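(* Let $(\mathbf u,\mathbf z,p,\lambda)\in \mathbf V\times\mathbf V\times Q\times Q$ solve the continuous optimality system \[ \begin{aligned} \nu(\nabla\mathbf u,\nabla\boldsymbol\varphi)+(\mathrm{div}\,\boldsymbol\varphi,p)+\alpha^{-1/2}(\mathbf z,\boldsymbol\varphi)&=(\mathbf f,\boldsymbol\varphi)&&\forall\boldsymbol\varphi\in\mathbf V,\\ (\mathrm{div}\,\mathbf u,\psi)&=0&&\forall\psi\in Q,\\ \nu(\nabla\boldsymbol\varphi,\nabla\mathbf z)+(\mathrm{div}\,\boldsymbol\varphi,\lambda)-\alpha^{-1/2}(\mathbf u,\boldsymbol\varphi)&=-\alpha^{-1/2}(\mathbf u^{\mathrm d},\boldsymbol\varphi)&&\forall\boldsymbol\varphi\in\mathbf V,\\ (\mathrm{div}\,\mathbf z,\psi)&=0&&\forall\psi\in Q, \end{aligned} \] and assume it is sufficiently smooth, namely $\mathbf u,\mathbf z\in H^2(\Omega;\mathbb R^n)$ and $p,\lambda\in H^1(\Omega)$. Let $\Pi$ be a reconstruction operator and let $(\mathbf u_h,\mathbf z_h,p_h,\lambda_h)\in\mathbf V_h\times\mathbf V_h\times Q_h\times Q_h$ solve the fully pressure-robust discrete system \[ \begin{aligned} \nu(\nabla\mathbf u_h,\nabla\boldsymbol\varphi_h)+(\mathrm{div}\,\boldsymbol\varphi_h,p_h)&=(\mathbf f-\alpha^{-1/2}\Pi\mathbf z_h,\Pi\boldsymbol\varphi_h)&&\forall\boldsymbol\varphi_h\in\mathbf V_h,\\ (\mathrm{div}\,\mathbf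 u_h,\psi_h)&=0&&\forall\psi_h\in Q_h,\\ \nu(\nabla\boldsymbol\varphi_h,\nabla\mathbf z_h)+(\mathrm{div}\,\boldsymbol\varphi_h,\lambda_h)&=\alpha^{-1/2}(\Pi\mathbf u_h-\mathbf u^{\mathrm d},\Pi\boldsymbol\varphi_h)&&\forall\boldsymbol\varphi_h\in\mathbf V_h,\\ (\mathrm{div}\,\mathbf z_h,\psi_h)&=0&&\forall\psi_h\in Q_h. \end{aligned} \] Then \[ \begin{aligned} |||(\mathbb S_h\mathbf u-\mathbf u_h,\ \mathbb S_h\mathbf z-\mathbf z_h)|||\le{}&\Bigl(\|\Delta\mathbf u\circ(1-\Pi)\|^2_{(\mathbf V_h^0)^\star}+\|\Delta\mathbf z\circ(1-\Pi)\|^2_{(\mathbf V_h^0)^\star}\Bigr)^{1/2}\\ &+\frac{1}{\nu\alpha^{1/2}}\Bigl(\|(1-\Pi\mathbb S_h)\mathbf u\circ\Pi\|^2_{(\mathbf V_h^0)^\star}+\|(1-\Pi\mathbb S_h)\mathbf z\circ\Pi\|^2_{(\mathbf V_h^0)^\star}\Bigr)^{1/2}. \end{aligned} \] Moreover, assume that the Stokes problem on $\Omega$ is $H^2$-regular, and that $\Pi$ satisfies the approximation property (A) and the consistency property (B) stated in the context for the polynomial order $k\ge1$. Then for $\mathbf w\in\{\mathbf u,\mathbf z\}$ (assumed to be in $H^{k+1}(\Omega;\mathbb R^n)$), \[ \|\Delta\mathbf w\circ(1-\Pi)\|_{(\mathbf V_h^0)^\star}\lesssim h^k\|\Delta\mathbf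 w\|_{H^{k-1}(\Omega)}, \qquad \|(1-\Pi\mathbb S_h)\mathbf w\circ\Pi\|_{(\mathbf V_h^0)^\star}\lesssim h^{k+1}\|\mathbf w\|_{H^{k+1}(\Omega)}, \] where $a\lesssim b$ means $a\le Cb$ with a constant $C$ independent of the mesh size $h$ and of $\mathbf w$.
   Context: Setting: $\Omega\subset\mathbb R^n$, $n\le3$, is a bounded Lipschitz domain; $\nu>0$, $\alpha>0$; $\mathbf f,\mathbf u^{\mathrm d}\in L^2(\Omega;\mathbb R^n)$; $\mathbf V=H^1_0(\Omega;\mathbb R^n)$, $Q=L^2_0(\Omega)$ (mean-zero $L^2$ functions); $(\cdot,\cdot)$ is the $L^2(\Omega)$ inner product. (The continuous system is the optimality system of minimizing $\frac12\|\mathbf u-\mathbf u^{\mathrm d}\|^2_{L^2}+\frac\alpha2\|\mathbf q\|^2_{L^2}$ subject to the Stokes equations with right-hand side $\mathbf f+\mathbf q$, where $\mathbf q=-\alpha^{-1/2}\mathbf z$.) Discrete spaces: for mesh sizes $h$ in a bounded set, $\mathbf V_h\times Q_h\subset\mathbf V\times Q$ is a family of finite-dimensional inf-sup stable pairs (discrete inf-sup constants bounded below by a positive constant independent of $h$). The discretely divergence-free space is \[\mathbf V_h^0=\{\boldsymbol\varphi_h\in\mathbf V_h:(\mathrm{div}\,\boldsymbol\varphi_h,\psi_h)=0\ \ \forall\psi_h\in Q_h\}.\] The order of the method is $k\ge1$, used only in the second part of the claim: for $1\le s\le k$, $\inf_{\boldsymbol\varphi_h\in\mathbf V_h}\|\nabla(\mathbf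 w-\boldsymbol\varphi_h)\|_{L^2}\lesssim h^s\|\mathbf w\|_{H^{s+1}}$ for all $\mathbf w\in\mathbf V\cap H^{s+1}$, and $\inf_{\psi_h\in Q_h}\|\psi-\psi_h\|_{L^2}\lesssim h\|\psi\|_{H^1}$ for all $\psi\in Q\cap H^1$. Stokes projector: for $\mathbf w\in\mathbf V$, $\mathbb S_h\mathbf w\in\mathbf V_h^0$ is defined by $(\nabla(\mathbf w-\mathbb S_h\mathbf w),\nabla\boldsymbol\varphi_h)=0$ for all $\boldsymbol\varphi_h\in\mathbf V_h^0$. Energy norm: $|||(\mathbf v,\mathbf y)|||^2=\|\nabla\mathbf v\|^2_{L^2(\Omega)}+\|\nabla\mathbf y\|^2_{L^2(\Omega)}$. Reconstruction operator: a linear operator $\Pi:\mathbf V_h+\mathbf V\to\mathbf W_h$, with $\mathbf W_h\subset L^2(\Omega;\mathbb R^n)$ a finite-dimensional space, that maps discretely divergence-free functions to exactly divergence-free ones: for every $\boldsymbol\varphi_h\in\mathbf V_h^0$, $\Pi\boldsymbol\varphi_h\in H(\mathrm{div},\Omega)$, $\mathrm{div}\,\Pi\boldsymbol\varphi_h=0$, and the normal trace of $\Pi\boldsymbol\varphi_h$ on $\partial\Omega$ vanishes (so that $(\nabla\psi,\Pi\boldsymbol\varphi_h)=0$ for all $\psi\in H^1(\Omega)$). Dual norms: \[ \|\mathbf g\circ(1-\Pi)\|_{(\mathbf V_h^0)^\star}:=\sup_{0\ne\boldsymbol\varphi_h\in\mathbf V_h^0}\frac{(\mathbf g,(1-\Pi)\boldsymbol\varphi_h)}{\|\nabla\boldsymbol\varphi_h\|_{L^2(\Omega)}},\qquad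 \|\mathbf g\circ\Pi\|_{(\mathbf V_h^0)^\star}:=\sup_{0\ne\boldsymbol\varphi_h\in\mathbf V_h^0}\frac{(\mathbf g,\Pi\boldsymbol\varphi_h)}{\|\nabla\boldsymbol\varphi_h\|_{L^2(\Omega)}} \] for $\mathbf g\in L^2(\Omega;\mathbb R^n)$; here $(1-\Pi\mathbb S_h)\mathbf w=\mathbf w-\Pi\mathbb S_h\mathbf w$. Properties of $\Pi$ used in the second part: (A) $\|\boldsymbol\varphi-\Pi\boldsymbol\varphi\|_{L^2(\Omega)}\lesssim h^m\|\boldsymbol\varphi\|_{H^m(\Omega)}$ for all $m\in\{1,\dots,k+1\}$ and all $\boldsymbol\varphi\in\mathbf V\cap H^m(\Omega;\mathbb R^n)$. (B) $\|\mathbf g\circ(1-\Pi)\|_{(\mathbf V_h^0)^\star}\lesssim h^k\|\mathbf g\|_{H^{k-1}(\Omega)}$ for all $\mathbf g\in H^{k-1}(\Omega;\mathbb R^n)$. $H^2$-regularity of the Stokes problem: for every $\mathbf g\in L^2(\Omega;\mathbb R^n)$ the solution $(\mathbf v,r)\in\mathbf V\times Q$ of $(\nabla\mathbf v,\nabla\boldsymbol\varphi)+(r,\mathrm{div}\,\boldsymbol\varphi)=(\mathbf g,\boldsymbol\varphi)$ for all $\boldsymbol\varphi\in\mathbf V$, $(\mathrm{div}\,\mathbf v,\psi)=0$ for all $\psi\in Q$, satisfies $\mathbf v\in H^2$, $r\in H^1$ and $\|\mathbf v\|_{H^2}+\|r\|_{H^1}\lesssim\|\mathbf g\|_{L^2}$.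 *)

theory Defs
  imports "HOL-Analysis.Analysis"
begin

text \<open>
  Elements of Lebesgue and Sobolev spaces are represented by functions on the whole of
  \<open>real ^ 'n\<close>; two functions denote the same element iff they agree almost everywhere on \<open>\<Omega>\<close>,
  and values outside \<open>\<Omega>\<close> are irrelevant.
\<close>

definition lipschitz_domain :: "(real ^ 'n) set \<Rightarrow> bool" where
  "lipschitz_domain \<Omega> \<longleftrightarrow> open \<Omega> \<and> connected \<Omega> \<and> \<Omega> \<noteq> {} \<and>
    (\<forall>x0 \<in> frontier \<Omega>. \<exists>r > 0. \<exists>e \<gamma> L. norm e = 1 \<and> L-lipschitz_on {y. y \<bullet> e = 0} \<gamma> \<and>
      \<Omega> \<inter> ball x0 r = {x \<in> ball x0 r. \<gamma> (x - (x \<bullet> e) *\<^sub>R e) < x \<bullet> e})"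


subsection \<open>Lebesgue spaces\<close>

definition ae_eq :: "(real ^ 'n) set \<Rightarrow> (real ^ 'n \<Rightarrow> 'b) \<Rightarrow> (real ^ 'n \<Rightarrow> 'b) \<Rightarrow> bool" where
  "ae_eq \<Omega> f g \<longleftrightarrow> (AE x in lebesgue_on \<Omega>. f x = g x)"

definition L2 :: "(real ^ 'n) set \<Rightarrow> (real ^ 'n \<Rightarrow> 'b::euclidean_space) set" where
  "L2 \<Omega> = {f \<in> borel_measurable (lebesgue_on \<Omega>). integrable (lebesgue_on \<Omega>) (\<lambda>x. (norm (f x))\<^sup>2)}"

definition L2_inner ::
    "(real ^ 'n) set \<Rightarrow> (real ^ 'n \<Rightarrow> 'b::euclidean_space) \<Rightarrow> (real ^ 'n \<Rightarrow> 'b) \<Rightarrow> real" where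
  "L2_inner \<Omega> f g = integral\<^sup>L (lebesgue_on \<Omega>) (\<lambda>x. f x \<bullet> g x)"

definition L2_norm :: "(real ^ 'n) set \<Rightarrow> (real ^ 'n \<Rightarrow> 'b::euclidean_space) \<Rightarrow> real" where
  "L2_norm \<Omega> f = sqrt (L2_inner \<Omega> f f)"

definition L2_mean_zero :: "(real ^ 'n) set \<Rightarrow> (real ^ 'n \<Rightarrow> real) set" where
  "L2_mean_zero \<Omega> = {q \<in> L2 \<Omega>. integral\<^sup>L (lebesgue_on \<Omega>) q = 0}"


subsection \<open>Sobolev spaces\<close>

definition partial_deriv ::
    "'n::finite \<Rightarrow> (real ^ 'n \<Rightarrow> 'b::real_normed_vector) \<Rightarrow> real ^ 'n \<Rightarrow> 'b" where
  "partial_deriv i f x = frechet_derivative f (at x) (axis i 1)"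

fun partial_derivs ::
    "'n::finite list \<Rightarrow> (real ^ 'n \<Rightarrow> 'b::real_normed_vector) \<Rightarrow> real ^ 'n \<Rightarrow> 'b" where
  "partial_derivs [] f = f"
| "partial_derivs (i # is) f = partial_deriv i (partial_derivs is f)"

definition test_functions ::
    "(real ^ 'n) set \<Rightarrow> (real ^ 'n \<Rightarrow> 'b::real_normed_vector) set" where
  "test_functions \<Omega> = {\<phi>. (\<forall>is. partial_derivs is \<phi> differentiable_on UNIV) \<and>
     (\<exists>K. compact K \<and> K \<subseteq> \<Omega> \<and> (\<forall>x. x \<notin> K \<longrightarrow> \<phi> x = 0))}"

text \<open>
  A list of coordinate directions plays the role of a multi-index; its length is the order of
  the derivative.
\<close>

definition has_weak_deriv ::
    "(real ^ 'n) set \<Rightarrow> 'n::finite list \<Rightarrow> (real ^ 'n \<Rightarrow> 'b::euclidean_space) \<Rightarrow>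
     (real ^ 'n \<Rightarrow> 'b) \<Rightarrow> bool" where
  "has_weak_deriv \<Omega> is u g \<longleftrightarrow> (\<forall>\<phi> :: real ^ 'n \<Rightarrow> real. \<phi> \<in> test_functions \<Omega> \<longrightarrow>
     integral\<^sup>L (lebesgue_on \<Omega>) (\<lambda>x. partial_derivs is \<phi> x *\<^sub>R u x) =
     (- 1) ^ length is *\<^sub>R integral\<^sup>L (lebesgue_on \<Omega>) (\<lambda>x. \<phi> x *\<^sub>R g x))"

definition weak_deriv ::
    "(real ^ 'n) set \<Rightarrow> 'n::finite list \<Rightarrow> (real ^ 'n \<Rightarrow> 'b::euclidean_space) \<Rightarrow>
     real ^ 'n \<Rightarrow> 'b" where
  "weak_deriv \<Omega> is u = (SOME g. g \<in> L2 \<Omega> \<and> has_weak_deriv \<Omega> is u g)"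

definition Sobolev ::
    "nat \<Rightarrow> (real ^ 'n::finite) set \<Rightarrow> (real ^ 'n \<Rightarrow> 'b::euclidean_space) set" where
  "Sobolev m \<Omega> =
     {u \<in> L2 \<Omega>. \<forall>is. length is \<le> m \<longrightarrow> (\<exists>g \<in> L2 \<Omega>. has_weak_deriv \<Omega> is u g)}"

text \<open>
  The sum runs over all entries of the derivative tensors of order at most \<open>m\<close>, so each mixed
  derivative is counted once for every ordering of its directions.
\<close>

definition Sobolev_norm ::
    "nat \<Rightarrow> (real ^ 'n::finite) set \<Rightarrow> (real ^ 'n \<Rightarrow> 'b::euclidean_space) \<Rightarrow> real" where
  "Sobolev_norm m \<Omega> u =
     sqrt (\<Sum>is \<in> {is. length is \<le> m}. (L2_norm \<Omega> (weak_deriv \<Omega> is u))\<^sup>2)"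

definition H10 :: "(real ^ 'n::finite) set \<Rightarrow> (real ^ 'n \<Rightarrow> 'b::euclidean_space) set" where
  "H10 \<Omega> = {u \<in> Sobolev 1 \<Omega>.
     \<forall>\<epsilon> > 0. \<exists>\<phi> \<in> test_functions \<Omega>. Sobolev_norm 1 \<Omega> (\<lambda>x. u x - \<phi> x) < \<epsilon>}"

text \<open>
  For vector fields, \<open>grad\<close> is the transposed Jacobian matrix; the inner product of
  \<open>real ^ 'n ^ 'n\<close> is the Frobenius product.
\<close>

definition grad ::
    "(real ^ 'n::finite) set \<Rightarrow> (real ^ 'n \<Rightarrow> 'b::euclidean_space) \<Rightarrow> real ^ 'n \<Rightarrow> 'b ^ 'n" where
  "grad \<Omega> u x = (\<chi> i. weak_deriv \<Omega> [i] u x)"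

definition laplacian ::
    "(real ^ 'n::finite) set \<Rightarrow> (real ^ 'n \<Rightarrow> 'b::euclidean_space) \<Rightarrow> real ^ 'n \<Rightarrow> 'b" where
  "laplacian \<Omega> u x = (\<Sum>i\<in>UNIV. weak_deriv \<Omega> [i, i] u x)"

definition has_weak_div ::
    "(real ^ 'n::finite) set \<Rightarrow> (real ^ 'n \<Rightarrow> real ^ 'n) \<Rightarrow> (real ^ 'n \<Rightarrow> real) \<Rightarrow> bool" where
  "has_weak_div \<Omega> v d \<longleftrightarrow> (\<forall>\<phi> :: real ^ 'n \<Rightarrow> real. \<phi> \<in> test_functions \<Omega> \<longrightarrow>
     L2_inner \<Omega> v (\<lambda>x. \<chi> i. partial_deriv i \<phi> x) = - L2_inner \<Omega> d \<phi>)"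

definition Hdiv :: "(real ^ 'n::finite) set \<Rightarrow> (real ^ 'n \<Rightarrow> real ^ 'n) set" where
  "Hdiv \<Omega> = {v \<in> L2 \<Omega>. \<exists>d \<in> L2 \<Omega>. has_weak_div \<Omega> v d}"

definition weak_div ::
    "(real ^ 'n::finite) set \<Rightarrow> (real ^ 'n \<Rightarrow> real ^ 'n) \<Rightarrow> real ^ 'n \<Rightarrow> real" where
  "weak_div \<Omega> v = (SOME d. d \<in> L2 \<Omega> \<and> has_weak_div \<Omega> v d)"

text \<open>
  The normal trace of a field in \<open>Hdiv \<Omega>\<close>, as a functional on \<open>H\<^sup>1(\<Omega>)\<close>
  (equivalently on the traces of its elements), given by Green's formula.
\<close>

definition normal_trace ::
    "(real ^ 'n::finite) set \<Rightarrow> (real ^ 'n \<Rightarrow> real ^ 'n) \<Rightarrow> (real ^ 'n \<Rightarrow> real) \<Rightarrow> real" where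
  "normal_trace \<Omega> v \<psi> = L2_inner \<Omega> (grad \<Omega> \<psi>) v + L2_inner \<Omega> \<psi> (weak_div \<Omega> v)"


subsection \<open>Discrete spaces\<close>

definition fin_dim_subspace ::
    "(real ^ 'n::finite) set \<Rightarrow> (real ^ 'n \<Rightarrow> 'b::euclidean_space) set \<Rightarrow>
     (real ^ 'n \<Rightarrow> 'b) set \<Rightarrow> bool" where
  "fin_dim_subspace \<Omega> S X \<longleftrightarrow> S \<subseteq> X \<and> (\<lambda>x. 0) \<in> S \<and>
     (\<forall>v \<in> S. \<forall>w \<in> S. \<forall>a b. (\<lambda>x. a *\<^sub>R v x + b *\<^sub>R w x) \<in> S) \<and>
     (\<exists>(N::nat) B. \<forall>v \<in> S. \<exists>c. ae_eq \<Omega> v (\<lambda>x. \<Sum>i<N. c i *\<^sub>R B i x))"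

text \<open>
  Adjoining \<open>0\<close> to the sets of quotients below only matters if there is no nonzero
  function to take the supremum over: otherwise these sets are symmetric about \<open>0\<close>.
\<close>

definition inf_sup_stable ::
    "(real ^ 'n::finite) set \<Rightarrow> real set \<Rightarrow> (real \<Rightarrow> (real ^ 'n \<Rightarrow> real ^ 'n) set) \<Rightarrow>
     (real \<Rightarrow> (real ^ 'n \<Rightarrow> real) set) \<Rightarrow> bool" where
  "inf_sup_stable \<Omega> I Vh Qh \<longleftrightarrow> (\<exists>\<beta> > 0. \<forall>h \<in> I. \<forall>q \<in> Qh h. \<not> ae_eq \<Omega> q (\<lambda>x. 0) \<longrightarrow>
     \<beta> \<le> Sup (insert 0 {L2_inner \<Omega> (weak_div \<Omega> v) q / (L2_norm \<Omega> (grad \<Omega> v) * L2_norm \<Omega> q) | v.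
                          v \<in> Vh h \<and> \<not> ae_eq \<Omega> v (\<lambda>x. 0)}))"

definition discr_div_free ::
    "(real ^ 'n::finite) set \<Rightarrow> (real ^ 'n \<Rightarrow> real ^ 'n) set \<Rightarrow> (real ^ 'n \<Rightarrow> real) set \<Rightarrow>
     (real ^ 'n \<Rightarrow> real ^ 'n) set" where
  "discr_div_free \<Omega> V Q = {v \<in> V. \<forall>q \<in> Q. L2_inner \<Omega> (weak_div \<Omega> v) q = 0}"

definition stokes_projector ::
    "(real ^ 'n::finite) set \<Rightarrow> (real ^ 'n \<Rightarrow> real ^ 'n) set \<Rightarrow> (real ^ 'n \<Rightarrow> real) set \<Rightarrow>
     (real ^ 'n \<Rightarrow> real ^ 'n) \<Rightarrow> real ^ 'n \<Rightarrow> real ^ 'n" where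
  "stokes_projector \<Omega> V Q w = (SOME v. v \<in> discr_div_free \<Omega> V Q \<and>
     (\<forall>\<phi> \<in> discr_div_free \<Omega> V Q. L2_inner \<Omega> (grad \<Omega> (\<lambda>x. w x - v x)) (grad \<Omega> \<phi>) = 0))"

definition energy_norm ::
    "(real ^ 'n::finite) set \<Rightarrow> (real ^ 'n \<Rightarrow> real ^ 'n) \<Rightarrow> (real ^ 'n \<Rightarrow> real ^ 'n) \<Rightarrow> real" where
  "energy_norm \<Omega> v y = sqrt ((L2_norm \<Omega> (grad \<Omega> v))\<^sup>2 + (L2_norm \<Omega> (grad \<Omega> y))\<^sup>2)"

text \<open>
  \<open>dual_norm \<Omega> V Q T g\<close> is the norm of \<open>\<phi> \<mapsto> (g, T \<phi>)\<close> as a functional on the discretely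
  divergence-free space, used with \<open>T = 1 - \<Pi>\<close> and \<open>T = \<Pi>\<close>.
\<close>

definition dual_norm ::
    "(real ^ 'n::finite) set \<Rightarrow> (real ^ 'n \<Rightarrow> real ^ 'n) set \<Rightarrow> (real ^ 'n \<Rightarrow> real) set \<Rightarrow>
     ((real ^ 'n \<Rightarrow> real ^ 'n) \<Rightarrow> real ^ 'n \<Rightarrow> real ^ 'n) \<Rightarrow> (real ^ 'n \<Rightarrow> real ^ 'n) \<Rightarrow> real" where
  "dual_norm \<Omega> V Q T g =
     Sup (insert 0 {L2_inner \<Omega> g (T \<phi>) / L2_norm \<Omega> (grad \<Omega> \<phi>) | \<phi>.
                      \<phi> \<in> discr_div_free \<Omega> V Q \<and> \<not> ae_eq \<Omega> \<phi> (\<lambda>x. 0)})"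

definition compl_op :: "((real ^ 'n \<Rightarrow> real ^ 'n) \<Rightarrow> real ^ 'n \<Rightarrow> real ^ 'n) \<Rightarrow>
    (real ^ 'n \<Rightarrow> real ^ 'n) \<Rightarrow> real ^ 'n \<Rightarrow> real ^ 'n" where
  "compl_op T \<phi> = (\<lambda>x. \<phi> x - T \<phi> x)"

text \<open>
  Since functions are representatives of classes, linearity is required almost everywhere, and
  the operator has to respect almost-everywhere equality.
\<close>

definition reconstruction_operator ::
    "(real ^ 'n::finite) set \<Rightarrow> (real ^ 'n \<Rightarrow> real ^ 'n) set \<Rightarrow> (real ^ 'n \<Rightarrow> real) set \<Rightarrow>
     (real ^ 'n \<Rightarrow> real ^ 'n) set \<Rightarrow>
     ((real ^ 'n \<Rightarrow> real ^ 'n) \<Rightarrow> real ^ 'n \<Rightarrow> real ^ 'n) \<Rightarrow> bool" where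
  "reconstruction_operator \<Omega> V Q W T \<longleftrightarrow>
     fin_dim_subspace \<Omega> W (L2 \<Omega>) \<and>
     (let D = {\<lambda>x. v x + w x | v w. v \<in> V \<and> w \<in> H10 \<Omega>} in
        (\<forall>v \<in> D. T v \<in> W) \<and>
        (\<forall>v \<in> D. \<forall>w \<in> D. ae_eq \<Omega> v w \<longrightarrow> ae_eq \<Omega> (T v) (T w)) \<and>
        (\<forall>v \<in> D. \<forall>w \<in> D. \<forall>a b.
           ae_eq \<Omega> (T (\<lambda>x. a *\<^sub>R v x + b *\<^sub>R w x)) (\<lambda>x. a *\<^sub>R T v x + b *\<^sub>R T w x))) \<and>
     (\<forall>\<phi> \<in> discr_div_free \<Omega> V Q. T \<phi> \<in> Hdiv \<Omega> \<and> ae_eq \<Omega> (weak_div \<Omega> (T \<phi>)) (\<lambda>x. 0) \<and>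
        (\<forall>\<psi> \<in> Sobolev 1 \<Omega>. normal_trace \<Omega> (T \<phi>) \<psi> = 0))"

definition approximation_order ::
    "(real ^ 'n::finite) set \<Rightarrow> real set \<Rightarrow> (real \<Rightarrow> (real ^ 'n \<Rightarrow> real ^ 'n) set) \<Rightarrow>
     (real \<Rightarrow> (real ^ 'n \<Rightarrow> real) set) \<Rightarrow> nat \<Rightarrow> bool" where
  "approximation_order \<Omega> I Vh Qh k \<longleftrightarrow>
     (\<exists>C. \<forall>h \<in> I. \<forall>s \<in> {1..k}. \<forall>w \<in> H10 \<Omega> \<inter> Sobolev (s + 1) \<Omega>.
        (INF \<phi> \<in> Vh h. L2_norm \<Omega> (grad \<Omega> (\<lambda>x. w x - \<phi> x))) \<le> C * h ^ s * Sobolev_norm (s + 1) \<Omega> w) \<and>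
     (\<exists>C. \<forall>h \<in> I. \<forall>\<psi> \<in> L2_mean_zero \<Omega> \<inter> Sobolev 1 \<Omega>.
        (INF \<psi>h \<in> Qh h. L2_norm \<Omega> (\<lambda>x. \<psi> x - \<psi>h x)) \<le> C * h * Sobolev_norm 1 \<Omega> \<psi>)"

definition reconstruction_approximation ::
    "(real ^ 'n::finite) set \<Rightarrow> real set \<Rightarrow>
     (real \<Rightarrow> (real ^ 'n \<Rightarrow> real ^ 'n) \<Rightarrow> real ^ 'n \<Rightarrow> real ^ 'n) \<Rightarrow> nat \<Rightarrow> bool" where
  "reconstruction_approximation \<Omega> I Rec k \<longleftrightarrow>
     (\<exists>C. \<forall>h \<in> I. \<forall>m \<in> {1..k + 1}. \<forall>\<phi> \<in> H10 \<Omega> \<inter> Sobolev m \<Omega>.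
        L2_norm \<Omega> (compl_op (Rec h) \<phi>) \<le> C * h ^ m * Sobolev_norm m \<Omega> \<phi>)"

definition reconstruction_consistency ::
    "(real ^ 'n::finite) set \<Rightarrow> real set \<Rightarrow> (real \<Rightarrow> (real ^ 'n \<Rightarrow> real ^ 'n) set) \<Rightarrow>
     (real \<Rightarrow> (real ^ 'n \<Rightarrow> real) set) \<Rightarrow>
     (real \<Rightarrow> (real ^ 'n \<Rightarrow> real ^ 'n) \<Rightarrow> real ^ 'n \<Rightarrow> real ^ 'n) \<Rightarrow> nat \<Rightarrow> bool" where
  "reconstruction_consistency \<Omega> I Vh Qh Rec k \<longleftrightarrow>
     (\<exists>C. \<forall>h \<in> I. \<forall>g \<in> Sobolev (k - 1) \<Omega>.
        dual_norm \<Omega> (Vh h) (Qh h) (compl_op (Rec h)) g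
          \<le> C * h ^ k * Sobolev_norm (k - 1) \<Omega> g)"


subsection \<open>Stokes problem and optimality systems\<close>

definition stokes_solution ::
    "(real ^ 'n::finite) set \<Rightarrow> (real ^ 'n \<Rightarrow> real ^ 'n) \<Rightarrow> (real ^ 'n \<Rightarrow> real ^ 'n) \<Rightarrow>
     (real ^ 'n \<Rightarrow> real) \<Rightarrow> bool" where
  "stokes_solution \<Omega> g v r \<longleftrightarrow> v \<in> H10 \<Omega> \<and> r \<in> L2_mean_zero \<Omega> \<and>
     (\<forall>\<phi> \<in> H10 \<Omega>. L2_inner \<Omega> (grad \<Omega> v) (grad \<Omega> \<phi>) + L2_inner \<Omega> r (weak_div \<Omega> \<phi>)
                    = L2_inner \<Omega> g \<phi>) \<and>
     (\<forall>\<psi> \<in> L2_mean_zero \<Omega>. L2_inner \<Omega> (weak_div \<Omega> v) \<psi> = 0)"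

definition stokes_H2_regular :: "(real ^ 'n::finite) set \<Rightarrow> bool" where
  "stokes_H2_regular \<Omega> \<longleftrightarrow> (\<exists>C. \<forall>g \<in> L2 \<Omega>. (\<exists>v r. stokes_solution \<Omega> g v r) \<and>
     (\<forall>v r. stokes_solution \<Omega> g v r \<longrightarrow> v \<in> Sobolev 2 \<Omega> \<and> r \<in> Sobolev 1 \<Omega> \<and>
        Sobolev_norm 2 \<Omega> v + Sobolev_norm 1 \<Omega> r \<le> C * L2_norm \<Omega> g))"

definition optimality_system ::
    "(real ^ 'n::finite) set \<Rightarrow> real \<Rightarrow> real \<Rightarrow> (real ^ 'n \<Rightarrow> real ^ 'n) \<Rightarrow> (real ^ 'n \<Rightarrow> real ^ 'n) \<Rightarrow>
     (real ^ 'n \<Rightarrow> real ^ 'n) \<Rightarrow> (real ^ 'n \<Rightarrow> real ^ 'n) \<Rightarrow>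
     (real ^ 'n \<Rightarrow> real) \<Rightarrow> (real ^ 'n \<Rightarrow> real) \<Rightarrow> bool" where
  "optimality_system \<Omega> \<nu> \<alpha> f ud u z p l \<longleftrightarrow>
     u \<in> H10 \<Omega> \<and> z \<in> H10 \<Omega> \<and> p \<in> L2_mean_zero \<Omega> \<and> l \<in> L2_mean_zero \<Omega> \<and>
     (\<forall>\<phi> \<in> H10 \<Omega>.
        \<nu> * L2_inner \<Omega> (grad \<Omega> u) (grad \<Omega> \<phi>) + L2_inner \<Omega> (weak_div \<Omega> \<phi>) p
          + \<alpha> powr (-1/2) * L2_inner \<Omega> z \<phi> = L2_inner \<Omega> f \<phi>) \<and>
     (\<forall>\<psi> \<in> L2_mean_zero \<Omega>. L2_inner \<Omega> (weak_div \<Omega> u) \<psi> = 0) \<and>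
     (\<forall>\<phi> \<in> H10 \<Omega>.
        \<nu> * L2_inner \<Omega> (grad \<Omega> \<phi>) (grad \<Omega> z) + L2_inner \<Omega> (weak_div \<Omega> \<phi>) l
          - \<alpha> powr (-1/2) * L2_inner \<Omega> u \<phi> = - (\<alpha> powr (-1/2)) * L2_inner \<Omega> ud \<phi>) \<and>
     (\<forall>\<psi> \<in> L2_mean_zero \<Omega>. L2_inner \<Omega> (weak_div \<Omega> z) \<psi> = 0)"

definition discrete_optimality_system ::
    "(real ^ 'n::finite) set \<Rightarrow> (real ^ 'n \<Rightarrow> real ^ 'n) set \<Rightarrow> (real ^ 'n \<Rightarrow> real) set \<Rightarrow>
     ((real ^ 'n \<Rightarrow> real ^ 'n) \<Rightarrow> real ^ 'n \<Rightarrow> real ^ 'n) \<Rightarrow>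
     real \<Rightarrow> real \<Rightarrow> (real ^ 'n \<Rightarrow> real ^ 'n) \<Rightarrow> (real ^ 'n \<Rightarrow> real ^ 'n) \<Rightarrow>
     (real ^ 'n \<Rightarrow> real ^ 'n) \<Rightarrow> (real ^ 'n \<Rightarrow> real ^ 'n) \<Rightarrow>
     (real ^ 'n \<Rightarrow> real) \<Rightarrow> (real ^ 'n \<Rightarrow> real) \<Rightarrow> bool" where
  "discrete_optimality_system \<Omega> V Q T \<nu> \<alpha> f ud uh zh ph lh \<longleftrightarrow>
     uh \<in> V \<and> zh \<in> V \<and> ph \<in> Q \<and> lh \<in> Q \<and>
     (\<forall>\<phi> \<in> V.
        \<nu> * L2_inner \<Omega> (grad \<Omega> uh) (grad \<Omega> \<phi>) + L2_inner \<Omega> (weak_div \<Omega> \<phi>) ph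
          = L2_inner \<Omega> (\<lambda>x. f x - \<alpha> powr (-1/2) *\<^sub>R T zh x) (T \<phi>)) \<and>
     (\<forall>\<psi> \<in> Q. L2_inner \<Omega> (weak_div \<Omega> uh) \<psi> = 0) \<and>
     (\<forall>\<phi> \<in> V.
        \<nu> * L2_inner \<Omega> (grad \<Omega> \<phi>) (grad \<Omega> zh) + L2_inner \<Omega> (weak_div \<Omega> \<phi>) lh
          = \<alpha> powr (-1/2) * L2_inner \<Omega> (\<lambda>x. T uh x - ud x) (T \<phi>)) \<and>
     (\<forall>\<psi> \<in> Q. L2_inner \<Omega> (weak_div \<Omega> zh) \<psi> = 0)"

end

theory Submission
  imports Defs
begin

text \<open>
  The discrete systems are tested with discretely divergence-free functions only. By the strong
  form of the continuous equations, which follows from the fundamental lemma of the calculus of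
  variations, and because \<open>\<Pi>\<close> maps such functions to fields orthogonal to all gradients, the
  pressures drop out. The errors \<open>e\<^sub>u = S\<^sub>h u - u\<^sub>h\<close> and \<open>e\<^sub>z = S\<^sub>h z - z\<^sub>h\<close> satisfy
  \<open>\<nu> (\<nabla> e\<^sub>u, \<nabla> \<phi>) = - \<nu> (\<Delta> u, (1 - \<Pi>) \<phi>) - \<alpha>\<^bsup>-1/2\<^esup> ((1 - \<Pi> S\<^sub>h) z, \<Pi> \<phi>) - \<alpha>\<^bsup>-1/2\<^esup> (\<Pi> e\<^sub>z, \<Pi> \<phi>)\<close>
  and an analogous equation for \<open>e\<^sub>z\<close> with the opposite sign in the last two terms. On testing with
  \<open>e\<^sub>u\<close> and \<open>e\<^sub>z\<close> the coupling terms \<open>(\<Pi> e\<^sub>z, \<Pi> e\<^sub>u)\<close> cancel, and the Cauchy-Schwarz inequality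
  gives the energy bound.

  For the rates, \<open>(1 - \<Pi> S\<^sub>h) w = (1 - \<Pi>) w + \<Pi> (w - S\<^sub>h w)\<close>. Inf-sup stability makes \<open>S\<^sub>h w\<close>
  quasi-optimal in \<open>V\<^sub>h\<close> for divergence-free \<open>w\<close>, and an Aubin-Nitsche argument gains one power of
  \<open>h\<close> in \<open>L\<^sup>2\<close>.
\<close>

subsection \<open>The space \<open>L\<^sup>2\<close>\<close>

text \<open>The function \<open>\<Pi> \<phi>\<^sub>h\<close> lies in \<open>L2\<close> with
  controlled divergence but in general not in \<open>H10\<close>, so the weak equations cannot be
  tested with it; the strong form can, as it is an identity between \<open>L2\<close> functions. A
  second obstacle is that functions are representatives and that \<open>weak_deriv\<close>,
  \<open>weak_div\<close> and \<open>stokes_projector\<close> are selected by \<open>SOME\<close>: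
  uniqueness of weak derivatives up to null sets and existence of the projection have to be
  established before any of these can be used, and identities between derivatives hold almost
  everywhere only. A third is that \<open>Sup\<close> over the reals is informative for bounded sets
  only. Boundedness comes from bases of the discrete spaces that are orthonormal for the gradient
  inner product, which is definite on \<open>H10\<close> by the Poincare inequality; the same bases
  yield the projection and the Riesz representatives behind quasi-optimality. The coupling terms can
  cancel because the discrete system applies the reconstruction to the trial function of the
  coupling term as well as to the test function.\<close>

lemma ae_eq_refl: "ae_eq U f f"
  by (simp add: ae_eq_def)

lemma ae_eq_sym: "ae_eq U f g \<Longrightarrow> ae_eq U g f"
  by (simp add: ae_eq_def eq_commute)

lemma L2_measurable: "f \<in> L2 U \<Longrightarrow> f \<in> borel_measurable (lebesgue_on U)"
  by (simp add: L2_def)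

lemma L2_zero: "(\<lambda>x. 0) \<in> L2 U"
  by (simp add: L2_def)

lemma L2_add:
  assumes "f \<in> L2 U" "g \<in> L2 U"
  shows "(\<lambda>x. f x + g x) \<in> L2 U"
proof -
  have [measurable]: "f \<in> borel_measurable (lebesgue_on U)" "g \<in> borel_measurable (lebesgue_on U)"
    using assms by (auto simp: L2_def)
  have "(norm (f x + g x))\<^sup>2 \<le> 2 * (norm (f x))\<^sup>2 + 2 * (norm (g x))\<^sup>2" for x
  proof -
    have "(norm (f x + g x))\<^sup>2 \<le> (norm (f x) + norm (g x))\<^sup>2"
      by (intro power_mono norm_triangle_ineq) auto
    also have "\<dots> \<le> 2 * (norm (f x))\<^sup>2 + 2 * (norm (g x))\<^sup>2"
      using sum_squares_bound[of "norm (f x)" "norm (g x)"] by (simp add: power2_sum)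
    finally show ?thesis .
  qed
  moreover have "integrable (lebesgue_on U) (\<lambda>x. 2 * (norm (f x))\<^sup>2 + 2 * (norm (g x))\<^sup>2)"
    using assms by (auto simp: L2_def)
  ultimately have "integrable (lebesgue_on U) (\<lambda>x. (norm (f x + g x))\<^sup>2)"
    by (intro Bochner_Integration.integrable_bound[where g = "\<lambda>x. (norm (f x + g x))\<^sup>2"
          and f = "\<lambda>x. 2 * (norm (f x))\<^sup>2 + 2 * (norm (g x))\<^sup>2"]) auto
  then show ?thesis by (simp add: L2_def)
qed

lemma L2_scaleR: "f \<in> L2 U \<Longrightarrow> (\<lambda>x. c *\<^sub>R f x) \<in> L2 U"
  by (auto simp: L2_def power_mult_distrib)

lemma L2_lincomb: "f \<in> L2 U \<Longrightarrow> g \<in> L2 U \<Longrightarrow> (\<lambda>x. a *\<^sub>R f x + b *\<^sub>R g x) \<in> L2 U"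
  by (intro L2_add L2_scaleR)

lemma L2_diff: "f \<in> L2 U \<Longrightarrow> g \<in> L2 U \<Longrightarrow> (\<lambda>x. f x - g x) \<in> L2 U"
  using L2_lincomb[of f U g 1 "-1"] by simp

lemma L2_sum: "(\<And>i. i \<in> A \<Longrightarrow> f i \<in> L2 U) \<Longrightarrow> (\<lambda>x. \<Sum>i\<in>A. f i x) \<in> L2 U"
  by (induction A rule: infinite_finite_induct) (auto intro: L2_zero L2_add)

lemma L2_dominated:
  assumes "f \<in> L2 U" "g \<in> borel_measurable (lebesgue_on U)" "\<And>x. norm (g x) \<le> C * norm (f x)"
  shows "g \<in> L2 U"
proof -
  have [measurable]: "g \<in> borel_measurable (lebesgue_on U)" by fact
  have "integrable (lebesgue_on U) (\<lambda>x. C\<^sup>2 * (norm (f x))\<^sup>2)"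
    using assms by (simp add: L2_def)
  moreover have "(norm (g x))\<^sup>2 \<le> C\<^sup>2 * (norm (f x))\<^sup>2" for x
    using power_mono[OF assms(3) norm_ge_zero, of x 2] by (simp add: power_mult_distrib)
  ultimately have "integrable (lebesgue_on U) (\<lambda>x. (norm (g x))\<^sup>2)"
    by (intro Bochner_Integration.integrable_bound[where g = "\<lambda>x. (norm (g x))\<^sup>2"
          and f = "\<lambda>x. C\<^sup>2 * (norm (f x))\<^sup>2"]) auto
  then show ?thesis by (simp add: L2_def)
qed

lemma L2_linear_image:
  fixes T :: "'b::euclidean_space \<Rightarrow> 'c::euclidean_space"
  assumes "bounded_linear T" "f \<in> L2 U"
  shows "(\<lambda>x. T (f x)) \<in> L2 U"
proof -
  interpret bounded_linear T by fact
  obtain K where K: "\<And>x. norm (T x) \<le> norm x * K" using bounded by blast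
  have [measurable]: "T \<in> borel_measurable borel"
    by (intro borel_measurable_continuous_onI continuous_on continuous_on_id)
  have "(\<lambda>x. T (f x)) \<in> borel_measurable (lebesgue_on U)"
    using L2_measurable[OF assms(2)] by measurable
  then show ?thesis
    by (rule L2_dominated[OF assms(2), where C = K]) (simp add: K mult.commute[of K])
qed

lemma L2_inner_integrable:
  assumes "f \<in> L2 U" "g \<in> L2 U"
  shows "integrable (lebesgue_on U) (\<lambda>x. f x \<bullet> g x)"
proof -
  have [measurable]: "f \<in> borel_measurable (lebesgue_on U)" "g \<in> borel_measurable (lebesgue_on U)"
    using assms by (auto simp: L2_def)
  have "\<bar>f x \<bullet> g x\<bar> \<le> (norm (f x))\<^sup>2 + (norm (g x))\<^sup>2" for x
    using Cauchy_Schwarz_ineq2[of "f x" "g x"] sum_squares_bound[of "norm (f x)" "norm (g x)"]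
      mult_nonneg_nonneg[OF norm_ge_zero norm_ge_zero, of "f x" "g x"]
    by linarith
  moreover have "integrable (lebesgue_on U) (\<lambda>x. (norm (f x))\<^sup>2 + (norm (g x))\<^sup>2)"
    using assms by (auto simp: L2_def)
  ultimately show ?thesis
    by (intro Bochner_Integration.integrable_bound[where g = "\<lambda>x. f x \<bullet> g x"
          and f = "\<lambda>x. (norm (f x))\<^sup>2 + (norm (g x))\<^sup>2"]) auto
qed

lemma L2_scaleR_integrable:
  fixes f :: "real ^ 'n \<Rightarrow> real"
  assumes "f \<in> L2 U" "g \<in> L2 U"
  shows "integrable (lebesgue_on U) (\<lambda>x. f x *\<^sub>R g x)"
proof -
  have [measurable]: "f \<in> borel_measurable (lebesgue_on U)" "g \<in> borel_measurable (lebesgue_on U)"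
    using assms by (auto simp: L2_def)
  have "norm (f x *\<^sub>R g x) \<le> (norm (f x))\<^sup>2 + (norm (g x))\<^sup>2" for x
    using sum_squares_bound[of "norm (f x)" "norm (g x)"]
      mult_nonneg_nonneg[OF norm_ge_zero norm_ge_zero, of "f x" "g x"]
    unfolding norm_scaleR real_norm_def by linarith
  moreover have "integrable (lebesgue_on U) (\<lambda>x. (norm (f x))\<^sup>2 + (norm (g x))\<^sup>2)"
    using assms by (auto simp: L2_def)
  ultimately show ?thesis
    by (intro Bochner_Integration.integrable_bound[where g = "\<lambda>x. f x *\<^sub>R g x"
          and f = "\<lambda>x. (norm (f x))\<^sup>2 + (norm (g x))\<^sup>2"]) auto
qed

lemma L2_inner_cong:
  assumes "ae_eq U f f'" "ae_eq U g g'" "f \<in> L2 U" "f' \<in> L2 U" "g \<in> L2 U" "g' \<in> L2 U"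
  shows "L2_inner U f g = L2_inner U f' g'"
  unfolding L2_inner_def
proof (rule integral_cong_AE)
  show "AE x in lebesgue_on U. f x \<bullet> g x = f' x \<bullet> g' x"
    using assms(1,2) unfolding ae_eq_def by eventually_elim auto
qed (use assms in \<open>auto simp: L2_def\<close>)

lemma L2_norm_cong: "ae_eq U f g \<Longrightarrow> f \<in> L2 U \<Longrightarrow> g \<in> L2 U \<Longrightarrow> L2_norm U f = L2_norm U g"
  unfolding L2_norm_def by (simp add: L2_inner_cong[of U f g f g])

lemma L2_inner_commute: "L2_inner U f g = L2_inner U g f"
  by (simp add: L2_inner_def inner_commute)

lemma L2_inner_lincomb_left:
  assumes "f \<in> L2 U" "g \<in> L2 U" "k \<in> L2 U"
  shows "L2_inner U (\<lambda>x. a *\<^sub>R f x + b *\<^sub>R g x) k = a * L2_inner U f k + b * L2_inner U g k"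
  using assms by (simp add: L2_inner_def inner_add_left L2_inner_integrable)

lemma L2_inner_lincomb_right:
  assumes "f \<in> L2 U" "g \<in> L2 U" "k \<in> L2 U"
  shows "L2_inner U k (\<lambda>x. a *\<^sub>R f x + b *\<^sub>R g x) = a * L2_inner U k f + b * L2_inner U k g"
  using assms by (simp add: L2_inner_commute[of U k] L2_inner_lincomb_left)

lemma L2_inner_diff_left:
  assumes "f \<in> L2 U" "g \<in> L2 U" "k \<in> L2 U"
  shows "L2_inner U (\<lambda>x. f x - g x) k = L2_inner U f k - L2_inner U g k"
  using L2_inner_lincomb_left[OF assms, of 1 "-1"] by simp

lemma L2_inner_diff_right:
  assumes "f \<in> L2 U" "g \<in> L2 U" "k \<in> L2 U"
  shows "L2_inner U k (\<lambda>x. f x - g x) = L2_inner U k f - L2_inner U k g"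
  using L2_inner_lincomb_right[OF assms, of 1 "-1"] by simp

lemma L2_inner_scaleR_left: "L2_inner U (\<lambda>x. a *\<^sub>R f x) k = a * L2_inner U f k"
  by (simp add: L2_inner_def)

lemma L2_inner_scaleR_right: "L2_inner U k (\<lambda>x. a *\<^sub>R f x) = a * L2_inner U k f"
  by (simp add: L2_inner_def)

lemma L2_inner_zero_left [simp]: "L2_inner U (\<lambda>x. 0) k = 0"
  by (simp add: L2_inner_def)

lemma L2_inner_zero_right [simp]: "L2_inner U k (\<lambda>x. 0) = 0"
  by (simp add: L2_inner_def)

lemma L2_inner_nonneg: "0 \<le> L2_inner U f f"
  unfolding L2_inner_def by (rule integral_nonneg_AE) simp

lemma L2_norm_nonneg: "0 \<le> L2_norm U f"
  by (simp add: L2_norm_def L2_inner_nonneg)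

lemma L2_norm_square: "(L2_norm U f)\<^sup>2 = L2_inner U f f"
  by (simp add: L2_norm_def L2_inner_nonneg)

lemma L2_norm_zero [simp]: "L2_norm U (\<lambda>x. 0) = 0"
  by (simp add: L2_norm_def)

lemma L2_norm_eq_0_iff:
  assumes "f \<in> L2 U"
  shows "L2_norm U f = 0 \<longleftrightarrow> ae_eq U f (\<lambda>x. 0)"
proof -
  have "L2_norm U f = 0 \<longleftrightarrow> integral\<^sup>L (lebesgue_on U) (\<lambda>x. f x \<bullet> f x) = 0"
    by (simp add: L2_norm_def L2_inner_def)
  also have "\<dots> \<longleftrightarrow> (AE x in lebesgue_on U. f x \<bullet> f x = 0)"
    by (rule integral_nonneg_eq_0_iff_AE) (auto intro: L2_inner_integrable assms)
  finally show ?thesis by (simp add: ae_eq_def)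
qed

text \<open>Expanding the squared norm of \<open>s f + t g\<close> gives a quadratic form in
  \<open>s\<close> and \<open>t\<close> that is nonnegative everywhere. Keeping both variables free
  lets the same form settle the degenerate case as well.\<close>

lemma L2_Cauchy_Schwarz:
  assumes f: "f \<in> L2 U" and g: "g \<in> L2 U"
  shows "\<bar>L2_inner U f g\<bar> \<le> L2_norm U f * L2_norm U g"
proof -
  define A B C where "A = L2_inner U f f" and "B = L2_inner U f g" and "C = L2_inner U g g"
  have nonneg: "0 \<le> A" "0 \<le> C" by (auto simp: A_def C_def L2_inner_nonneg)
  have quadratic: "0 \<le> A * s\<^sup>2 + 2 * B * s * t + C * t\<^sup>2" for s t
  proof -
    have k: "(\<lambda>x. s *\<^sub>R f x + t *\<^sub>R g x) \<in> L2 U" by (intro L2_lincomb f g)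
    have "0 \<le> L2_inner U (\<lambda>x. s *\<^sub>R f x + t *\<^sub>R g x) (\<lambda>x. s *\<^sub>R f x + t *\<^sub>R g x)"
      by (rule L2_inner_nonneg)
    also have "\<dots> = A * s\<^sup>2 + 2 * B * s * t + C * t\<^sup>2"
      unfolding L2_inner_lincomb_left[OF f g k] L2_inner_lincomb_right[OF f g f]
        L2_inner_lincomb_right[OF f g g]
      by (simp add: A_def B_def C_def L2_inner_commute[of U g f] power2_eq_square algebra_simps)
    finally show ?thesis .
  qed
  have "B\<^sup>2 \<le> A * C"
  proof (cases "C = 0")
    case True
    show ?thesis
    proof (rule ccontr)
      assume "\<not> ?thesis"
      then have "B \<noteq> 0" by (simp add: True)
      \<comment> \<open>For \<open>C = 0\<close> and \<open>s = 1\<close> the form is affine in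
        \<open>t\<close>, and this \<open>t\<close> gives it the value -1.\<close>
      then have "2 * B * (- (A + 1) / (2 * B)) = - (A + 1)" by simp
      with quadratic[of 1 "- (A + 1) / (2 * B)"] True show False by simp
    qed
  next
    case False
    then have "C > 0" using nonneg by simp
    \<comment> \<open>The pair \<open>s = C\<close>, \<open>t = - B\<close> is the minimising
      direction, scaled so that no division occurs.\<close>
    have "0 \<le> C * (A * C - B\<^sup>2)"
      using quadratic[of C "- B"] by (simp add: power2_eq_square algebra_simps)
    then show ?thesis using \<open>C > 0\<close> by (simp add: zero_le_mult_iff)
  qed
  then have "sqrt (B\<^sup>2) \<le> sqrt (A * C)" by (rule real_sqrt_le_mono)
  then show ?thesis by (simp add: A_def B_def C_def L2_norm_def real_sqrt_mult)
qed

lemma L2_norm_triangle: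
  assumes f: "f \<in> L2 U" and g: "g \<in> L2 U"
  shows "L2_norm U (\<lambda>x. f x + g x) \<le> L2_norm U f + L2_norm U g"
proof (rule power2_le_imp_le)
  have "(L2_norm U (\<lambda>x. f x + g x))\<^sup>2 = (L2_norm U f)\<^sup>2 + 2 * L2_inner U f g + (L2_norm U g)\<^sup>2"
    using L2_inner_lincomb_left[OF f g L2_add[OF f g], of 1 1]
      L2_inner_lincomb_right[OF f g f, of 1 1] L2_inner_lincomb_right[OF f g g, of 1 1]
    by (simp add: L2_norm_square L2_inner_commute[of U g f])
  also have "\<dots> \<le> (L2_norm U f + L2_norm U g)\<^sup>2"
    using L2_Cauchy_Schwarz[OF f g] by (simp add: power2_sum)
  finally show "(L2_norm U (\<lambda>x. f x + g x))\<^sup>2 \<le> (L2_norm U f + L2_norm U g)\<^sup>2" .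
qed (simp add: L2_norm_nonneg)

lemma L2_norm_scaleR: "L2_norm U (\<lambda>x. c *\<^sub>R f x) = \<bar>c\<bar> * L2_norm U f"
  by (simp add: L2_norm_def L2_inner_scaleR_left L2_inner_scaleR_right real_sqrt_mult
      flip: mult.assoc power2_eq_square)

lemma L2_norm_minus_commute: "L2_norm U (\<lambda>x. f x - g x) = L2_norm U (\<lambda>x. g x - f x)"
  by (simp add: L2_norm_def L2_inner_def power2_norm_eq_inner[symmetric] norm_minus_commute)

lemma L2_norm_triangle_diff:
  assumes f: "f \<in> L2 U" and g: "g \<in> L2 U"
  shows "L2_norm U f \<le> L2_norm U g + L2_norm U (\<lambda>x. f x - g x)"
  using L2_norm_triangle[OF g L2_diff[OF f g]] by simp

lemma L2_norm_mono:
  assumes "f \<in> L2 U" "g \<in> L2 U" "0 \<le> C" "AE x in lebesgue_on U. norm (g x) \<le> C * norm (f x)"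
  shows "L2_norm U g \<le> C * L2_norm U f"
proof (rule power2_le_imp_le)
  have "L2_inner U g g \<le> (\<integral>x. C\<^sup>2 * (f x \<bullet> f x) \<partial>lebesgue_on U)"
    unfolding L2_inner_def
  proof (rule integral_mono_AE)
    show "AE x in lebesgue_on U. g x \<bullet> g x \<le> C\<^sup>2 * (f x \<bullet> f x)"
      using assms(4)
    proof eventually_elim
      case (elim x)
      then have "(norm (g x))\<^sup>2 \<le> (C * norm (f x))\<^sup>2" by (intro power_mono) auto
      then show ?case by (simp add: power_mult_distrib power2_norm_eq_inner)
    qed
  qed (use assms in \<open>auto intro!: integrable_mult_right L2_inner_integrable\<close>)
  then show "(L2_norm U g)\<^sup>2 \<le> (C * L2_norm U f)\<^sup>2"
    by (simp add: L2_norm_square power_mult_distrib) (simp add: L2_inner_def)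
qed (use assms in \<open>simp add: L2_norm_nonneg\<close>)

lemma L2_inner_sum_left:
  assumes "\<And>i. i \<in> A \<Longrightarrow> f i \<in> L2 U" "k \<in> L2 U"
  shows "L2_inner U (\<lambda>x. \<Sum>i\<in>A. f i x) k = (\<Sum>i\<in>A. L2_inner U (f i) k)"
  using assms by (simp add: L2_inner_def inner_sum_left L2_inner_integrable)

text \<open>Compactness of \<open>K\<close> gives integrability for the Borel measure, which passes
  to the completion and to the restriction to \<open>U\<close>. Continuity is asked for on
  \<open>K\<close> only, so that constants yield the indicators of boxes.\<close>

lemma L2_indicator_continuous:
  fixes f :: "real ^ 'n \<Rightarrow> 'b::euclidean_space"
  assumes "U \<in> sets lebesgue" "compact K" "continuous_on K f"
  shows "(\<lambda>x. indicator K x *\<^sub>R f x) \<in> L2 U"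
proof -
  have *: "(\<lambda>x. indicator K x *\<^sub>R f x) \<in> borel_measurable borel"
    using assms by (auto intro!: borel_measurable_continuous_on_indicator borel_compact)
  then have "(\<lambda>x. indicator K x *\<^sub>R f x) \<in> borel_measurable lebesgue"
    using borel_measurable_if_I measurable_completion[of _ lborel borel] by simp
  then have m: "(\<lambda>x. indicator K x *\<^sub>R f x) \<in> borel_measurable (lebesgue_on U)"
    by (rule measurable_restrict_space1)
  have "integrable lborel (\<lambda>x. indicator K x *\<^sub>R (norm (f x))\<^sup>2)"
    using assms by (intro borel_integrable_compact continuous_intros) auto
  then have "integrable lborel (\<lambda>x. (norm (indicator K x *\<^sub>R f x))\<^sup>2)"
    by (rule back_subst[where P = "integrable lborel"]) (auto simp: indicator_def)
  then have "integrable lebesgue (\<lambda>x. (norm (indicator K x *\<^sub>R f x))\<^sup>2)"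
    using * by (subst integrable_completion) auto
  then have "integrable lebesgue (\<lambda>x. indicator U x *\<^sub>R (norm (indicator K x *\<^sub>R f x))\<^sup>2)"
    using assms by (intro integrable_mult_indicator) auto
  then have "integrable (lebesgue_on U) (\<lambda>x. (norm (indicator K x *\<^sub>R f x))\<^sup>2)"
    using assms by (subst integrable_restrict_space) auto
  with m show ?thesis by (simp add: L2_def)
qed

lemma L2_continuous_compact_support:
  fixes f :: "real ^ 'n \<Rightarrow> 'b::euclidean_space"
  assumes "U \<in> sets lebesgue" "compact K" "continuous_on K f" "\<And>x. x \<notin> K \<Longrightarrow> f x = 0"
  shows "f \<in> L2 U"
proof -
  have "f = (\<lambda>x. indicator K x *\<^sub>R f x)" using assms(4) by (force simp: indicator_def)
  then show ?thesis using L2_indicator_continuous[OF assms(1-3)] by simp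
qed

lemma indicator_cbox_L2: "U \<in> sets lebesgue \<Longrightarrow> indicat_real (cbox a b :: (real ^ 'n) set) \<in> L2 U"
  using L2_indicator_continuous[OF _ compact_cbox continuous_on_const[of _ "1::real"]] by simp

lemma indicator_box_L2:
  assumes "U \<in> sets lebesgue"
  shows "indicat_real (box a b :: (real ^ 'n) set) \<in> L2 U"
proof (rule L2_dominated[OF indicator_cbox_L2[OF assms, of a b], where C = 1])
  show "indicat_real (box a b) \<in> borel_measurable (lebesgue_on U)"
    by (intro measurable_restrict_space1 borel_measurable_indicator) auto
qed (use box_subset_cbox[of a b] in \<open>auto simp: indicator_def\<close>)

subsection \<open>Test functions\<close>

lemma partial_deriv_eq: "(f has_derivative f') (at x) \<Longrightarrow> partial_deriv i f x = f' (axis i 1)"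
  unfolding partial_deriv_def by (metis frechet_derivative_at)

lemma partial_deriv_scaleR:
  assumes "\<phi> differentiable at x" "v differentiable at x"
  shows "partial_deriv i (\<lambda>x. \<phi> x *\<^sub>R v x) x =
    partial_deriv i \<phi> x *\<^sub>R v x + \<phi> x *\<^sub>R partial_deriv i v x"
  using partial_deriv_eq[OF has_derivative_scaleR[OF assms[unfolded frechet_derivative_works]]]
  by (simp add: partial_deriv_def)

lemma partial_deriv_inner:
  assumes "u differentiable at x" "v differentiable at x"
  shows "partial_deriv i (\<lambda>x. u x \<bullet> v x) x =
    u x \<bullet> partial_deriv i v x + partial_deriv i u x \<bullet> v x"
  using partial_deriv_eq[OF has_derivative_inner[OF assms[unfolded frechet_derivative_works]]]
  by (simp add: partial_deriv_def)

lemma partial_deriv_lincomb: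
  assumes "u differentiable at x" "v differentiable at x"
  shows "partial_deriv i (\<lambda>x. a *\<^sub>R u x + b *\<^sub>R v x) x =
    a *\<^sub>R partial_deriv i u x + b *\<^sub>R partial_deriv i v x"
  using partial_deriv_eq[OF has_derivative_add[OF
      has_derivative_scaleR_right[OF assms(1)[unfolded frechet_derivative_works]]
      has_derivative_scaleR_right[OF assms(2)[unfolded frechet_derivative_works]]]]
  by (simp add: partial_deriv_def)

lemma partial_deriv_linear_image:
  assumes "bounded_linear T" "u differentiable at x"
  shows "partial_deriv i (\<lambda>x. T (u x)) x = T (partial_deriv i u x)"
  using partial_deriv_eq[OF bounded_linear.has_derivative[OF assms(1)
        assms(2)[unfolded frechet_derivative_works]]]
  by (simp add: partial_deriv_def)

lemma partial_deriv_outside_support: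
  assumes "closed K" "\<And>x. x \<notin> K \<Longrightarrow> f x = 0" "x \<notin> K"
  shows "partial_deriv i f x = 0"
proof -
  have "(f has_derivative (\<lambda>_. 0)) (at x)"
    by (rule has_derivative_transform_within_open[where s = "- K" and f = "\<lambda>_. 0"])
      (use assms in auto)
  then show ?thesis by (simp add: partial_deriv_eq)
qed

lemma partial_derivs_append:
  "partial_derivs is (partial_derivs js f) = partial_derivs (is @ js) f"
  by (induction "is") auto

lemma test_fun_differentiable:
  "\<phi> \<in> test_functions U \<Longrightarrow> partial_derivs is \<phi> differentiable at x"
  by (auto simp: test_functions_def differentiable_on_def)

lemma test_fun_continuous:
  "\<phi> \<in> test_functions U \<Longrightarrow> continuous_on S (partial_derivs is \<phi>)"
  by (meson continuous_at_imp_continuous_on differentiable_imp_continuous_within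
      test_fun_differentiable)

text \<open>One compact set serves derivatives of all orders, because differentiation does not
  enlarge a closed set off which a function vanishes.\<close>

lemma test_fun_support:
  assumes "\<phi> \<in> test_functions U"
  obtains K where "compact K" "K \<subseteq> U" "\<And>is x. x \<notin> K \<Longrightarrow> partial_derivs is \<phi> x = 0"
proof -
  obtain K where K: "compact K" "K \<subseteq> U" "\<And>x. x \<notin> K \<Longrightarrow> \<phi> x = 0"
    using assms by (auto simp: test_functions_def)
  have "x \<notin> K \<Longrightarrow> partial_derivs is \<phi> x = 0" for "is" x
  proof (induction "is" arbitrary: x)
    case (Cons i "is")
    then show ?case
      using partial_deriv_outside_support[OF compact_imp_closed[OF K(1)], of "partial_derivs is \<phi>"]
      by simp
  qed (use K in simp)
  with K that show ?thesis by blast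
qed

lemma test_fun_partial_derivs:
  assumes "\<phi> \<in> test_functions U"
  shows "partial_derivs is \<phi> \<in> test_functions U"
proof -
  obtain K where "compact K" "K \<subseteq> U" "\<And>is x. x \<notin> K \<Longrightarrow> partial_derivs is \<phi> x = 0"
    using test_fun_support[OF assms] by blast
  then show ?thesis
    using assms by (auto simp: test_functions_def partial_derivs_append)
qed

lemma test_fun_L2:
  assumes "U \<in> sets lebesgue" "\<phi> \<in> test_functions U"
  shows "partial_derivs is \<phi> \<in> L2 U"
proof -
  obtain K where K: "compact K" "K \<subseteq> U" "\<And>is x. x \<notin> K \<Longrightarrow> partial_derivs is \<phi> x = 0"
    using test_fun_support[OF assms(2)] by blast
  show ?thesis
    by (rule L2_continuous_compact_support[OF assms(1) K(1) test_fun_continuous[OF assms(2)] K(3)])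
qed

lemma partial_derivs_linear_image:
  assumes "bounded_linear T" "\<phi> \<in> test_functions U"
  shows "partial_derivs is (\<lambda>x. T (\<phi> x)) = (\<lambda>x. T (partial_derivs is \<phi> x))"
proof (induction "is")
  case (Cons i "is")
  then show ?case
    using partial_deriv_linear_image[OF assms(1) test_fun_differentiable[OF assms(2)]] by auto
qed simp

lemma test_fun_linear_image:
  assumes "bounded_linear T" "\<phi> \<in> test_functions U"
  shows "(\<lambda>x. T (\<phi> x)) \<in> test_functions U"
proof -
  interpret bounded_linear T by fact
  have "(\<lambda>x. T (partial_derivs is \<phi> x)) differentiable at x" for "is" x
    by (rule differentiable_compose[where f = T, OF bounded_linear_imp_differentiable[OF assms(1)]
          test_fun_differentiable[OF assms(2)]])
  moreover obtain K where "compact K" "K \<subseteq> U" "\<And>x. x \<notin> K \<Longrightarrow> T (\<phi> x) = 0"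
    using assms(2) zero by (force simp: test_functions_def)
  ultimately show ?thesis
    unfolding test_functions_def differentiable_on_def
    by (auto simp: partial_derivs_linear_image[OF assms])
qed

lemma partial_derivs_lincomb:
  assumes "\<phi> \<in> test_functions U" "\<psi> \<in> test_functions U"
  shows "partial_derivs is (\<lambda>x. a *\<^sub>R \<phi> x + b *\<^sub>R \<psi> x) =
    (\<lambda>x. a *\<^sub>R partial_derivs is \<phi> x + b *\<^sub>R partial_derivs is \<psi> x)"
proof (induction "is")
  case (Cons i "is")
  then show ?case
    using partial_deriv_lincomb[OF assms[THEN test_fun_differentiable]] by auto
qed simp

lemma test_fun_lincomb:
  assumes "\<phi> \<in> test_functions U" "\<psi> \<in> test_functions U"
  shows "(\<lambda>x. a *\<^sub>R \<phi> x + b *\<^sub>R \<psi> x) \<in> test_functions U"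
proof -
  obtain K where K: "compact K" "K \<subseteq> U" "\<And>is x. x \<notin> K \<Longrightarrow> partial_derivs is \<phi> x = 0"
    using test_fun_support[OF assms(1)] by blast
  obtain L where L: "compact L" "L \<subseteq> U" "\<And>is x. x \<notin> L \<Longrightarrow> partial_derivs is \<psi> x = 0"
    using test_fun_support[OF assms(2)] by blast
  have "a *\<^sub>R \<phi> x + b *\<^sub>R \<psi> x = 0" if "x \<notin> K \<union> L" for x
    using K(3)[of x "[]"] L(3)[of x "[]"] that by simp
  moreover have "compact (K \<union> L)" "K \<union> L \<subseteq> U" using K L by auto
  moreover have "partial_derivs is (\<lambda>x. a *\<^sub>R \<phi> x + b *\<^sub>R \<psi> x) differentiable_on UNIV" for "is"
    unfolding partial_derivs_lincomb[OF assms] differentiable_on_def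
    by (intro ballI differentiable_add differentiable_scaleR differentiable_const
        assms[THEN test_fun_differentiable])
  ultimately show ?thesis unfolding test_functions_def by blast
qed

lemma partial_deriv_zero: "partial_deriv i (\<lambda>x. 0) = (\<lambda>x. 0)"
  by (rule ext) (simp add: partial_deriv_def)

lemma test_fun_zero: "(\<lambda>x. 0) \<in> test_functions U"
proof -
  have *: "partial_derivs is (\<lambda>x. 0) = (\<lambda>x. 0)" for "is" :: "'a list"
    by (induction "is") (simp_all add: partial_deriv_zero)
  show ?thesis by (auto simp: test_functions_def * intro: exI[of _ "{}"])
qed

subsection \<open>Smooth bumps\<close>

text \<open>The classical smooth function exp(-1/t), continued by zero. The powers of
  \<open>t\<close> in the denominator make the linear span of the family closed under
  differentiation.\<close>

definition flat :: "nat \<Rightarrow> real \<Rightarrow> real" where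
  "flat k t = (if t > 0 then exp (- 1 / t) / t ^ k else 0)"

text \<open>In the variable 1/t the exponential outgrows every power.\<close>

lemma flat_tendsto_0: "(flat k \<longlongrightarrow> 0) (at_right 0)"
proof -
  have "((\<lambda>t::real. inverse t ^ k / exp (inverse t)) \<longlongrightarrow> 0) (at_right 0)"
    by (rule filterlim_compose[OF tendsto_power_div_exp_0 filterlim_inverse_at_top_right])
  then show ?thesis
    by (rule Lim_transform_eventually)
      (auto simp: flat_def eventually_at_right_less exp_minus field_simps
        intro!: eventually_mono[OF eventually_at_right_less])
qed

lemma flat_has_derivative:
  "(flat k has_real_derivative flat (k + 2) t - real k * flat (k + 1) t) (at t)"
proof (cases t "0::real" rule: linorder_cases)
  case less
  then have "((\<lambda>_. 0) has_real_derivative 0) (at t)" by simp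
  then have "(flat k has_real_derivative 0) (at t)"
    by (rule has_field_derivative_transform_within_open[where S = "{..<0}"])
      (use less in \<open>auto simp: flat_def\<close>)
  then show ?thesis using less by (simp add: flat_def)
next
  case equal
  \<comment> \<open>From the right the difference quotient at 0 is \<open>flat (k + 1)\<close>
    itself; from the left it is 0.\<close>
  have "((\<lambda>h. (flat k (0 + h) - flat k 0) / h) \<longlongrightarrow> 0) (at_right 0)"
    by (rule Lim_transform_eventually[OF flat_tendsto_0[of "k + 1"]])
      (auto simp: flat_def intro!: eventually_mono[OF eventually_at_right_less])
  moreover have "((\<lambda>h. (flat k (0 + h) - flat k 0) / h) \<longlongrightarrow> 0) (at_left 0)"
    by (rule Lim_transform_eventually[OF tendsto_const])
      (auto simp: flat_def eventually_at_filter)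
  ultimately have "(flat k has_real_derivative 0) (at 0)"
    unfolding DERIV_def by (simp add: filterlim_at_split)
  then show ?thesis using equal by (simp add: flat_def)
next
  case greater
  have "((\<lambda>t. exp (- 1 / t)) has_real_derivative exp (- 1 / t) / t\<^sup>2) (at t)"
    using greater by (auto intro!: derivative_eq_intros simp: power2_eq_square)
  from DERIV_divide[OF this DERIV_pow[of k t]] greater
  have "((\<lambda>t. exp (- 1 / t) / t ^ k) has_real_derivative
      (exp (- 1 / t) / t\<^sup>2 * t ^ k - exp (- 1 / t) * (real k * t ^ (k - Suc 0))) / (t ^ k * t ^ k)) (at t)"
    by simp
  also have "(exp (- 1 / t) / t\<^sup>2 * t ^ k - exp (- 1 / t) * (real k * t ^ (k - Suc 0))) / (t ^ k * t ^ k) =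
      exp (- 1 / t) / t ^ (k + 2) - real k * (exp (- 1 / t) / t ^ (k + 1))"
    using greater by (cases k) (auto simp: field_simps power2_eq_square)
  finally have "((\<lambda>t. exp (- 1 / t) / t ^ k) has_real_derivative
      exp (- 1 / t) / t ^ (k + 2) - real k * (exp (- 1 / t) / t ^ (k + 1))) (at t)" .
  then have "(flat k has_real_derivative
      exp (- 1 / t) / t ^ (k + 2) - real k * (exp (- 1 / t) / t ^ (k + 1))) (at t)"
    by (rule has_field_derivative_transform_within_open[where S = "{0<..}"])
      (use greater in \<open>auto simp: flat_def\<close>)
  then show ?thesis using greater by (simp add: flat_def)
qed

text \<open>
  Partial derivatives do not lead out of this set, so its elements are smooth.
\<close>

inductive_set bump_algebra :: "(real ^ 'n \<Rightarrow> real) set" where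
  const: "(\<lambda>x. c) \<in> bump_algebra"
| flat: "(\<lambda>x. flat k (a * x $ i + b)) \<in> bump_algebra"
| add: "f \<in> bump_algebra \<Longrightarrow> g \<in> bump_algebra \<Longrightarrow> (\<lambda>x. f x + g x) \<in> bump_algebra"
| mult: "f \<in> bump_algebra \<Longrightarrow> g \<in> bump_algebra \<Longrightarrow> (\<lambda>x. f x * g x) \<in> bump_algebra"

lemma bump_algebra_prod:
  "finite A \<Longrightarrow> (\<And>i. i \<in> A \<Longrightarrow> f i \<in> bump_algebra) \<Longrightarrow> (\<lambda>x. \<Prod>i\<in>A. f i x) \<in> bump_algebra"
  by (induction A rule: finite_induct) (auto intro: bump_algebra.intros)

text \<open>The full derivative is carried through the induction: one claim then supplies
  differentiability together with closure of the algebra under every directional derivative.\<close>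

lemma bump_algebra_derivative:
  fixes f :: "real ^ 'n \<Rightarrow> real"
  assumes "f \<in> bump_algebra"
  shows "\<exists>f'. (\<forall>x. (f has_derivative f' x) (at x)) \<and> (\<forall>e. (\<lambda>x. f' x e) \<in> bump_algebra)"
  using assms
proof induction
  case (const c)
  show ?case
    by (rule exI[of _ "\<lambda>x e. 0"]) (auto intro: bump_algebra.intros)
next
  case (flat k a i b)
  let ?d = "\<lambda>x. flat (k + 2) (a * x $ i + b) + (- real k) * flat (k + 1) (a * x $ i + b)"
  have "((\<lambda>x. flat k (a * x $ i + b)) has_derivative (\<lambda>e. (a * e $ i) * ?d x)) (at x)" for x :: "real ^ 'n"
  proof -
    have "((\<lambda>x. a * x $ i + b) has_derivative (\<lambda>e. a * e $ i)) (at x)"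
      using bounded_linear_imp_has_derivative[OF bounded_linear_vec_nth[of i], of "at x"]
      by (auto intro!: derivative_eq_intros)
    then show ?thesis
      using DERIV_compose_FDERIV[OF flat_has_derivative] by fastforce
  qed
  then show ?case
    by (intro exI[of _ "\<lambda>x e. (a * e $ i) * ?d x"] conjI allI bump_algebra.intros) auto
next
  case (add f g)
  then obtain f' g' where
    "\<And>x. (f has_derivative f' x) (at x)" "\<And>e. (\<lambda>x. f' x e) \<in> bump_algebra"
    "\<And>x. (g has_derivative g' x) (at x)" "\<And>e. (\<lambda>x. g' x e) \<in> bump_algebra"
    by blast
  then show ?case
    by (intro exI[of _ "\<lambda>x e. f' x e + g' x e"]) (auto intro!: bump_algebra.intros derivative_intros)
next
  case (mult f g)
  then obtain f' g' where
    "\<And>x. (f has_derivative f' x) (at x)" "\<And>e. (\<lambda>x. f' x e) \<in> bump_algebra"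
    "\<And>x. (g has_derivative g' x) (at x)" "\<And>e. (\<lambda>x. g' x e) \<in> bump_algebra"
    by blast
  with mult.hyps show ?case
    by (intro exI[of _ "\<lambda>x e. f x * g' x e + f' x e * g x"])
      (auto intro!: bump_algebra.intros has_derivative_mult)
qed

lemma bump_algebra_partial_derivs:
  assumes "f \<in> bump_algebra"
  shows "partial_derivs is f \<in> bump_algebra"
proof (induction "is")
  case (Cons i "is")
  obtain f' where f': "\<And>x. (partial_derivs is f has_derivative f' x) (at x)"
    "\<And>e. (\<lambda>x. f' x e) \<in> bump_algebra"
    using bump_algebra_derivative[OF Cons] by blast
  have "partial_derivs (i # is) f = (\<lambda>x. f' x (axis i 1))"
    using partial_deriv_eq[OF f'(1)] by auto
  then show ?case using f'(2) by simp
qed (use assms in simp)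

text \<open>As \<open>m\<close> grows, each factor steepens towards the indicator of a half space,
  while the support stays in the same box for every \<open>m\<close>. Integrals over boxes thus
  become limits of integrals against test functions, without any convolution.\<close>

definition bump :: "real ^ 'n \<Rightarrow> real ^ 'n \<Rightarrow> nat \<Rightarrow> real ^ 'n \<Rightarrow> real" where
  "bump a b m x = (\<Prod>i\<in>UNIV. flat 0 (real m * (x $ i - a $ i)) * flat 0 (real m * (b $ i - x $ i)))"

lemma bump_bounds: "0 \<le> bump a b m x" "bump a b m x \<le> 1"
proof -
  have "0 \<le> flat 0 t" "flat 0 t \<le> 1" for t by (auto simp: flat_def)
  then show "0 \<le> bump a b m x" "bump a b m x \<le> 1"
    unfolding bump_def by (auto intro!: prod_nonneg prod_le_1 mult_le_one)
qed

lemma bump_outside_box: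
  assumes "x \<notin> box a b"
  shows "bump a b m x = 0"
proof -
  obtain i where "\<not> (a $ i < x $ i \<and> x $ i < b $ i)"
    using assms by (auto simp: mem_box_cart)
  then have "flat 0 (real m * (x $ i - a $ i)) * flat 0 (real m * (b $ i - x $ i)) = 0"
    by (auto simp: flat_def zero_less_mult_iff)
  then show ?thesis unfolding bump_def by (intro prod_zero) auto
qed

lemma bump_tendsto: "(\<lambda>m. bump a b m x) \<longlonglongrightarrow> indicator (box a b) x"
proof (cases "x \<in> box a b")
  case True
  have *: "(\<lambda>m. flat 0 (real m * t)) \<longlonglongrightarrow> 1" if "t > 0" for t
  proof -
    have "(\<lambda>m. exp (- (inverse (real m) * inverse t))) \<longlonglongrightarrow> exp (- (0 * inverse t))"
      by (intro tendsto_intros lim_inverse_n)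
    then have "(\<lambda>m. exp (- (inverse (real m) * inverse t))) \<longlonglongrightarrow> 1" by simp
    then show ?thesis
      by (rule Lim_transform_eventually)
        (use that in \<open>auto simp: flat_def field_simps intro!: eventually_mono[OF eventually_gt_at_top[of 0]]\<close>)
  qed
  have "(\<lambda>m. bump a b m x) \<longlonglongrightarrow> (\<Prod>i\<in>(UNIV::'a set). 1 * 1)"
    unfolding bump_def using True by (intro tendsto_intros *) (auto simp: mem_box_cart)
  then show ?thesis using True by simp
qed (simp add: bump_outside_box)

lemma bump_test_function:
  fixes a b :: "real ^ 'n"
  assumes "cbox a b \<subseteq> U"
  shows "bump a b m \<in> test_functions U"
proof -
  have "bump a b m = (\<lambda>x. \<Prod>i\<in>UNIV. flat 0 (real m * x $ i + (- real m * a $ i))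
      * flat 0 (- real m * x $ i + real m * b $ i))"
    unfolding bump_def by (simp add: algebra_simps)
  also have "\<dots> \<in> bump_algebra" by (intro bump_algebra_prod bump_algebra.intros) auto
  finally have "bump a b m \<in> bump_algebra" .
  then have "partial_derivs is (bump a b m) differentiable_on UNIV" for "is"
    using bump_algebra_derivative[OF bump_algebra_partial_derivs]
    by (meson differentiableI differentiable_on_def differentiable_at_withinI)
  moreover have "bump a b m x = 0" if "x \<notin> cbox a b" for x
    using bump_outside_box box_subset_cbox that by blast
  ultimately show ?thesis
    using assms by (auto simp: test_functions_def intro!: exI[of _ "cbox a b"])
qed

section \<open>The fundamental lemma of the calculus of variations\<close>

lemma integral_box_eq_0:
  assumes "U \<in> sets lebesgue" "g \<in> L2 U" "cbox a b \<subseteq> U"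
    and "\<And>\<phi> :: real ^ 'n \<Rightarrow> real. \<phi> \<in> test_functions U \<Longrightarrow>
      integral\<^sup>L (lebesgue_on U) (\<lambda>x. \<phi> x *\<^sub>R g x) = 0"
  shows "integral\<^sup>L (lebesgue_on U) (\<lambda>x. indicator (box a b) x *\<^sub>R g x) = 0"
proof -
  have [measurable]: "g \<in> borel_measurable (lebesgue_on U)" using assms(2) by (rule L2_measurable)
  note integrable = L2_scaleR_integrable[OF indicator_cbox_L2[OF assms(1)] assms(2)]
  have "(\<lambda>m. integral\<^sup>L (lebesgue_on U) (\<lambda>x. bump a b m x *\<^sub>R g x))
      \<longlonglongrightarrow> integral\<^sup>L (lebesgue_on U) (\<lambda>x. indicator (box a b) x *\<^sub>R g x)"
  \<comment> \<open>The dominating function is the norm of \<open>g\<close> cut off to the closed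
    box: the bumps have values in the unit interval and vanish off the box.\<close>
  proof (rule integral_dominated_convergence[OF _ _ integrable_norm[OF integrable]])
    show "(\<lambda>x. indicator (box a b) x *\<^sub>R g x) \<in> borel_measurable (lebesgue_on U)"
      by (intro borel_measurable_scaleR L2_measurable indicator_box_L2 assms(1,2))
    show "(\<lambda>x. bump a b m x *\<^sub>R g x) \<in> borel_measurable (lebesgue_on U)" for m
      using L2_measurable[OF test_fun_L2[OF assms(1) bump_test_function[OF assms(3)], of "[]"]]
      by (intro borel_measurable_scaleR) auto
    show "AE x in lebesgue_on U. (\<lambda>m. bump a b m x *\<^sub>R g x) \<longlonglongrightarrow> indicator (box a b) x *\<^sub>R g x"
      by (intro AE_I2 tendsto_intros bump_tendsto)
    show "AE x in lebesgue_on U. norm (bump a b m x *\<^sub>R g x) \<le> norm (indicator (cbox a b) x *\<^sub>R g x)" for m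
    proof (intro AE_I2)
      fix x
      have "bump a b m x \<le> indicator (cbox a b) x"
        using bump_bounds[of a b m x] bump_outside_box[of x a b m] box_subset_cbox[of a b]
        by (auto simp: indicator_def)
      then show "norm (bump a b m x *\<^sub>R g x) \<le> norm (indicator (cbox a b) x *\<^sub>R g x)"
        using bump_bounds[of a b m x] by (auto intro!: mult_right_mono)
    qed
  qed
  moreover have "integral\<^sup>L (lebesgue_on U) (\<lambda>x. bump a b m x *\<^sub>R g x) = 0" for m
    by (intro assms(4) bump_test_function assms(3))
  ultimately show ?thesis by (simp add: LIMSEQ_const_iff)
qed

text \<open>The integral of \<open>g\<close> vanishes over every box inside \<open>U\<close>. By
  Lebesgue differentiation \<open>g\<close> is almost everywhere the limit of its averages over
  shrinking cubes, and these lie in the open set \<open>U\<close> eventually.\<close>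

theorem fundamental_lemma:
  fixes g :: "real ^ 'n \<Rightarrow> 'b::euclidean_space"
  assumes "open U" "g \<in> L2 U"
    and "\<And>\<phi> :: real ^ 'n \<Rightarrow> real. \<phi> \<in> test_functions U \<Longrightarrow>
      integral\<^sup>L (lebesgue_on U) (\<lambda>x. \<phi> x *\<^sub>R g x) = 0"
  shows "ae_eq U g (\<lambda>x. 0)"
proof -
  have U: "U \<in> sets lebesgue" using assms(1) by auto
  \<comment> \<open>The differentiation theorem asks for integrability over every box, hence the
    extension by zero.\<close>
  define G where "G x = (if x \<in> U then g x else 0)" for x
  have int: "G integrable_on cbox a b" for a b
  proof -
    from integrable_on_lebesgue_on[OF L2_scaleR_integrable[OF indicator_cbox_L2[OF U] assms(2)] U]
    have "(\<lambda>x. if x \<in> U then indicator (cbox a b) x *\<^sub>R g x else 0) integrable_on UNIV"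
      by (simp only: Henstock_Kurzweil_Integration.integrable_restrict_UNIV)
    also have "(\<lambda>x. if x \<in> U then indicator (cbox a b) x *\<^sub>R g x else 0) =
        (\<lambda>x. if x \<in> cbox a b then G x else 0)"
      by (auto simp: G_def indicator_def)
    finally show ?thesis by (simp only: Henstock_Kurzweil_Integration.integrable_restrict_UNIV)
  qed
  have zero: "integral (cbox a b) G = 0" if "cbox a b \<subseteq> U" for a b
  proof -
    have "integrable (lebesgue_on U) (\<lambda>x. indicator (box a b) x *\<^sub>R g x)"
      by (intro L2_scaleR_integrable indicator_box_L2 U assms(2))
    then have "integral U (\<lambda>x. indicator (box a b) x *\<^sub>R g x) = 0"
      using integral_box_eq_0[OF U assms(2) that assms(3)] lebesgue_integral_eq_integral[OF _ U]
      by metis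
    then have "integral UNIV (\<lambda>x. if x \<in> U then indicator (box a b) x *\<^sub>R g x else 0) = 0"
      by (simp only: Henstock_Kurzweil_Integration.integral_restrict_UNIV)
    also have "(\<lambda>x. if x \<in> U then indicator (box a b) x *\<^sub>R g x else 0) =
        (\<lambda>x. if x \<in> box a b then G x else 0)"
      by (auto simp: G_def indicator_def)
    finally have "integral (box a b) G = 0"
      by (simp only: Henstock_Kurzweil_Integration.integral_restrict_UNIV)
    then show ?thesis by (simp add: integral_open_interval)
  qed
  obtain N where N: "negligible N"
    and lim: "\<And>x e. x \<notin> N \<Longrightarrow> 0 < e \<Longrightarrow> \<exists>d>0. \<forall>h. 0 < h \<and> h < d \<longrightarrow>
      norm (integral (cbox x (x + h *\<^sub>R One)) G /\<^sub>R h ^ DIM(real ^ 'n) - G x) < e"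
    using integrable_ccontinuous_explicit[OF int] by blast
  have G0: "G x = 0" if x: "x \<in> U" "x \<notin> N" for x
  proof (rule ccontr)
    assume "G x \<noteq> 0"
    then obtain d where d: "d > 0" "\<And>h. 0 < h \<Longrightarrow> h < d \<Longrightarrow>
        norm (integral (cbox x (x + h *\<^sub>R One)) G /\<^sub>R h ^ DIM(real ^ 'n) - G x) < norm (G x)"
      using lim[OF x(2), of "norm (G x)"] by auto
    obtain r where r: "r > 0" "cball x r \<subseteq> U"
      using assms(1) x(1) open_contains_cball by blast
    \<comment> \<open>Small enough for the average to be close to \<open>G x\<close>, and for the
      cube with corner \<open>x\<close>, whose diagonal is \<open>h\<close> times the norm of
      \<open>One\<close>, to stay in the ball of radius \<open>r\<close>.\<close>
    define h where "h = min (d / 2) (r / (norm (One :: real ^ 'n) + 1))"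
    have pos: "norm (One :: real ^ 'n) + 1 > 0" by (simp add: add_nonneg_pos)
    have h: "0 < h" "h < d" "h \<le> r / (norm (One :: real ^ 'n) + 1)"
      using d(1) r(1) pos by (auto simp: h_def)
    have "h * (norm (One :: real ^ 'n) + 1) \<le> r"
      using h(3) pos by (simp add: pos_le_divide_eq)
    then have hr: "h * norm (One :: real ^ 'n) \<le> r" using h(1) by (simp add: distrib_left)
    have "cbox x (x + h *\<^sub>R One) \<subseteq> cball x r"
    proof
      fix y assume y: "y \<in> cbox x (x + h *\<^sub>R One)"
      have "\<bar>(y - x) \<bullet> i\<bar> \<le> \<bar>(h *\<^sub>R One) \<bullet> i\<bar>" if "i \<in> Basis" for i
        using y h(1) that by (auto simp: mem_box inner_diff_left inner_add_left)
      then have "norm (y - x) \<le> norm (h *\<^sub>R One :: real ^ 'n)" by (rule norm_le_componentwise)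
      then show "y \<in> cball x r" using hr h(1) by (simp add: dist_norm norm_minus_commute)
    qed
    then have "integral (cbox x (x + h *\<^sub>R One)) G = 0" using zero r(2) by blast
    then show False using d(2)[OF h(1,2)] by simp
  qed
  have "AE x in lebesgue. x \<notin> N" using N by (simp add: AE_iff_null_sets negligible_iff_null_sets AE_not_in)
  then have "AE x in lebesgue. x \<in> U \<longrightarrow> g x = 0"
    by eventually_elim (use G0 in \<open>auto simp: G_def\<close>)
  then show ?thesis
    unfolding ae_eq_def using U by (subst AE_restrict_space_iff) auto
qed

subsection \<open>Integration by parts\<close>

lemma integral_lborel_translate:
  fixes f :: "'a::euclidean_space \<Rightarrow> 'b::{banach, second_countable_topology}"
  assumes "f \<in> borel_measurable borel"
  shows "integral\<^sup>L lborel (\<lambda>x. f (c + x)) = integral\<^sup>L lborel f"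
  using integral_distr[of "(+) c" lborel borel f] assms by (simp add: lborel_distr_plus)

lemma integrable_lborel_translate:
  fixes f :: "'a::euclidean_space \<Rightarrow> 'b::{banach, second_countable_topology}"
  assumes "f \<in> borel_measurable borel" "integrable lborel f"
  shows "integrable lborel (\<lambda>x. f (c + x))"
  using integrable_distr_eq[of "(+) c" lborel borel f] assms by (simp add: lborel_distr_plus)

lemma difference_quotient_LIMSEQ:
  assumes "f differentiable at x"
  shows "(\<lambda>n. real (Suc n) *\<^sub>R (f (inverse (real (Suc n)) *\<^sub>R axis i 1 + x) - f x))
    \<longlonglongrightarrow> partial_deriv i f x"
proof -
  let ?D = "frechet_derivative f (at x)" and ?h = "\<lambda>n. inverse (real (Suc n)) *\<^sub>R axis i (1::real)"
  have D: "(f has_derivative ?D) (at x)" using assms by (simp add: frechet_derivative_works)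
  then interpret D: bounded_linear ?D by (rule has_derivative_bounded_linear)
  have "((\<lambda>h. norm (f (x + h) - f x - ?D h) / norm h) \<longlongrightarrow> 0) (at 0)"
    using D by (simp add: has_derivative_at)
  moreover have "filterlim ?h (at 0) sequentially"
  proof (rule filterlim_atI)
    have "?h \<longlonglongrightarrow> 0 *\<^sub>R axis i 1" by (intro tendsto_intros LIMSEQ_inverse_real_of_nat)
    then show "?h \<longlonglongrightarrow> 0" by simp
  qed (simp add: axis_eq_0_iff)
  ultimately have "(\<lambda>n. norm (f (x + ?h n) - f x - ?D (?h n)) / norm (?h n)) \<longlonglongrightarrow> 0"
    by (rule filterlim_compose)
  moreover have "norm (f (x + ?h n) - f x - ?D (?h n)) / norm (?h n) =
      norm (real (Suc n) *\<^sub>R (f (?h n + x) - f x) - partial_deriv i f x)" for n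
  proof -
    have "real (Suc n) *\<^sub>R (f (?h n + x) - f x) - partial_deriv i f x =
        real (Suc n) *\<^sub>R (f (x + ?h n) - f x - ?D (?h n))"
      by (simp add: D.scaleR partial_deriv_def add.commute scaleR_diff_right del: of_nat_Suc)
    then show ?thesis
      by (simp add: norm_axis_1 divide_inverse del: of_nat_Suc)
  qed
  ultimately show ?thesis
    by (simp only: LIM_zero_cancel[OF tendsto_norm_zero_cancel])
qed

text \<open>The mean value inequality along a coordinate line; it makes difference quotients bounded
  uniformly in the step, as dominated convergence demands.\<close>

lemma partial_difference_bound:
  assumes "\<And>x. f differentiable at x" "\<And>x. norm (partial_deriv i f x) \<le> B" "0 \<le> h"
  shows "norm (f (h *\<^sub>R axis i 1 + x) - f x) \<le> B * h"
proof -
  have "((\<lambda>t. f (t *\<^sub>R axis i 1 + x)) has_derivative (\<lambda>s. s *\<^sub>R partial_deriv i f (t *\<^sub>R axis i 1 + x)))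
      (at t within {0..h})" for t
  proof -
    have D: "(f has_derivative frechet_derivative f (at (t *\<^sub>R axis i 1 + x))) (at (t *\<^sub>R axis i 1 + x))"
      using assms(1) frechet_derivative_works by blast
    have "((\<lambda>t. t *\<^sub>R axis i (1::real) + x) has_derivative (\<lambda>s. s *\<^sub>R axis i 1)) (at t within {0..h})"
      by (auto intro!: derivative_eq_intros)
    from has_derivative_compose[OF this D] show ?thesis
      using linear_cmul[OF has_derivative_linear[OF D]] by (simp add: partial_deriv_def)
  qed
  moreover have "onorm (\<lambda>s. s *\<^sub>R partial_deriv i f (t *\<^sub>R axis i 1 + x)) \<le> B" for t
    by (rule onorm_le) (use assms(2) in \<open>auto simp: mult.commute[of B] intro!: mult_left_mono\<close>)
  ultimately have "norm (f (h *\<^sub>R axis i 1 + x) - f (0 *\<^sub>R axis i 1 + x)) \<le> B * norm (h - 0)"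
    by (intro differentiable_bound[where S = "{0..h}"]) (use assms(3) in auto)
  then show ?thesis using assms(3) by simp
qed

text \<open>Every difference quotient of \<open>f\<close> has integral zero by translation
  invariance of the Lebesgue measure, and dominated convergence carries this over to the derivative.
  This avoids iterated integrals.\<close>

proposition integral_partial_deriv_eq_0:
  fixes f :: "real ^ 'n \<Rightarrow> 'b::euclidean_space"
  assumes "compact K" "\<And>x. x \<notin> K \<Longrightarrow> f x = 0"
    and diff: "\<And>x. f differentiable at x" and cont: "continuous_on UNIV (partial_deriv i f)"
  shows "integral\<^sup>L lborel (partial_deriv i f) = 0"
proof -
  have contf: "continuous_on S f" for S
    by (meson continuous_at_imp_continuous_on differentiable_imp_continuous_within diff)
  have [measurable]: "f \<in> borel_measurable borel" "partial_deriv i f \<in> borel_measurable borel"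
    by (auto intro!: borel_measurable_continuous_onI contf cont)
  have "(\<lambda>x. indicator K x *\<^sub>R f x) = f" using assms(2) by (force simp: indicator_def)
  then have intf: "integrable lborel f"
    using borel_integrable_compact[OF assms(1) contf] by simp
  have outside: "partial_deriv i f x = 0" if "x \<notin> K" for x
    using partial_deriv_outside_support[OF compact_imp_closed[OF assms(1)] assms(2) that] .
  have "bounded (partial_deriv i f ` K)"
    by (intro compact_imp_bounded compact_continuous_image assms(1) continuous_on_subset[OF cont]) auto
  then obtain B where "B > 0" and BK: "\<And>x. x \<in> K \<Longrightarrow> norm (partial_deriv i f x) \<le> B"
    by (auto simp: bounded_pos)
  then have B: "norm (partial_deriv i f x) \<le> B" for x
    using outside[of x] by (cases "x \<in> K") auto
  obtain R where R: "\<And>x. x \<in> K \<Longrightarrow> norm x \<le> R"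
    using compact_imp_bounded[OF assms(1)] by (auto simp: bounded_iff)
  define s where "s n x = real (Suc n) *\<^sub>R (f (inverse (real (Suc n)) *\<^sub>R axis i 1 + x) - f x)" for n x
  have "(\<lambda>n. integral\<^sup>L lborel (s n)) \<longlonglongrightarrow> integral\<^sup>L lborel (partial_deriv i f)"
  proof (rule integral_dominated_convergence)
    show "AE x in lborel. (\<lambda>n. s n x) \<longlonglongrightarrow> partial_deriv i f x"
      unfolding s_def by (intro AE_I2 difference_quotient_LIMSEQ diff)
    \<comment> \<open>All steps have length at most 1, so the quotients vanish outside a ball whose
      radius exceeds that of the support by 1.\<close>
    show "integrable lborel (\<lambda>x. indicator (cball 0 (R + 1) :: (real ^ 'n) set) x *\<^sub>R B)"
      by (intro borel_integrable_compact) auto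
    show "AE x in lborel. norm (s n x) \<le> indicator (cball 0 (R + 1)) x *\<^sub>R B" for n
    proof (intro AE_I2)
      fix x :: "real ^ 'n"
      let ?e = "inverse (real (Suc n)) *\<^sub>R axis i (1::real)"
      show "norm (s n x) \<le> indicator (cball 0 (R + 1)) x *\<^sub>R B"
      proof (cases "x \<in> cball 0 (R + 1)")
        case True
        have "norm (s n x) = real (Suc n) * norm (f (?e + x) - f x)"
          by (simp add: s_def del: of_nat_Suc)
        also have "\<dots> \<le> real (Suc n) * (B * inverse (real (Suc n)))"
          by (intro mult_left_mono partial_difference_bound diff B) auto
        also have "\<dots> = B" by (simp del: of_nat_Suc)
        finally show ?thesis using True by simp
      next
        case False
        have "norm ?e \<le> 1" by (simp add: norm_axis_1 inverse_le_1_iff del: of_nat_Suc)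
        then have "norm x \<le> norm (?e + x) + 1"
          using norm_triangle_ineq4[of "?e + x" ?e] by simp
        then have "x \<notin> K" "?e + x \<notin> K" using False R[of x] R[of "?e + x"] by auto
        then show ?thesis using False by (simp add: s_def assms(2))
      qed
    qed
    show "s n \<in> borel_measurable lborel" for n unfolding s_def by measurable
  qed measurable
  moreover have "integral\<^sup>L lborel (s n) = 0" for n
    unfolding s_def using intf
    by (simp add: integral_lborel_translate integrable_lborel_translate)
  ultimately show ?thesis by (simp add: LIMSEQ_const_iff)
qed

lemma integral_on_partial_deriv_eq_0:
  fixes f :: "real ^ 'n \<Rightarrow> 'b::euclidean_space"
  assumes "U \<in> sets lebesgue" "compact K" "K \<subseteq> U" "\<And>x. x \<notin> K \<Longrightarrow> f x = 0"
    and "\<And>x. f differentiable at x" "continuous_on UNIV (partial_deriv i f)"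
  shows "integral\<^sup>L (lebesgue_on U) (partial_deriv i f) = 0"
proof -
  have "partial_deriv i f x = 0" if "x \<notin> K" for x
    using partial_deriv_outside_support[OF compact_imp_closed[OF assms(2)] assms(4) that] .
  then have "(\<lambda>x. indicator U x *\<^sub>R partial_deriv i f x) = partial_deriv i f"
    using assms(3) by (force simp: indicator_def)
  then have "integral\<^sup>L (lebesgue_on U) (partial_deriv i f) = integral\<^sup>L lebesgue (partial_deriv i f)"
    using assms(1) by (subst integral_restrict_space) auto
  also have "\<dots> = integral\<^sup>L lborel (partial_deriv i f)"
    by (intro integral_completion) (use assms(6) in \<open>auto intro: borel_measurable_continuous_onI\<close>)
  also have "\<dots> = 0" by (rule integral_partial_deriv_eq_0[OF assms(2,4,5,6)])
  finally show ?thesis .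
qed

lemma integration_by_parts:
  fixes \<phi> :: "real ^ 'n \<Rightarrow> real" and v :: "real ^ 'n \<Rightarrow> 'b::euclidean_space"
  assumes "U \<in> sets lebesgue" and \<phi>: "\<phi> \<in> test_functions U" and v: "v \<in> test_functions U"
  shows "integral\<^sup>L (lebesgue_on U) (\<lambda>x. partial_deriv i \<phi> x *\<^sub>R v x) =
    - integral\<^sup>L (lebesgue_on U) (\<lambda>x. \<phi> x *\<^sub>R partial_deriv i v x)"
proof -
  obtain K where K: "compact K" "K \<subseteq> U" "\<And>is x. x \<notin> K \<Longrightarrow> partial_derivs is \<phi> x = 0"
    using test_fun_support[OF \<phi>] by blast
  have diff: "\<phi> differentiable at x" "v differentiable at x" for x
    using test_fun_differentiable[OF \<phi>, of "[]"] test_fun_differentiable[OF v, of "[]"] by auto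
  have eq: "partial_deriv i (\<lambda>x. \<phi> x *\<^sub>R v x) =
      (\<lambda>x. partial_deriv i \<phi> x *\<^sub>R v x + \<phi> x *\<^sub>R partial_deriv i v x)"
    by (auto simp: partial_deriv_scaleR[OF diff])
  have "integral\<^sup>L (lebesgue_on U) (partial_deriv i (\<lambda>x. \<phi> x *\<^sub>R v x)) = 0"
  proof (rule integral_on_partial_deriv_eq_0[OF assms(1) K(1,2)])
    show "\<phi> x *\<^sub>R v x = 0" if "x \<notin> K" for x using K(3)[OF that, of "[]"] by simp
    show "continuous_on UNIV (partial_deriv i (\<lambda>x. \<phi> x *\<^sub>R v x))"
      unfolding eq
      using test_fun_continuous[OF \<phi>, of _ "[]"] test_fun_continuous[OF \<phi>, of _ "[i]"]
        test_fun_continuous[OF v, of _ "[]"] test_fun_continuous[OF v, of _ "[i]"]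
      by (intro continuous_intros) auto
  qed (use diff in auto)
  moreover have "integrable (lebesgue_on U) (\<lambda>x. partial_deriv i \<phi> x *\<^sub>R v x)"
    using L2_scaleR_integrable[OF test_fun_L2[OF assms(1) \<phi>] test_fun_L2[OF assms(1) v],
        of "[i]" "[]"] by simp
  moreover have "integrable (lebesgue_on U) (\<lambda>x. \<phi> x *\<^sub>R partial_deriv i v x)"
    using L2_scaleR_integrable[OF test_fun_L2[OF assms(1) \<phi>] test_fun_L2[OF assms(1) v],
        of "[]" "[i]"] by simp
  ultimately show ?thesis unfolding eq by (simp add: add_eq_0_iff)
qed

text \<open>The order in \<open>Sobolev 1\<close> and \<open>Sobolev_norm 1\<close> has to keep this
  shape, since rewriting it to \<open>Suc 0\<close> would hide it from the facts stated for order
  1.\<close>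

declare One_nat_def [simp del]

type_synonym 'n vfield = "real ^ 'n \<Rightarrow> real ^ 'n"

text \<open>The last move of the energy estimates: it cancels a norm that may vanish, in which case
  nonnegativity of \<open>c\<close> decides.\<close>

lemma le_if_mult_self_le: "x * x \<le> c * x \<Longrightarrow> 0 \<le> c \<Longrightarrow> x \<le> c" for c x :: real
  by (cases "x \<le> 0") auto

subsection \<open>Weak derivatives\<close>

locale open_domain =
  fixes U :: "(real ^ 'n::finite) set"
  assumes open_domain: "open U"
begin

abbreviation ip :: "(real ^ 'n \<Rightarrow> 'b::euclidean_space) \<Rightarrow> (real ^ 'n \<Rightarrow> 'b) \<Rightarrow> real" where
  "ip \<equiv> L2_inner U"

abbreviation nrm :: "(real ^ 'n \<Rightarrow> 'b::euclidean_space) \<Rightarrow> real" where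
  "nrm \<equiv> L2_norm U"

lemma lmeasurable_domain: "U \<in> sets lebesgue"
  using open_domain by auto

lemma test_fun_L2':
  assumes "\<phi> \<in> test_functions U"
  shows "\<phi> \<in> L2 U" "partial_deriv i \<phi> \<in> L2 U"
  using test_fun_L2[OF lmeasurable_domain assms, of "[]"]
    test_fun_L2[OF lmeasurable_domain assms, of "[i]"] by auto

text \<open>All test functions annihilate the difference of two candidates. Since
  \<open>weak_deriv\<close> is a choice by \<open>SOME\<close>, this is what determines it up to
  null sets.\<close>

lemma weak_deriv_unique:
  assumes "g \<in> L2 U" "g' \<in> L2 U" "has_weak_deriv U is u g" "has_weak_deriv U is u g'"
  shows "ae_eq U g g'"
proof -
  have "ae_eq U (\<lambda>x. g x - g' x) (\<lambda>x. 0)"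
  proof (rule fundamental_lemma[OF open_domain L2_diff[OF assms(1,2)]])
    fix \<phi> :: "real ^ 'n \<Rightarrow> real" assume \<phi>: "\<phi> \<in> test_functions U"
    have "(- 1) ^ length is *\<^sub>R integral\<^sup>L (lebesgue_on U) (\<lambda>x. \<phi> x *\<^sub>R g x) =
        (- 1) ^ length is *\<^sub>R integral\<^sup>L (lebesgue_on U) (\<lambda>x. \<phi> x *\<^sub>R g' x)"
      using assms(3)[unfolded has_weak_deriv_def, rule_format, OF \<phi>]
        assms(4)[unfolded has_weak_deriv_def, rule_format, OF \<phi>] by (rule trans[OF sym])
    then show "integral\<^sup>L (lebesgue_on U) (\<lambda>x. \<phi> x *\<^sub>R (g x - g' x)) = 0"
      by (simp add: scaleR_diff_right L2_scaleR_integrable[OF test_fun_L2'(1)[OF \<phi>]] assms(1,2))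
  qed
  then show ?thesis by (simp add: ae_eq_def)
qed

lemma weak_deriv_eqI:
  assumes "g \<in> L2 U" "has_weak_deriv U is u g"
  shows "weak_deriv U is u \<in> L2 U" "has_weak_deriv U is u (weak_deriv U is u)"
    "ae_eq U (weak_deriv U is u) g"
proof -
  have "weak_deriv U is u \<in> L2 U \<and> has_weak_deriv U is u (weak_deriv U is u)"
    unfolding weak_deriv_def by (rule someI[of _ g]) (use assms in blast)
  then show "weak_deriv U is u \<in> L2 U" "has_weak_deriv U is u (weak_deriv U is u)"
    "ae_eq U (weak_deriv U is u) g"
    using assms weak_deriv_unique by auto
qed

lemma has_weak_deriv_lincomb:
  fixes u v :: "real ^ 'n \<Rightarrow> 'b::euclidean_space"
  assumes "u \<in> L2 U" "v \<in> L2 U" "g \<in> L2 U" "k \<in> L2 U"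
    and "has_weak_deriv U is u g" "has_weak_deriv U is v k"
  shows "has_weak_deriv U is (\<lambda>x. a *\<^sub>R u x + b *\<^sub>R v x) (\<lambda>x. a *\<^sub>R g x + b *\<^sub>R k x)"
  unfolding has_weak_deriv_def
proof (intro allI impI)
  fix \<phi> :: "real ^ 'n \<Rightarrow> real" assume \<phi>: "\<phi> \<in> test_functions U"
  let ?I = "integral\<^sup>L (lebesgue_on U)"
  have lin: "?I (\<lambda>x. \<psi> x *\<^sub>R (a *\<^sub>R f x + b *\<^sub>R h x)) =
      a *\<^sub>R ?I (\<lambda>x. \<psi> x *\<^sub>R f x) + b *\<^sub>R ?I (\<lambda>x. \<psi> x *\<^sub>R h x)"
    if "\<psi> \<in> L2 U" "f \<in> L2 U" "h \<in> L2 U" for \<psi> and f h :: "real ^ 'n \<Rightarrow> 'b"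
  proof -
    have "\<psi> x *\<^sub>R (a *\<^sub>R f x + b *\<^sub>R h x) = a *\<^sub>R (\<psi> x *\<^sub>R f x) + b *\<^sub>R (\<psi> x *\<^sub>R h x)" for x
      by (simp add: algebra_simps)
    moreover have "integrable (lebesgue_on U) (\<lambda>x. a *\<^sub>R (\<psi> x *\<^sub>R f x))"
      "integrable (lebesgue_on U) (\<lambda>x. b *\<^sub>R (\<psi> x *\<^sub>R h x))"
      using that by (auto intro!: integrable_scaleR_right L2_scaleR_integrable simp del: scaleR_scaleR)
    ultimately show ?thesis
      by (simp only: Bochner_Integration.integral_add integral_scaleR_right)
  qed
  show "?I (\<lambda>x. partial_derivs is \<phi> x *\<^sub>R (a *\<^sub>R u x + b *\<^sub>R v x)) =
      (- 1) ^ length is *\<^sub>R ?I (\<lambda>x. \<phi> x *\<^sub>R (a *\<^sub>R g x + b *\<^sub>R k x))"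
    unfolding lin[OF test_fun_L2[OF lmeasurable_domain \<phi>] assms(1,2)]
      lin[OF test_fun_L2'(1)[OF \<phi>] assms(3,4)]
      assms(5)[unfolded has_weak_deriv_def, rule_format, OF \<phi>]
      assms(6)[unfolded has_weak_deriv_def, rule_format, OF \<phi>]
    by (simp add: scaleR_add_right mult.commute)
qed

lemma has_weak_deriv_cong:
  assumes "u \<in> L2 U" "v \<in> L2 U" "ae_eq U u v"
  shows "has_weak_deriv U is u g \<longleftrightarrow> has_weak_deriv U is v g"
proof -
  have "integral\<^sup>L (lebesgue_on U) (\<lambda>x. partial_derivs is \<phi> x *\<^sub>R u x) =
      integral\<^sup>L (lebesgue_on U) (\<lambda>x. partial_derivs is \<phi> x *\<^sub>R v x)"
    if "\<phi> \<in> test_functions U" for \<phi> :: "real ^ 'n \<Rightarrow> real"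
  proof (rule integral_cong_AE)
    show "AE x in lebesgue_on U. partial_derivs is \<phi> x *\<^sub>R u x = partial_derivs is \<phi> x *\<^sub>R v x"
      using assms(3) unfolding ae_eq_def by eventually_elim simp
  qed (intro borel_measurable_scaleR L2_measurable[OF assms(1)] L2_measurable[OF assms(2)]
      L2_measurable[OF test_fun_L2[OF lmeasurable_domain that]])+
  then show ?thesis by (simp add: has_weak_deriv_def)
qed

text \<open>The equality is literal: the defining integrals do not distinguish \<open>u\<close> from
  \<open>v\<close>, so \<open>SOME\<close> is applied to the same predicate on both sides.\<close>

lemma weak_deriv_cong:
  "u \<in> L2 U \<Longrightarrow> v \<in> L2 U \<Longrightarrow> ae_eq U u v \<Longrightarrow> weak_deriv U is u = weak_deriv U is v"
  by (simp add: weak_deriv_def has_weak_deriv_cong[of u v])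

lemma Sobolev_L2: "u \<in> Sobolev m U \<Longrightarrow> u \<in> L2 U"
  by (simp add: Sobolev_def)

lemma Sobolev_mono: "u \<in> Sobolev m U \<Longrightarrow> k \<le> m \<Longrightarrow> u \<in> Sobolev k U"
  by (auto simp: Sobolev_def)

lemma Sobolev_weak_deriv:
  assumes "u \<in> Sobolev m U" "length is \<le> m"
  shows "weak_deriv U is u \<in> L2 U" "has_weak_deriv U is u (weak_deriv U is u)"
proof -
  obtain g where g: "g \<in> L2 U" "has_weak_deriv U is u g" using assms by (auto simp: Sobolev_def)
  show "weak_deriv U is u \<in> L2 U" "has_weak_deriv U is u (weak_deriv U is u)"
    by (fact weak_deriv_eqI[OF g])+
qed

lemma Sobolev_weak_deriv_1:
  assumes "u \<in> Sobolev 1 U"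
  shows "weak_deriv U [i] u \<in> L2 U" "has_weak_deriv U [i] u (weak_deriv U [i] u)"
  using Sobolev_weak_deriv[OF assms, of "[i]"] by auto

lemma Sobolev_lincomb:
  assumes "u \<in> Sobolev m U" "v \<in> Sobolev m U"
  shows "(\<lambda>x. a *\<^sub>R u x + b *\<^sub>R v x) \<in> Sobolev m U"
proof -
  have "(\<lambda>x. a *\<^sub>R weak_deriv U is u x + b *\<^sub>R weak_deriv U is v x) \<in> L2 U"
    "has_weak_deriv U is (\<lambda>x. a *\<^sub>R u x + b *\<^sub>R v x)
      (\<lambda>x. a *\<^sub>R weak_deriv U is u x + b *\<^sub>R weak_deriv U is v x)" if "length is \<le> m" for "is"
    by (intro L2_lincomb has_weak_deriv_lincomb Sobolev_L2[OF assms(1)] Sobolev_L2[OF assms(2)]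
        Sobolev_weak_deriv[OF assms(1) that] Sobolev_weak_deriv[OF assms(2) that])+
  then have "\<exists>g\<in>L2 U. has_weak_deriv U is (\<lambda>x. a *\<^sub>R u x + b *\<^sub>R v x) g" if "length is \<le> m" for "is"
    using that by (intro bexI[of _ "\<lambda>x. a *\<^sub>R weak_deriv U is u x + b *\<^sub>R weak_deriv U is v x"])
  then show ?thesis
    using L2_lincomb[OF Sobolev_L2[OF assms(1)] Sobolev_L2[OF assms(2)]] by (simp add: Sobolev_def)
qed

lemma weak_deriv_lincomb:
  assumes "u \<in> Sobolev m U" "v \<in> Sobolev m U" "length is \<le> m"
  shows "ae_eq U (weak_deriv U is (\<lambda>x. a *\<^sub>R u x + b *\<^sub>R v x))
    (\<lambda>x. a *\<^sub>R weak_deriv U is u x + b *\<^sub>R weak_deriv U is v x)"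
  by (intro weak_deriv_eqI(3)[OF L2_lincomb has_weak_deriv_lincomb]
      Sobolev_L2[OF assms(1)] Sobolev_L2[OF assms(2)] Sobolev_weak_deriv[OF assms(1,3)]
      Sobolev_weak_deriv[OF assms(2,3)])

lemma has_weak_deriv_zero: "has_weak_deriv U is (\<lambda>x. 0) (\<lambda>x. 0)"
  by (simp add: has_weak_deriv_def)

lemma Sobolev_zero: "(\<lambda>x. 0) \<in> Sobolev m U"
  using has_weak_deriv_zero L2_zero by (auto simp: Sobolev_def)

lemma Sobolev_sum:
  "(\<And>i. i \<in> A \<Longrightarrow> f i \<in> Sobolev m U) \<Longrightarrow> (\<lambda>x. \<Sum>i\<in>A. f i x) \<in> Sobolev m U"
proof (induction A rule: infinite_finite_induct)
  case (insert i A)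
  then show ?case using Sobolev_lincomb[of "f i" m "\<lambda>x. \<Sum>i\<in>A. f i x" 1 1] by simp
qed (auto intro: Sobolev_zero)

text \<open>Testing the derivative along \<open>js\<close> with
  \<open>partial_derivs is \<phi>\<close> produces \<open>partial_derivs (js @ is) \<phi>\<close>,
  which dictates the order of the concatenation. With this order the symmetry of mixed derivatives
  never comes up.\<close>

lemma has_weak_deriv_weak_deriv:
  assumes "u \<in> Sobolev m U" "length js + length is \<le> m"
  shows "has_weak_deriv U is (weak_deriv U js u) (weak_deriv U (js @ is) u)"
  unfolding has_weak_deriv_def
proof (intro allI impI)
  fix \<phi> :: "real ^ 'n \<Rightarrow> real" assume \<phi>: "\<phi> \<in> test_functions U"
  let ?I = "integral\<^sup>L (lebesgue_on U)"
  have "?I (\<lambda>x. partial_derivs (js @ is) \<phi> x *\<^sub>R u x) =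
      (- 1) ^ length js *\<^sub>R ?I (\<lambda>x. partial_derivs is \<phi> x *\<^sub>R weak_deriv U js u x)"
    using Sobolev_weak_deriv(2)[OF assms(1), of js, unfolded has_weak_deriv_def, rule_format,
        OF _ test_fun_partial_derivs[OF \<phi>, of "is"]] assms(2)
    by (simp add: partial_derivs_append)
  moreover have "?I (\<lambda>x. partial_derivs (js @ is) \<phi> x *\<^sub>R u x) =
      (- 1) ^ length (js @ is) *\<^sub>R ?I (\<lambda>x. \<phi> x *\<^sub>R weak_deriv U (js @ is) u x)"
    using Sobolev_weak_deriv(2)[OF assms(1), of "js @ is"] \<phi> assms(2)
    by (simp add: has_weak_deriv_def)
  \<comment> \<open>Both sides are multiplied by the sign belonging to \<open>js\<close>, whose
    square is 1.\<close>
  ultimately have "(- 1) ^ length js *\<^sub>R (- 1) ^ length js *\<^sub>R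
        ?I (\<lambda>x. partial_derivs is \<phi> x *\<^sub>R weak_deriv U js u x) =
      (- 1) ^ length js *\<^sub>R (- 1) ^ length (js @ is) *\<^sub>R ?I (\<lambda>x. \<phi> x *\<^sub>R weak_deriv U (js @ is) u x)"
    by simp
  then show "?I (\<lambda>x. partial_derivs is \<phi> x *\<^sub>R weak_deriv U js u x) =
      (- 1) ^ length is *\<^sub>R ?I (\<lambda>x. \<phi> x *\<^sub>R weak_deriv U (js @ is) u x)"
    by (simp add: power_add flip: mult.assoc power_mult_distrib)
qed

lemma weak_deriv_Sobolev:
  assumes "u \<in> Sobolev (length js + m) U"
  shows "weak_deriv U js u \<in> Sobolev m U"
proof -
  have "\<exists>g\<in>L2 U. has_weak_deriv U is (weak_deriv U js u) g" if "length is \<le> m" for "is"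
    using that has_weak_deriv_weak_deriv[OF assms, of js "is"]
      Sobolev_weak_deriv(1)[OF assms, of "js @ is"] by auto
  then show ?thesis using Sobolev_weak_deriv(1)[OF assms, of js] by (simp add: Sobolev_def)
qed

lemma laplacian_Sobolev:
  assumes "u \<in> Sobolev (m + 2) U"
  shows "laplacian U u \<in> Sobolev m U"
proof -
  have "(\<lambda>x. \<Sum>i\<in>UNIV. weak_deriv U [i, i] u x) \<in> Sobolev m U"
    by (intro Sobolev_sum weak_deriv_Sobolev) (use assms in simp)
  then show ?thesis by (simp add: laplacian_def[abs_def])
qed

lemma laplacian_L2: "u \<in> Sobolev 2 U \<Longrightarrow> laplacian U u \<in> L2 U"
  using Sobolev_L2[OF laplacian_Sobolev[of u 0, unfolded add_0]] .

text \<open>Integration by parts takes the outermost derivative, the head of the list, off the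
  scalar test function and makes it the innermost one of \<open>v\<close>; therefore the list is
  reversed.\<close>

lemma has_weak_deriv_test_function:
  assumes "v \<in> test_functions U"
  shows "has_weak_deriv U is v (partial_derivs (rev is) v)"
  using assms
proof (induction "is" arbitrary: v)
  case (Cons i "is")
  have v': "partial_deriv i v \<in> test_functions U"
    using test_fun_partial_derivs[OF Cons.prems, of "[i]"] by simp
  have "partial_derivs (rev is) (partial_deriv i v) = partial_derivs (rev (i # is)) v"
    using partial_derivs_append[of "rev is" "[i]" v] by simp
  with Cons.IH[OF v'] show ?case
    using integration_by_parts[OF lmeasurable_domain test_fun_partial_derivs Cons.prems]
    by (simp add: has_weak_deriv_def)
qed (simp add: has_weak_deriv_def)

lemma test_fun_Sobolev: "v \<in> test_functions U \<Longrightarrow> v \<in> Sobolev m U"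
  using has_weak_deriv_test_function test_fun_L2[OF lmeasurable_domain] test_fun_L2'(1)
  unfolding Sobolev_def by blast

lemma weak_deriv_test_function:
  "v \<in> test_functions U \<Longrightarrow> ae_eq U (weak_deriv U [i] v) (partial_deriv i v)"
  using weak_deriv_eqI(3)[OF _ has_weak_deriv_test_function[of v "[i]"]] test_fun_L2'(2)[of v i]
  by simp

lemma weak_deriv_Nil: "u \<in> L2 U \<Longrightarrow> ae_eq U (weak_deriv U [] u) u"
  by (rule weak_deriv_eqI) (auto simp: has_weak_deriv_def)

text \<open>Weak derivatives are defined by scalar test functions. A vector-valued
  \<open>\<phi>\<close> is handled through its coordinates, each of which is a scalar test
  function.\<close>

lemma has_weak_deriv_inner:
  fixes u :: "real ^ 'n \<Rightarrow> 'b::euclidean_space"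
  assumes "has_weak_deriv U [i] u g" "u \<in> L2 U" "g \<in> L2 U" and \<phi>: "\<phi> \<in> test_functions U"
  shows "ip u (partial_deriv i \<phi>) = - ip g \<phi>"
proof -
  let ?I = "integral\<^sup>L (lebesgue_on U)"
  have sum: "ip f h = (\<Sum>b\<in>Basis. ?I (\<lambda>x. (h x \<bullet> b) *\<^sub>R f x) \<bullet> b)"
    if "f \<in> L2 U" "h \<in> L2 U" for f h :: "real ^ 'n \<Rightarrow> 'b"
  proof -
    have h: "(\<lambda>x. h x \<bullet> b) \<in> L2 U" for b
      by (rule L2_linear_image[OF bounded_linear_inner_left that(2)])
    note int = L2_scaleR_integrable[OF h that(1)]
    have "f x \<bullet> h x = (\<Sum>b\<in>Basis. ((h x \<bullet> b) *\<^sub>R f x) \<bullet> b)" for x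
      by (subst euclidean_inner) (simp add: mult.commute)
    then have "ip f h = ?I (\<lambda>x. \<Sum>b\<in>Basis. ((h x \<bullet> b) *\<^sub>R f x) \<bullet> b)"
      by (simp only: L2_inner_def)
    also have "\<dots> = (\<Sum>b\<in>Basis. ?I (\<lambda>x. ((h x \<bullet> b) *\<^sub>R f x) \<bullet> b))"
      by (intro Bochner_Integration.integral_sum integrable_inner_left int)
    also have "\<dots> = (\<Sum>b\<in>Basis. ?I (\<lambda>x. (h x \<bullet> b) *\<^sub>R f x) \<bullet> b)"
      by (intro sum.cong refl integral_inner_left int)
    finally show ?thesis .
  qed
  have "?I (\<lambda>x. (partial_deriv i \<phi> x \<bullet> b) *\<^sub>R u x) = - ?I (\<lambda>x. (\<phi> x \<bullet> b) *\<^sub>R g x)" for b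
    using assms(1)[unfolded has_weak_deriv_def, rule_format,
        OF test_fun_linear_image[OF bounded_linear_inner_left \<phi>, of b]]
      partial_derivs_linear_image[OF bounded_linear_inner_left[of b] \<phi>, of "[i]"]
    by simp
  then show ?thesis
    using assms test_fun_L2'[OF \<phi>] by (simp add: sum sum_negf)
qed

subsection \<open>Gradient and divergence\<close>

lemma bounded_linear_axis: "bounded_linear (axis i :: 'b::euclidean_space \<Rightarrow> 'b ^ 'n)"
  by (rule linear_conv_bounded_linear[THEN iffD1], rule linearI) (auto simp: vec_eq_iff axis_def)

lemma vec_L2:
  fixes f :: "'n \<Rightarrow> real ^ 'n \<Rightarrow> 'b::euclidean_space"
  assumes "\<And>i. f i \<in> L2 U"
  shows "(\<lambda>x. \<chi> i. f i x) \<in> L2 U"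
proof -
  have "(\<chi> i. f i x) = (\<Sum>i\<in>UNIV. axis i (f i x))" for x
    by (simp add: vec_eq_iff axis_def if_distrib cong: if_cong)
  then show ?thesis
    using L2_sum[of UNIV "\<lambda>i x. axis i (f i x)", OF L2_linear_image[OF bounded_linear_axis assms]]
    by simp
qed

lemma L2_inner_vec:
  fixes f g :: "'n \<Rightarrow> real ^ 'n \<Rightarrow> 'b::euclidean_space"
  assumes "\<And>i. f i \<in> L2 U" "\<And>i. g i \<in> L2 U"
  shows "ip (\<lambda>x. \<chi> i. f i x) (\<lambda>x. \<chi> i. g i x) = (\<Sum>i\<in>UNIV. ip (f i) (g i))"
  unfolding L2_inner_def inner_vec_def
  by (simp add: Bochner_Integration.integral_sum L2_inner_integrable assms)

lemma grad_L2: "u \<in> Sobolev 1 U \<Longrightarrow> grad U u \<in> L2 U"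
  unfolding grad_def[abs_def] by (intro vec_L2 Sobolev_weak_deriv) auto

lemma L2_inner_grad:
  "u \<in> Sobolev 1 U \<Longrightarrow> v \<in> Sobolev 1 U \<Longrightarrow>
    ip (grad U u) (grad U v) = (\<Sum>i\<in>UNIV. ip (weak_deriv U [i] u) (weak_deriv U [i] v))"
  unfolding grad_def[abs_def] by (intro L2_inner_vec Sobolev_weak_deriv) auto

lemma grad_cong: "u \<in> L2 U \<Longrightarrow> v \<in> L2 U \<Longrightarrow> ae_eq U u v \<Longrightarrow> grad U u = grad U v"
  unfolding grad_def[abs_def] by (simp add: weak_deriv_cong[of u v])

lemma ae_eq_vec:
  fixes f g :: "'n \<Rightarrow> real ^ 'n \<Rightarrow> 'b"
  assumes "\<And>i. ae_eq U (f i) (g i)"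
  shows "AE x in lebesgue_on U. \<forall>i. f i x = g i x"
proof -
  have "AE x in lebesgue_on U. \<forall>i\<in>UNIV. f i x = g i x"
    using assms unfolding ae_eq_def by (intro AE_finite_allI) auto
  then show ?thesis by simp
qed

lemma grad_lincomb:
  assumes "u \<in> Sobolev 1 U" "v \<in> Sobolev 1 U"
  shows "ae_eq U (grad U (\<lambda>x. a *\<^sub>R u x + b *\<^sub>R v x)) (\<lambda>x. a *\<^sub>R grad U u x + b *\<^sub>R grad U v x)"
proof -
  have "ae_eq U (weak_deriv U [i] (\<lambda>x. a *\<^sub>R u x + b *\<^sub>R v x))
      (\<lambda>x. a *\<^sub>R weak_deriv U [i] u x + b *\<^sub>R weak_deriv U [i] v x)" for i
    by (rule weak_deriv_lincomb[OF assms]) simp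
  from ae_eq_vec[OF this] show ?thesis
    unfolding ae_eq_def by eventually_elim (simp add: grad_def vec_eq_iff)
qed

lemma norm_weak_deriv_le_grad:
  assumes "u \<in> Sobolev 1 U"
  shows "nrm (weak_deriv U [i] u) \<le> nrm (grad U u)"
proof -
  have "norm (weak_deriv U [i] u x) \<le> 1 * norm (grad U u x)" for x
    using Finite_Cartesian_Product.norm_nth_le[of "grad U u x" i] by (simp add: grad_def)
  then show ?thesis
    using L2_norm_mono[OF grad_L2[OF assms] Sobolev_weak_deriv(1)[OF assms, of "[i]"], of 1] by simp
qed

lemma Sobolev_norm_1:
  assumes "u \<in> Sobolev 1 U"
  shows "(Sobolev_norm 1 U u)\<^sup>2 = (nrm u)\<^sup>2 + (nrm (grad U u))\<^sup>2"
proof -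
  have lists: "{is :: 'n list. length is \<le> 1} = insert [] (range (\<lambda>i. [i]))"
  proof (intro equalityI subsetI)
    fix l :: "'n list" assume "l \<in> {is. length is \<le> 1}"
    then show "l \<in> insert [] (range (\<lambda>i. [i]))" by (cases l) auto
  qed auto
  have "(Sobolev_norm 1 U u)\<^sup>2 = (\<Sum>is\<in>insert [] (range (\<lambda>i. [i])). (nrm (weak_deriv U is u))\<^sup>2)"
    unfolding Sobolev_norm_def lists by (simp add: sum_nonneg)
  also have "\<dots> = (nrm (weak_deriv U [] u))\<^sup>2 +
      (\<Sum>i\<in>UNIV. (nrm (weak_deriv U [i] u))\<^sup>2)"
    by (subst sum.insert) (auto simp: sum.reindex inj_on_def)
  also have "nrm (weak_deriv U [] u) = nrm u"
    using assms by (intro L2_norm_cong weak_deriv_Nil Sobolev_L2 Sobolev_weak_deriv) auto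
  also have "(\<Sum>i\<in>UNIV. (nrm (weak_deriv U [i] u))\<^sup>2) = (nrm (grad U u))\<^sup>2"
    by (simp add: L2_norm_square L2_inner_grad[OF assms assms])
  finally show ?thesis .
qed

lemma Sobolev_norm_nonneg: "0 \<le> Sobolev_norm m U u"
  by (simp add: Sobolev_norm_def sum_nonneg)

lemma Sobolev_norm_1_bounds:
  assumes "u \<in> Sobolev 1 U"
  shows "nrm u \<le> Sobolev_norm 1 U u" "nrm (grad U u) \<le> Sobolev_norm 1 U u"
    "Sobolev_norm 1 U u \<le> nrm u + nrm (grad U u)"
proof -
  show "nrm u \<le> Sobolev_norm 1 U u" "nrm (grad U u) \<le> Sobolev_norm 1 U u"
    by (rule power2_le_imp_le; simp add: Sobolev_norm_1[OF assms] Sobolev_norm_nonneg)+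
  show "Sobolev_norm 1 U u \<le> nrm u + nrm (grad U u)"
    by (rule power2_le_imp_le) (auto simp: Sobolev_norm_1[OF assms] power2_sum L2_norm_nonneg)
qed

lemma Sobolev_norm_zero: "Sobolev_norm 1 U (\<lambda>x. 0 :: 'b::euclidean_space) = 0"
proof -
  have "ae_eq U (grad U (\<lambda>x. 0 :: 'b)) (\<lambda>x. 0)"
    using grad_lincomb[OF Sobolev_zero Sobolev_zero, of 0 0] by simp
  then have "nrm (grad U (\<lambda>x. 0 :: 'b)) = 0"
    using L2_norm_eq_0_iff grad_L2 Sobolev_zero by blast
  then show ?thesis using Sobolev_norm_1[of "\<lambda>x. 0 :: 'b", OF Sobolev_zero] by simp
qed

section \<open>Zero boundary values through approximation by test functions\<close>

lemma H10_Sobolev: "u \<in> H10 U \<Longrightarrow> u \<in> Sobolev 1 U"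
  by (simp add: H10_def)

lemma H10_L2: "u \<in> H10 U \<Longrightarrow> u \<in> L2 U"
  by (simp add: H10_def Sobolev_def)

lemma grad_H10_L2: "u \<in> H10 U \<Longrightarrow> grad U u \<in> L2 U"
  by (intro grad_L2 H10_Sobolev)

lemma test_fun_H10:
  assumes "v \<in> test_functions U"
  shows "v \<in> H10 U"
proof -
  have "\<exists>\<phi>\<in>test_functions U. Sobolev_norm 1 U (\<lambda>x. v x - \<phi> x) < \<epsilon>" if "\<epsilon> > 0" for \<epsilon>
    by (rule bexI[OF _ assms]) (use that in \<open>simp add: Sobolev_norm_zero\<close>)
  then show ?thesis using test_fun_Sobolev[OF assms] by (simp add: H10_def)
qed

lemma H10_approx:
  assumes "u \<in> H10 U" "\<epsilon> > 0"
  obtains \<phi> where "\<phi> \<in> test_functions U"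
    "nrm (\<lambda>x. u x - \<phi> x) < \<epsilon>" "nrm (grad U (\<lambda>x. u x - \<phi> x)) < \<epsilon>"
proof -
  obtain \<phi> where \<phi>: "\<phi> \<in> test_functions U" "Sobolev_norm 1 U (\<lambda>x. u x - \<phi> x) < \<epsilon>"
    using assms by (auto simp: H10_def)
  have "(\<lambda>x. u x - \<phi> x) \<in> Sobolev 1 U"
    using Sobolev_lincomb[OF H10_Sobolev[OF assms(1)] test_fun_Sobolev[OF \<phi>(1)], of 1 "-1"] by simp
  from Sobolev_norm_1_bounds[OF this] \<phi> show ?thesis by (intro that[of \<phi>]) auto
qed

lemma grad_norm_lincomb_le:
  assumes "u \<in> Sobolev 1 U" "v \<in> Sobolev 1 U"
  shows "nrm (grad U (\<lambda>x. a *\<^sub>R u x + b *\<^sub>R v x)) \<le>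
    \<bar>a\<bar> * nrm (grad U u) + \<bar>b\<bar> * nrm (grad U v)"
proof -
  have "nrm (grad U (\<lambda>x. a *\<^sub>R u x + b *\<^sub>R v x)) =
      nrm (\<lambda>x. a *\<^sub>R grad U u x + b *\<^sub>R grad U v x)"
    by (intro L2_norm_cong grad_lincomb assms grad_L2 Sobolev_lincomb L2_lincomb)
  also have "\<dots> \<le> \<bar>a\<bar> * nrm (grad U u) + \<bar>b\<bar> * nrm (grad U v)"
    using L2_norm_triangle[OF L2_scaleR[OF grad_L2[OF assms(1)]] L2_scaleR[OF grad_L2[OF assms(2)]], of a b]
    by (simp add: L2_norm_scaleR)
  finally show ?thesis .
qed

lemma L2_norm_lincomb_le:
  assumes "u \<in> L2 U" "v \<in> L2 U"
  shows "nrm (\<lambda>x. a *\<^sub>R u x + b *\<^sub>R v x) \<le> \<bar>a\<bar> * nrm u + \<bar>b\<bar> * nrm v"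
  using L2_norm_triangle[OF L2_scaleR[OF assms(1)] L2_scaleR[OF assms(2)], of a b]
  by (simp add: L2_norm_scaleR)

lemma H10_lincomb:
  assumes "u \<in> H10 U" "v \<in> H10 U"
  shows "(\<lambda>x. a *\<^sub>R u x + b *\<^sub>R v x) \<in> H10 U"
proof -
  let ?w = "\<lambda>x. a *\<^sub>R u x + b *\<^sub>R v x"
  have w: "?w \<in> Sobolev 1 U" by (intro Sobolev_lincomb H10_Sobolev assms)
  have "\<exists>\<phi>\<in>test_functions U. Sobolev_norm 1 U (\<lambda>x. ?w x - \<phi> x) < \<epsilon>" if "\<epsilon> > 0" for \<epsilon>
  proof -
    \<comment> \<open>The function and gradient errors add up to at most
      \<open>2 * (\<bar>a\<bar> + \<bar>b\<bar>) * \<delta>\<close>. The larger factor with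
      \<open>+ 1\<close> keeps the comparison with \<open>\<epsilon>\<close> strict and the
      denominator positive even if \<open>a\<close> and \<open>b\<close> vanish.\<close>
    define \<delta> where "\<delta> = \<epsilon> / (4 * (\<bar>a\<bar> + \<bar>b\<bar> + 1))"
    have "\<delta> > 0" using that by (auto simp: \<delta>_def intro!: divide_pos_pos)
    obtain \<phi> where \<phi>: "\<phi> \<in> test_functions U" "nrm (\<lambda>x. u x - \<phi> x) < \<delta>"
        "nrm (grad U (\<lambda>x. u x - \<phi> x)) < \<delta>"
      using H10_approx[OF assms(1) \<open>\<delta> > 0\<close>] by blast
    obtain \<psi> where \<psi>: "\<psi> \<in> test_functions U" "nrm (\<lambda>x. v x - \<psi> x) < \<delta>"
        "nrm (grad U (\<lambda>x. v x - \<psi> x)) < \<delta>"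
      using H10_approx[OF assms(2) \<open>\<delta> > 0\<close>] by blast
    have diff: "(\<lambda>x. u x - \<phi> x) \<in> Sobolev 1 U" "(\<lambda>x. v x - \<psi> x) \<in> Sobolev 1 U"
      using Sobolev_lincomb[OF H10_Sobolev[OF assms(1)] test_fun_Sobolev[OF \<phi>(1)], of 1 "-1"]
        Sobolev_lincomb[OF H10_Sobolev[OF assms(2)] test_fun_Sobolev[OF \<psi>(1)], of 1 "-1"] by auto
    let ?d = "\<lambda>x. a *\<^sub>R (u x - \<phi> x) + b *\<^sub>R (v x - \<psi> x)"
    have "Sobolev_norm 1 U ?d \<le> nrm ?d + nrm (grad U ?d)"
      by (intro Sobolev_norm_1_bounds Sobolev_lincomb diff)
    also have "\<dots> \<le> (\<bar>a\<bar> * nrm (\<lambda>x. u x - \<phi> x) + \<bar>b\<bar> * nrm (\<lambda>x. v x - \<psi> x)) +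
        (\<bar>a\<bar> * nrm (grad U (\<lambda>x. u x - \<phi> x)) + \<bar>b\<bar> * nrm (grad U (\<lambda>x. v x - \<psi> x)))"
      by (intro add_mono L2_norm_lincomb_le grad_norm_lincomb_le diff Sobolev_L2[OF diff(1)]
          Sobolev_L2[OF diff(2)])
    also have "\<dots> \<le> (\<bar>a\<bar> * \<delta> + \<bar>b\<bar> * \<delta>) + (\<bar>a\<bar> * \<delta> + \<bar>b\<bar> * \<delta>)"
      using \<phi> \<psi> by (intro add_mono mult_left_mono) auto
    also have "\<dots> = 2 * (\<bar>a\<bar> + \<bar>b\<bar>) * \<delta>" by (simp add: algebra_simps)
    also have "\<dots> < 4 * (\<bar>a\<bar> + \<bar>b\<bar> + 1) * \<delta>"
      using \<open>\<delta> > 0\<close> by (intro mult_strict_right_mono) auto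
    also have "\<dots> = \<epsilon>" by (simp add: \<delta>_def add_nonneg_eq_0_iff)
    finally have "Sobolev_norm 1 U (\<lambda>x. ?w x - (a *\<^sub>R \<phi> x + b *\<^sub>R \<psi> x)) < \<epsilon>"
      by (simp add: scaleR_diff_right algebra_simps)
    then show ?thesis
      using test_fun_lincomb[OF \<phi>(1) \<psi>(1), of a b]
      by (intro bexI[of _ "\<lambda>x. a *\<^sub>R \<phi> x + b *\<^sub>R \<psi> x"])
  qed
  then show ?thesis using w by (simp add: H10_def)
qed

lemma H10_zero: "(\<lambda>x. 0) \<in> H10 U"
  by (intro test_fun_H10 test_fun_zero)

lemma H10_diff: "u \<in> H10 U \<Longrightarrow> v \<in> H10 U \<Longrightarrow> (\<lambda>x. u x - v x) \<in> H10 U"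
  using H10_lincomb[of u v 1 "-1"] by simp

section \<open>The weak divergence\<close>

lemma weak_div_eqI:
  assumes "d \<in> L2 U" "has_weak_div U v d"
  shows "weak_div U v \<in> L2 U" "ae_eq U (weak_div U v) d"
proof -
  have *: "weak_div U v \<in> L2 U \<and> has_weak_div U v (weak_div U v)"
    unfolding weak_div_def by (rule someI[of _ d]) (use assms in blast)
  then show L2: "weak_div U v \<in> L2 U" ..
  have "ae_eq U (\<lambda>x. weak_div U v x - d x) (\<lambda>x. 0)"
  proof (rule fundamental_lemma[OF open_domain L2_diff[OF L2 assms(1)]])
    fix \<phi> :: "real ^ 'n \<Rightarrow> real" assume \<phi>: "\<phi> \<in> test_functions U"
    have "- ip (weak_div U v) \<phi> = - ip d \<phi>"
      using assms(2) * \<phi> unfolding has_weak_div_def by metis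
    then have "ip (\<lambda>x. weak_div U v x - d x) \<phi> = 0"
      using L2_inner_diff_left[OF L2 assms(1) test_fun_L2'(1)[OF \<phi>]] by simp
    then show "integral\<^sup>L (lebesgue_on U) (\<lambda>x. \<phi> x *\<^sub>R (weak_div U v x - d x)) = 0"
      by (simp add: L2_inner_def mult.commute)
  qed
  then show "ae_eq U (weak_div U v) d" by (simp add: ae_eq_def)
qed

text \<open>The function \<open>weak_div U v\<close> is selected independently of the weak
  derivatives of \<open>v\<close>. Identifying it with the trace of the gradient transfers linearity
  and the bound by the gradient norm.\<close>

lemma weak_div_eq_trace:
  fixes v :: "'n vfield"
  assumes "v \<in> Sobolev 1 U"
  shows "weak_div U v \<in> L2 U" "ae_eq U (weak_div U v) (\<lambda>x. \<Sum>i\<in>UNIV. weak_deriv U [i] v x $ i)"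
proof -
  let ?D = "\<lambda>i. weak_deriv U [i] v"
  have D: "?D i \<in> L2 U" "has_weak_deriv U [i] v (?D i)" for i
    using Sobolev_weak_deriv_1[OF assms] by auto
  have nth: "(\<lambda>x. f x $ i) \<in> L2 U" if "f \<in> L2 U" for f :: "'n vfield" and i
    by (rule L2_linear_image[OF bounded_linear_vec_nth that])
  have trace: "(\<lambda>x. \<Sum>i\<in>UNIV. ?D i x $ i) \<in> L2 U" by (intro L2_sum nth D)
  moreover have "has_weak_div U v (\<lambda>x. \<Sum>i\<in>UNIV. ?D i x $ i)"
    unfolding has_weak_div_def
  proof (intro allI impI)
    fix \<phi> :: "real ^ 'n \<Rightarrow> real" assume \<phi>: "\<phi> \<in> test_functions U"
    note v = Sobolev_L2[OF assms]
    have *: "ip (\<lambda>x. v x $ i) (partial_deriv i \<phi>) = - ip (\<lambda>x. ?D i x $ i) \<phi>" for i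
    proof -
      have nth_inner: "integral\<^sup>L (lebesgue_on U) (\<lambda>x. g x *\<^sub>R f x) \<bullet> axis i 1 = ip (\<lambda>x. f x $ i) g"
        if "g \<in> L2 U" "f \<in> L2 U" for g and f :: "'n vfield"
        unfolding L2_inner_def
        by (subst integral_inner_left[symmetric])
          (auto simp: inner_axis mult.commute intro: L2_scaleR_integrable that)
      have "integral\<^sup>L (lebesgue_on U) (\<lambda>x. partial_deriv i \<phi> x *\<^sub>R v x) \<bullet> axis i 1 =
          - (integral\<^sup>L (lebesgue_on U) (\<lambda>x. \<phi> x *\<^sub>R ?D i x) \<bullet> axis i 1)"
        using D(2)[of i] \<phi> by (simp add: has_weak_deriv_def)
      then show ?thesis
        by (simp only: nth_inner test_fun_L2'[OF \<phi>] v D(1))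
    qed
    have "ip (\<lambda>x. \<chi> i. v x $ i) (\<lambda>x. \<chi> i. partial_deriv i \<phi> x) =
        (\<Sum>i\<in>UNIV. ip (\<lambda>x. v x $ i) (partial_deriv i \<phi>))"
      by (intro L2_inner_vec nth v test_fun_L2' \<phi>)
    also have "\<dots> = - ip (\<lambda>x. \<Sum>i\<in>UNIV. ?D i x $ i) \<phi>"
      by (simp add: * sum_negf L2_inner_sum_left nth D test_fun_L2'(1)[OF \<phi>])
    finally show "ip v (\<lambda>x. \<chi> i. partial_deriv i \<phi> x) = - ip (\<lambda>x. \<Sum>i\<in>UNIV. ?D i x $ i) \<phi>"
      by simp
  qed
  ultimately show "weak_div U v \<in> L2 U" "ae_eq U (weak_div U v) (\<lambda>x. \<Sum>i\<in>UNIV. ?D i x $ i)"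
    by (rule weak_div_eqI)+
qed

text \<open>Each of the \<open>CARD('n)\<close> diagonal entries is bounded by the Frobenius norm of
  the gradient. This crude factor reappears in the constants of quasi-optimality and of the duality
  argument.\<close>

lemma weak_div_norm_le_grad:
  fixes v :: "'n vfield"
  assumes "v \<in> Sobolev 1 U"
  shows "nrm (weak_div U v) \<le> real CARD('n) * nrm (grad U v)"
proof (rule L2_norm_mono[OF grad_L2[OF assms] weak_div_eq_trace(1)[OF assms]])
  have "norm (\<Sum>i\<in>UNIV. weak_deriv U [i] v x $ i) \<le> real CARD('n) * norm (grad U v x)" for x
  proof (rule sum_norm_bound)
    fix i
    have "norm (weak_deriv U [i] v x $ i) \<le> norm (grad U v x $ i)"
      using Finite_Cartesian_Product.norm_nth_le[of "grad U v x $ i" i] by (simp add: grad_def)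
    also have "\<dots> \<le> norm (grad U v x)" by (rule Finite_Cartesian_Product.norm_nth_le)
    finally show "norm (weak_deriv U [i] v x $ i) \<le> norm (grad U v x)" .
  qed
  then show "AE x in lebesgue_on U. norm (weak_div U v x) \<le> real CARD('n) * norm (grad U v x)"
    using weak_div_eq_trace(2)[OF assms] unfolding ae_eq_def by (auto elim: eventually_mono)
qed simp

lemma weak_div_lincomb:
  fixes u v :: "'n vfield"
  assumes "u \<in> Sobolev 1 U" "v \<in> Sobolev 1 U"
  shows "ae_eq U (weak_div U (\<lambda>x. a *\<^sub>R u x + b *\<^sub>R v x)) (\<lambda>x. a *\<^sub>R weak_div U u x + b *\<^sub>R weak_div U v x)"
  using weak_div_eq_trace(2)[OF Sobolev_lincomb[OF assms, of a b]]
    weak_div_eq_trace(2)[OF assms(1)] weak_div_eq_trace(2)[OF assms(2)] grad_lincomb[OF assms, of a b]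
  unfolding ae_eq_def
proof eventually_elim
  case (elim x)
  have "weak_deriv U [i] (\<lambda>x. a *\<^sub>R u x + b *\<^sub>R v x) x =
      a *\<^sub>R weak_deriv U [i] u x + b *\<^sub>R weak_deriv U [i] v x" for i
    using arg_cong[OF elim(4), of "\<lambda>y. y $ i"] by (simp add: grad_def)
  with elim(1-3) show ?case by (simp add: sum.distrib sum_distrib_left)
qed

lemma L2_inner_weak_div_lincomb:
  fixes u v :: "'n vfield"
  assumes "u \<in> Sobolev 1 U" "v \<in> Sobolev 1 U" "q \<in> L2 U"
  shows "ip (weak_div U (\<lambda>x. a *\<^sub>R u x + b *\<^sub>R v x)) q =
    a * ip (weak_div U u) q + b * ip (weak_div U v) q"
proof -
  note L2 = weak_div_eq_trace(1)[OF assms(1)] weak_div_eq_trace(1)[OF assms(2)]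
  have "ip (weak_div U (\<lambda>x. a *\<^sub>R u x + b *\<^sub>R v x)) q =
      ip (\<lambda>x. a *\<^sub>R weak_div U u x + b *\<^sub>R weak_div U v x) q"
    by (intro L2_inner_cong weak_div_lincomb ae_eq_refl weak_div_eq_trace Sobolev_lincomb L2_lincomb
        L2 assms)
  then show ?thesis using L2_inner_lincomb_left[OF L2 assms(3)] by simp
qed

lemma weak_div_cong:
  fixes u v :: "'n vfield"
  assumes "u \<in> L2 U" "v \<in> L2 U" "ae_eq U u v"
  shows "weak_div U u = weak_div U v"
proof -
  have "has_weak_div U u d \<longleftrightarrow> has_weak_div U v d" for d
  proof -
    have "ip u (\<lambda>x. \<chi> i. partial_deriv i \<phi> x) = ip v (\<lambda>x. \<chi> i. partial_deriv i \<phi> x)"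
      if "\<phi> \<in> test_functions U" for \<phi> :: "real ^ 'n \<Rightarrow> real"
      by (intro L2_inner_cong assms ae_eq_refl vec_L2 test_fun_L2' that)
    then show ?thesis by (simp add: has_weak_div_def)
  qed
  then show ?thesis by (simp add: weak_div_def)
qed

lemma L2_inner_grad_lincomb_left:
  assumes "u \<in> Sobolev 1 U" "v \<in> Sobolev 1 U" "w \<in> Sobolev 1 U"
  shows "ip (grad U (\<lambda>x. a *\<^sub>R u x + b *\<^sub>R v x)) (grad U w) =
    a * ip (grad U u) (grad U w) + b * ip (grad U v) (grad U w)"
proof -
  have "ip (grad U (\<lambda>x. a *\<^sub>R u x + b *\<^sub>R v x)) (grad U w) =
      ip (\<lambda>x. a *\<^sub>R grad U u x + b *\<^sub>R grad U v x) (grad U w)"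
    by (intro L2_inner_cong grad_lincomb ae_eq_refl grad_L2 Sobolev_lincomb L2_lincomb assms)
  then show ?thesis using L2_inner_lincomb_left[OF grad_L2 grad_L2 grad_L2] assms by simp
qed

lemma L2_inner_grad_lincomb_right:
  assumes "u \<in> Sobolev 1 U" "v \<in> Sobolev 1 U" "w \<in> Sobolev 1 U"
  shows "ip (grad U w) (grad U (\<lambda>x. a *\<^sub>R u x + b *\<^sub>R v x)) =
    a * ip (grad U w) (grad U u) + b * ip (grad U w) (grad U v)"
  using L2_inner_grad_lincomb_left[OF assms] by (simp add: L2_inner_commute[of U "grad U w"])

section \<open>Green's formula and the Poincare inequality\<close>

lemma Green_test_function:
  fixes u :: "real ^ 'n \<Rightarrow> 'b::euclidean_space"
  assumes "u \<in> Sobolev 2 U" and \<phi>: "\<phi> \<in> test_functions U"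
  shows "ip (grad U u) (grad U \<phi>) = - ip (laplacian U u) \<phi>"
proof -
  note u1 = Sobolev_mono[OF assms(1), of 1, simplified]
  have D: "weak_deriv U [i] u \<in> L2 U" "weak_deriv U [i, i] u \<in> L2 U" for i
    using Sobolev_weak_deriv(1)[OF assms(1)] by auto
  have "ip (weak_deriv U [i] u) (weak_deriv U [i] \<phi>) = - ip (weak_deriv U [i, i] u) \<phi>" for i
  proof -
    have "ip (weak_deriv U [i] u) (weak_deriv U [i] \<phi>) =
        ip (weak_deriv U [i] u) (partial_deriv i \<phi>)"
      by (intro L2_inner_cong[OF ae_eq_refl weak_deriv_test_function] D \<phi> test_fun_L2'(2)[OF \<phi>]
          Sobolev_weak_deriv_1 test_fun_Sobolev)
    also have "\<dots> = - ip (weak_deriv U [i, i] u) \<phi>"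
      using has_weak_deriv_weak_deriv[OF assms(1), of "[i]" "[i]"]
      by (intro has_weak_deriv_inner D \<phi>) simp
    finally show ?thesis .
  qed
  then show ?thesis
    using L2_inner_grad[OF _ test_fun_Sobolev[OF \<phi>], of u] u1
    by (simp add: laplacian_def[abs_def] L2_inner_sum_left D test_fun_L2'(1)[OF \<phi>] sum_negf)
qed

text \<open>Both sides are continuous in \<open>v\<close> for the norm of order 1, so the identity
  extends from test functions to their limits. This also accounts for the absence of a boundary
  term, although \<open>u\<close> satisfies no boundary condition.\<close>

lemma Green:
  fixes u :: "real ^ 'n \<Rightarrow> 'b::euclidean_space"
  assumes u: "u \<in> Sobolev 2 U" and v: "v \<in> H10 U"
  shows "ip (grad U u) (grad U v) = - ip (laplacian U u) v"
proof -
  have u1: "u \<in> Sobolev 1 U" by (rule Sobolev_mono[OF u]) simp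
  let ?l = "ip (grad U u) (grad U v) + ip (laplacian U u) v"
  let ?C = "nrm (grad U u) + nrm (laplacian U u)"
  have "\<bar>?l\<bar> \<le> 0 + e" if "e > 0" for e
  proof -
    \<comment> \<open>The added 1 keeps the tolerance \<open>e / (?C + 1)\<close> meaningful when
      \<open>?C\<close> vanishes.\<close>
    have "?C + 1 > 0" by (simp add: L2_norm_nonneg add_nonneg_pos)
    then have "e / (?C + 1) > 0" using that by simp
    then obtain \<phi> where \<phi>: "\<phi> \<in> test_functions U"
        "nrm (\<lambda>x. v x - \<phi> x) < e / (?C + 1)" "nrm (grad U (\<lambda>x. v x - \<phi> x)) < e / (?C + 1)"
      using H10_approx[OF v] by blast
    have d: "(\<lambda>x. v x - \<phi> x) \<in> H10 U" by (intro H10_diff v test_fun_H10 \<phi>)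
    have "ip (grad U u) (grad U (\<lambda>x. v x - \<phi> x)) =
        ip (grad U u) (grad U v) - ip (grad U u) (grad U \<phi>)"
      using L2_inner_grad_lincomb_right[OF H10_Sobolev[OF v] test_fun_Sobolev[OF \<phi>(1)] u1, of 1 "-1"]
      by simp
    moreover have "ip (laplacian U u) (\<lambda>x. v x - \<phi> x) =
        ip (laplacian U u) v - ip (laplacian U u) \<phi>"
      by (intro L2_inner_diff_right H10_L2 v test_fun_L2' \<phi> laplacian_L2 u)
    ultimately have "?l = ip (grad U u) (grad U (\<lambda>x. v x - \<phi> x)) +
        ip (laplacian U u) (\<lambda>x. v x - \<phi> x)"
      using Green_test_function[OF u \<phi>(1)] by simp
    also have "\<bar>\<dots>\<bar> \<le> nrm (grad U u) * nrm (grad U (\<lambda>x. v x - \<phi> x)) +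
        nrm (laplacian U u) * nrm (\<lambda>x. v x - \<phi> x)"
      by (intro order_trans[OF abs_triangle_ineq] add_mono L2_Cauchy_Schwarz grad_L2 u1
          H10_Sobolev d H10_L2 laplacian_L2 u)
    also have "\<dots> \<le> nrm (grad U u) * (e / (?C + 1)) + nrm (laplacian U u) * (e / (?C + 1))"
      using \<phi> by (intro add_mono mult_left_mono) (auto simp: L2_norm_nonneg)
    also have "\<dots> = ?C * (e / (?C + 1))" by (simp only: distrib_right)
    also have "\<dots> \<le> (?C + 1) * (e / (?C + 1))"
      using \<open>e / (?C + 1) > 0\<close> by (intro mult_right_mono) auto
    also have "\<dots> = e" using \<open>?C + 1 > 0\<close> by simp
    finally show ?thesis by simp
  qed
  then have "\<bar>?l\<bar> \<le> 0" by (rule field_le_epsilon)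
  then show ?thesis by simp
qed

text \<open>The derivative in direction \<open>i\<close> of \<open>x $ i\<close> times the squared
  norm of \<open>\<phi> x\<close> has integral zero. By the product rule the squared norm of
  \<open>\<phi>\<close> equals minus twice the inner product of
  \<open>x $ i *\<^sub>R \<phi> x\<close> with the partial derivative; Cauchy-Schwarz and the bound
  \<open>R\<close> give the factor \<open>2 * R\<close>.\<close>

lemma Poincare_test_function:
  fixes \<phi> :: "real ^ 'n \<Rightarrow> 'b::euclidean_space"
  assumes \<phi>: "\<phi> \<in> test_functions U" and R: "\<And>x. x \<in> U \<Longrightarrow> \<bar>x $ i\<bar> \<le> R" "0 \<le> R"
  shows "nrm \<phi> \<le> 2 * R * nrm (partial_deriv i \<phi>)"
proof -
  let ?I = "integral\<^sup>L (lebesgue_on U)" and ?D = "partial_deriv i \<phi>"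
  obtain K where K: "compact K" "K \<subseteq> U" "\<And>is x. x \<notin> K \<Longrightarrow> partial_derivs is \<phi> x = 0"
    using test_fun_support[OF \<phi>] by blast
  have \<phi>K: "\<phi> x = 0" if "x \<notin> K" for x using K(3)[OF that, of "[]"] by simp
  have diff: "\<phi> differentiable at x" for x
    using test_fun_differentiable[OF \<phi>, of "[]"] by simp
  have cont: "continuous_on S \<phi>" "continuous_on S ?D" for S
    using test_fun_continuous[OF \<phi>, of S "[]"] test_fun_continuous[OF \<phi>, of S "[i]"] by auto
  have nth: "((\<lambda>x. x $ i) has_derivative (\<lambda>x. x $ i)) (at x)" for x :: "real ^ 'n"
    by (rule bounded_linear_imp_has_derivative[OF bounded_linear_vec_nth])
  have diff2: "(\<lambda>x. \<phi> x \<bullet> \<phi> x) differentiable at x" for x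
    by (intro differentiable_inner diff)
  have deriv: "partial_deriv i (\<lambda>x. x $ i *\<^sub>R (\<phi> x \<bullet> \<phi> x)) = (\<lambda>x. \<phi> x \<bullet> \<phi> x + 2 * ((x $ i *\<^sub>R \<phi> x) \<bullet> ?D x))"
  proof
    fix x :: "real ^ 'n"
    have "(\<lambda>x :: real ^ 'n. x $ i) differentiable at x" using nth unfolding differentiable_def by blast
    from partial_deriv_scaleR[OF this diff2]
    show "partial_deriv i (\<lambda>x. x $ i *\<^sub>R (\<phi> x \<bullet> \<phi> x)) x = \<phi> x \<bullet> \<phi> x + 2 * ((x $ i *\<^sub>R \<phi> x) \<bullet> ?D x)"
      by (simp add: partial_deriv_eq[OF nth] partial_deriv_inner[OF diff diff] inner_commute algebra_simps)
  qed
  have x\<phi>: "(\<lambda>x. x $ i *\<^sub>R \<phi> x) \<in> L2 U"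
    by (rule L2_continuous_compact_support[OF lmeasurable_domain K(1)])
      (auto intro!: continuous_intros cont simp: \<phi>K)
  note L2 = test_fun_L2'[OF \<phi>]
  have "?I (partial_deriv i (\<lambda>x. x $ i *\<^sub>R (\<phi> x \<bullet> \<phi> x))) = 0"
  proof (rule integral_on_partial_deriv_eq_0[OF lmeasurable_domain K(1,2)])
    show "(\<lambda>x. x $ i *\<^sub>R (\<phi> x \<bullet> \<phi> x)) differentiable at x" for x
      using nth diff2 by (intro differentiable_scaleR) (auto simp: differentiable_def)
    show "continuous_on UNIV (partial_deriv i (\<lambda>x. x $ i *\<^sub>R (\<phi> x \<bullet> \<phi> x)))"
      unfolding deriv by (intro continuous_intros cont)
  qed (simp add: \<phi>K)
  then have "ip \<phi> \<phi> + 2 * ip (\<lambda>x. x $ i *\<^sub>R \<phi> x) ?D = 0"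
    unfolding deriv L2_inner_def
    using L2_inner_integrable[OF L2(1,1)] L2_inner_integrable[OF x\<phi> L2(2)[of i]] by simp
  then have "(nrm \<phi>)\<^sup>2 \<le> 2 * \<bar>ip (\<lambda>x. x $ i *\<^sub>R \<phi> x) ?D\<bar>"
    by (simp add: L2_norm_square)
  also have "\<dots> \<le> 2 * (nrm (\<lambda>x. x $ i *\<^sub>R \<phi> x) * nrm ?D)"
    by (intro mult_left_mono L2_Cauchy_Schwarz x\<phi> L2) auto
  also have "nrm (\<lambda>x. x $ i *\<^sub>R \<phi> x) \<le> R * nrm \<phi>"
    by (rule L2_norm_mono[OF L2(1) x\<phi> R(2)])
      (auto intro!: AE_I2 mult_right_mono R simp: space_restrict_space)
  finally have "nrm \<phi> * nrm \<phi> \<le> (2 * R * nrm ?D) * nrm \<phi>"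
    by (simp add: power2_eq_square mult_right_mono L2_norm_nonneg algebra_simps)
  then show ?thesis by (rule le_if_mult_self_le) (simp add: R(2) L2_norm_nonneg)
qed

lemma Poincare:
  assumes "bounded U"
  obtains C where "C > 0" "\<And>u. u \<in> H10 U \<Longrightarrow> nrm (u :: real ^ 'n \<Rightarrow> 'b::euclidean_space) \<le> C * nrm (grad U u)"
proof -
  obtain R where R: "R > 0" "\<And>x. x \<in> U \<Longrightarrow> norm x \<le> R"
    using assms by (auto simp: bounded_pos)
  \<comment> \<open>Any one direction will do, since a single partial derivative is already bounded
    by the gradient.\<close>
  fix i :: 'n
  have Ri: "\<bar>x $ i\<bar> \<le> R" if "x \<in> U" for x
    using R(2)[OF that] component_le_norm_cart[of x i] by linarith
  have "nrm u \<le> 2 * R * nrm (grad U u) + e"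
    if u: "u \<in> H10 U" and "e > 0" for u :: "real ^ 'n \<Rightarrow> 'b" and e
  proof -
    \<comment> \<open>Passing from \<open>u\<close> to \<open>\<phi>\<close> costs this tolerance
      once directly and \<open>2 * R\<close> times through the gradient; together that is exactly
      \<open>e\<close>.\<close>
    have "e / (2 * R + 1) > 0" using R(1) \<open>e > 0\<close> by simp
    then obtain \<phi> where \<phi>: "\<phi> \<in> test_functions U"
        "nrm (\<lambda>x. u x - \<phi> x) < e / (2 * R + 1)" "nrm (grad U (\<lambda>x. u x - \<phi> x)) < e / (2 * R + 1)"
      using H10_approx[OF u] by blast
    have d: "(\<lambda>x. u x - \<phi> x) \<in> Sobolev 1 U" by (intro H10_Sobolev H10_diff u test_fun_H10 \<phi>)
    have "nrm (partial_deriv i \<phi>) = nrm (weak_deriv U [i] \<phi>)"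
      by (rule L2_norm_cong[OF ae_eq_sym[OF weak_deriv_test_function[OF \<phi>(1)]]])
        (intro Sobolev_weak_deriv_1 test_fun_Sobolev test_fun_L2'(2) \<phi>(1))+
    also have "\<dots> \<le> nrm (grad U \<phi>)"
      by (intro norm_weak_deriv_le_grad test_fun_Sobolev \<phi>)
    also have "\<dots> \<le> nrm (grad U u) + nrm (grad U (\<lambda>x. u x - \<phi> x))"
      using grad_norm_lincomb_le[OF H10_Sobolev[OF u] d, of 1 "-1"] by simp
    finally have grad: "nrm (partial_deriv i \<phi>) \<le> nrm (grad U u) + e / (2 * R + 1)"
      using \<phi>(3) by simp
    have "nrm u \<le> nrm \<phi> + nrm (\<lambda>x. u x - \<phi> x)"
      by (intro L2_norm_triangle_diff H10_L2 u test_fun_L2' \<phi>)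
    also have "nrm \<phi> \<le> 2 * R * nrm (partial_deriv i \<phi>)"
      using Poincare_test_function[OF \<phi>(1) Ri] R(1) by simp
    also have "\<dots> \<le> 2 * R * (nrm (grad U u) + e / (2 * R + 1))"
      using grad R(1) by (intro mult_left_mono) auto
    also have "nrm (\<lambda>x. u x - \<phi> x) \<le> e / (2 * R + 1)" using \<phi>(2) by simp
    also have "2 * R * (nrm (grad U u) + e / (2 * R + 1)) + e / (2 * R + 1) =
        2 * R * nrm (grad U u) + e"
    proof -
      have "2 * R * (e / (2 * R + 1)) + e / (2 * R + 1) = (2 * R + 1) * (e / (2 * R + 1))"
        by (simp only: distrib_right mult_1)
      also have "\<dots> = e" using R(1) by simp
      finally show ?thesis by (simp add: distrib_left)
    qed
    finally show ?thesis by simp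
  qed
  then have "nrm u \<le> 2 * R * nrm (grad U u)" if "u \<in> H10 U" for u :: "real ^ 'n \<Rightarrow> 'b"
    using field_le_epsilon that by blast
  then show thesis using R(1) that[of "2 * R"] by simp
qed

lemma grad_eq_0_imp_zero:
  assumes "bounded U" "u \<in> H10 U" "nrm (grad U u) = 0"
  shows "ae_eq U u (\<lambda>x. 0)"
proof -
  obtain C where "nrm u \<le> C * nrm (grad U u)" using Poincare[OF assms(1)] assms(2) by metis
  then have "nrm u = 0" using assms(3) L2_norm_nonneg[of U u] by simp
  then show ?thesis using L2_norm_eq_0_iff H10_L2[OF assms(2)] by blast
qed

end

subsection \<open>Finite-dimensional subspaces of \<open>H\<^sup>1\<^sub>0\<close>\<close>

text \<open>Gaussian elimination, by induction on the number of coordinates. It works on arrays of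
  coefficients because the functions spanning a discrete space are arbitrary, and linear
  independence of these is not known.\<close>

lemma linear_dependence:
  fixes c :: "'i \<Rightarrow> nat \<Rightarrow> real"
  assumes "finite A" "card A = Suc N"
  shows "\<exists>a. (\<exists>i\<in>A. a i \<noteq> 0) \<and> (\<forall>j<N. (\<Sum>i\<in>A. a i * c i j) = 0)"
  using assms
proof (induction N arbitrary: A c)
  case 0
  then obtain i where "i \<in> A" by fastforce
  then show ?case by (intro exI[of _ "\<lambda>_. 1"]) auto
next
  case (Suc N)
  show ?case
  proof (cases "\<exists>p\<in>A. c p N \<noteq> 0")
    case True
    then obtain p where p: "p \<in> A" "c p N \<noteq> 0" by blast
    \<comment> \<open>The pivot \<open>c p N\<close> clears coordinate \<open>N\<close> from the
      remaining rows.\<close>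
    obtain a where a: "\<exists>i\<in>A - {p}. a i \<noteq> 0"
      "\<And>j. j < N \<Longrightarrow> (\<Sum>i\<in>A - {p}. a i * (c i j - c i N / c p N * c p j)) = 0"
      using Suc.IH[of "A - {p}" "\<lambda>i j. c i j - c i N / c p N * c p j"] Suc.prems p by auto
    \<comment> \<open>The entry at \<open>p\<close> is solved from the requirement that coordinate
      \<open>N\<close> of the combination vanish.\<close>
    define b where "b = a(p := - (\<Sum>i\<in>A - {p}. a i * c i N) / c p N)"
    have "(\<Sum>i\<in>A. b i * c i j) = (\<Sum>i\<in>A - {p}. a i * (c i j - c i N / c p N * c p j))" for j
    proof -
      have "(\<Sum>i\<in>A. b i * c i j) = b p * c p j + (\<Sum>i\<in>A - {p}. b i * c i j)"
        using Suc.prems p(1) by (simp add: sum.remove)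
      also have "(\<Sum>i\<in>A - {p}. b i * c i j) = (\<Sum>i\<in>A - {p}. a i * c i j)"
        by (intro sum.cong) (auto simp: b_def)
      also have "b p * c p j = - (\<Sum>i\<in>A - {p}. a i * (c i N / c p N * c p j))"
        by (simp add: b_def sum_distrib_left sum_divide_distrib mult_ac)
      finally show ?thesis by (simp add: right_diff_distrib sum_subtractf)
    qed
    moreover have "(\<Sum>i\<in>A - {p}. a i * (c i N - c i N / c p N * c p N)) = 0"
      using p(2) by simp
    ultimately have "\<forall>j<Suc N. (\<Sum>i\<in>A. b i * c i j) = 0" using a(2) by (simp add: less_Suc_eq)
    moreover have "\<exists>i\<in>A. b i \<noteq> 0" using a(1) by (auto simp: b_def)
    ultimately show ?thesis by blast
  next
    case False
    obtain p where p: "p \<in> A" using Suc.prems by fastforce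
    obtain a where a: "\<exists>i\<in>A - {p}. a i \<noteq> 0" "\<And>j. j < N \<Longrightarrow> (\<Sum>i\<in>A - {p}. a i * c i j) = 0"
      using Suc.IH[of "A - {p}" c] Suc.prems p by auto
    have "(\<Sum>i\<in>A. (a(p := 0)) i * c i j) = (\<Sum>i\<in>A - {p}. a i * c i j)" for j
      using Suc.prems p by (subst sum.remove) auto
    moreover have "(\<Sum>i\<in>A - {p}. a i * c i N) = 0" using False by simp
    ultimately have "\<forall>j<Suc N. (\<Sum>i\<in>A. (a(p := 0)) i * c i j) = 0"
      using a(2) by (simp add: less_Suc_eq del: fun_upd_apply)
    moreover have "\<exists>i\<in>A. (a(p := 0)) i \<noteq> 0" using a(1) by auto
    ultimately show ?thesis by blast
  qed
qed

text \<open>Basis expansions hold almost everywhere only, so inserting one into \<open>F\<close>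
  requires the second condition on top of linearity.\<close>

definition linear_form_on ::
    "(real ^ 'n) set \<Rightarrow> (real ^ 'n \<Rightarrow> 'b::real_vector) set \<Rightarrow> ((real ^ 'n \<Rightarrow> 'b) \<Rightarrow> real) \<Rightarrow> bool" where
  "linear_form_on U S F \<longleftrightarrow>
     (\<forall>v\<in>S. \<forall>w\<in>S. \<forall>a b. F (\<lambda>x. a *\<^sub>R v x + b *\<^sub>R w x) = a * F v + b * F w) \<and>
     (\<forall>v\<in>S. \<forall>w\<in>S. ae_eq U v w \<longrightarrow> F v = F w)"

lemma linear_form_onI:
  assumes "\<And>v w a b. v \<in> S \<Longrightarrow> w \<in> S \<Longrightarrow> F (\<lambda>x. a *\<^sub>R v x + b *\<^sub>R w x) = a * F v + b * F w"
    and "\<And>v w. v \<in> S \<Longrightarrow> w \<in> S \<Longrightarrow> ae_eq U v w \<Longrightarrow> F v = F w"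
  shows "linear_form_on U S F"
  using assms unfolding linear_form_on_def by blast

lemma linear_form_lincomb:
  "linear_form_on U S F \<Longrightarrow> v \<in> S \<Longrightarrow> w \<in> S \<Longrightarrow>
    F (\<lambda>x. a *\<^sub>R v x + b *\<^sub>R w x) = a * F v + b * F w"
  by (simp add: linear_form_on_def)

lemma linear_form_cong:
  "linear_form_on U S F \<Longrightarrow> v \<in> S \<Longrightarrow> w \<in> S \<Longrightarrow> ae_eq U v w \<Longrightarrow> F v = F w"
  unfolding linear_form_on_def by blast

lemma linear_form_scaleR:
  assumes "linear_form_on U S F" "v \<in> S"
  shows "F (\<lambda>x. a *\<^sub>R v x) = a * F v"
  using linear_form_lincomb[OF assms(1,2,2), of a 0] by simp

lemma fin_dim_subset: "fin_dim_subspace U S X \<Longrightarrow> v \<in> S \<Longrightarrow> v \<in> X"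
  by (auto simp: fin_dim_subspace_def)

lemma fin_dim_zero: "fin_dim_subspace U S X \<Longrightarrow> (\<lambda>x. 0) \<in> S"
  by (simp add: fin_dim_subspace_def)

lemma fin_dim_lincomb:
  "fin_dim_subspace U S X \<Longrightarrow> v \<in> S \<Longrightarrow> w \<in> S \<Longrightarrow> (\<lambda>x. a *\<^sub>R v x + b *\<^sub>R w x) \<in> S"
  by (simp add: fin_dim_subspace_def)

lemma fin_dim_diff:
  assumes "fin_dim_subspace U S X" "v \<in> S" "w \<in> S"
  shows "(\<lambda>x. v x - w x) \<in> S"
  using fin_dim_lincomb[OF assms, of 1 "-1"] by simp

lemma fin_dim_scaleR:
  assumes "fin_dim_subspace U S X" "v \<in> S"
  shows "(\<lambda>x. a *\<^sub>R v x) \<in> S"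
  using fin_dim_lincomb[OF assms(1,2,2), of a 0] by simp

lemma fin_dim_sum:
  assumes "fin_dim_subspace U S X" "finite A" "\<And>i. i \<in> A \<Longrightarrow> e i \<in> S"
  shows "(\<lambda>x. \<Sum>i\<in>A. c i *\<^sub>R e i x) \<in> S"
  using assms(2,3)
proof (induction A rule: finite_induct)
  case (insert i A)
  then show ?case
    using fin_dim_lincomb[OF assms(1), of "e i" "\<lambda>x. \<Sum>i\<in>A. c i *\<^sub>R e i x" "c i" 1] by simp
qed (simp add: fin_dim_zero[OF assms(1)])

lemma linear_form_sum:
  assumes "fin_dim_subspace U S X" "linear_form_on U S F" "finite A" "\<And>i. i \<in> A \<Longrightarrow> e i \<in> S"
  shows "F (\<lambda>x. \<Sum>i\<in>A. c i *\<^sub>R e i x) = (\<Sum>i\<in>A. c i * F (e i))"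
  using assms(3,4)
proof (induction A rule: finite_induct)
  case empty
  show ?case using linear_form_scaleR[OF assms(2) fin_dim_zero[OF assms(1)], of 0] by simp
next
  case (insert i A)
  have "(\<lambda>x. \<Sum>i\<in>A. c i *\<^sub>R e i x) \<in> S"
    by (rule fin_dim_sum[OF assms(1)]) (use insert in auto)
  then show ?case
    using insert linear_form_lincomb[OF assms(2), of "e i" "\<lambda>x. \<Sum>i\<in>A. c i *\<^sub>R e i x" "c i" 1] by simp
qed

locale bounded_domain = open_domain U for U :: "(real ^ 'n::finite) set" +
  assumes bounded_domain: "bounded U"
begin

abbreviation grad_inner ::
    "(real ^ 'n \<Rightarrow> 'b::euclidean_space) \<Rightarrow> (real ^ 'n \<Rightarrow> 'b) \<Rightarrow> real" where
  "grad_inner u v \<equiv> ip (grad U u) (grad U v)"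

abbreviation grad_norm :: "(real ^ 'n \<Rightarrow> 'b::euclidean_space) \<Rightarrow> real" where
  "grad_norm u \<equiv> nrm (grad U u)"

lemma grad_inner_Cauchy_Schwarz:
  "u \<in> H10 U \<Longrightarrow> v \<in> H10 U \<Longrightarrow> \<bar>grad_inner u v\<bar> \<le> grad_norm u * grad_norm v"
  by (intro L2_Cauchy_Schwarz grad_H10_L2)

lemma grad_inner_linear_form:
  fixes S :: "(real ^ 'n \<Rightarrow> 'b::euclidean_space) set"
  assumes "S \<subseteq> H10 U" "w \<in> H10 U"
  shows "linear_form_on U S (grad_inner w)" "linear_form_on U S (\<lambda>v. grad_inner v w)"
proof -
  show "linear_form_on U S (\<lambda>v. grad_inner v w)"
  proof (rule linear_form_onI)
    fix u v :: "real ^ 'n \<Rightarrow> 'b" and a b :: real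
    assume "u \<in> S" "v \<in> S"
    with assms show "grad_inner (\<lambda>x. a *\<^sub>R u x + b *\<^sub>R v x) w = a * grad_inner u w + b * grad_inner v w"
      by (intro L2_inner_grad_lincomb_left H10_Sobolev) auto
  next
    fix u v assume "u \<in> S" "v \<in> S" "ae_eq U u v"
    with assms show "grad_inner u w = grad_inner v w"
      using grad_cong[of u v] H10_L2[of u] H10_L2[of v] by (simp add: subset_iff)
  qed
  then show "linear_form_on U S (grad_inner w)"
    by (simp add: L2_inner_commute[of U "grad U w"])
qed

lemma grad_inner_diff_left:
  assumes "u \<in> H10 U" "v \<in> H10 U" "w \<in> H10 U"
  shows "grad_inner (\<lambda>x. u x - v x) w = grad_inner u w - grad_inner v w"
  using linear_form_lincomb[OF grad_inner_linear_form(2)[OF subset_refl assms(3)] assms(1,2), of 1 "-1"]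
  by simp

lemma grad_inner_diff_right:
  assumes "u \<in> H10 U" "v \<in> H10 U" "w \<in> H10 U"
  shows "grad_inner w (\<lambda>x. u x - v x) = grad_inner w u - grad_inner w v"
  using grad_inner_diff_left[OF assms] by (simp add: L2_inner_commute[of U "grad U w"])

text \<open>The nontrivial direction is the Poincare inequality. It turns \<open>grad_norm\<close>
  into a norm on classes, so that a denominator in the suprema vanishes for the zero class
  only.\<close>

lemma ae_eq_zero_iff_grad_norm:
  assumes "u \<in> H10 U"
  shows "ae_eq U u (\<lambda>x. 0) \<longleftrightarrow> grad_norm u = 0"
proof
  assume "ae_eq U u (\<lambda>x. 0)"
  then have "grad_inner u u = grad_inner (\<lambda>x. 0) u"
    using linear_form_cong[OF grad_inner_linear_form(2)[OF subset_refl assms] assms H10_zero] by simp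
  also have "\<dots> = 0"
    using linear_form_scaleR[OF grad_inner_linear_form(2)[OF subset_refl assms] assms, of 0] by simp
  finally show "grad_norm u = 0" by (simp add: L2_norm_def)
qed (rule grad_eq_0_imp_zero[OF bounded_domain assms])

definition orthonormal :: "nat \<Rightarrow> (nat \<Rightarrow> real ^ 'n \<Rightarrow> 'b::euclidean_space) \<Rightarrow> bool" where
  "orthonormal m e \<longleftrightarrow> (\<forall>i<m. \<forall>j<m. grad_inner (e i) (e j) = (if i = j then 1 else 0))"

lemma orthonormal_coefficient:
  assumes S: "fin_dim_subspace U S (H10 U)" and "\<And>i. i < m \<Longrightarrow> e i \<in> S" "orthonormal m e"
    and "A \<subseteq> {..<m}" "k \<in> A"
  shows "grad_inner (\<lambda>x. \<Sum>i\<in>A. a i *\<^sub>R e i x) (e k) = a k"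
proof -
  have sub: "S \<subseteq> H10 U" using fin_dim_subset[OF S] by blast
  have k: "k < m" "finite A" using assms(4,5) finite_subset by auto
  have "grad_inner (\<lambda>x. \<Sum>i\<in>A. a i *\<^sub>R e i x) (e k) = (\<Sum>i\<in>A. a i * grad_inner (e i) (e k))"
    by (rule linear_form_sum[OF S grad_inner_linear_form(2)[OF sub]])
      (use assms k sub in auto)
  also have "\<dots> = (\<Sum>i\<in>A. if i = k then a i else 0)"
    using assms(3,4) k(1) by (intro sum.cong) (auto simp: orthonormal_def)
  also have "\<dots> = a k" using k assms(5) by simp
  finally show ?thesis .
qed

text \<open>A longer family would have a nontrivial combination whose coefficients with respect to
  \<open>B\<close> all cancel. That combination is zero almost everywhere, and pairing it with each
  member shows that its coefficients are zero after all.\<close>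

lemma orthonormal_size_le:
  assumes S: "fin_dim_subspace U S (H10 U)" and e: "\<And>i. i < m \<Longrightarrow> e i \<in> S" "orthonormal m e"
    and B: "\<And>v. v \<in> S \<Longrightarrow> \<exists>c. ae_eq U v (\<lambda>x. \<Sum>j<N. c j *\<^sub>R B j x)"
  shows "m \<le> N"
proof (rule ccontr)
  assume "\<not> m \<le> N"
  then have sub: "{..N} \<subseteq> {..<m}" by auto
  have "\<forall>i. \<exists>c. i \<le> N \<longrightarrow> ae_eq U (e i) (\<lambda>x. \<Sum>j<N. c j *\<^sub>R B j x)"
    using B e(1) sub by blast
  then obtain c where c: "\<And>i. i \<le> N \<Longrightarrow> ae_eq U (e i) (\<lambda>x. \<Sum>j<N. c i j *\<^sub>R B j x)"
    by metis
  obtain a where a: "\<exists>i\<in>{..N}. a i \<noteq> 0" "\<And>j. j < N \<Longrightarrow> (\<Sum>i\<le>N. a i * c i j) = 0"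
    using linear_dependence[of "{..N}" N c] by auto
  let ?w = "\<lambda>x. \<Sum>i\<le>N. a i *\<^sub>R e i x"
  have w: "?w \<in> S" by (rule fin_dim_sum[OF S]) (use e(1) sub in auto)
  have "AE x in lebesgue_on U. \<forall>i\<in>{..N}. e i x = (\<Sum>j<N. c i j *\<^sub>R B j x)"
    using c unfolding ae_eq_def by (intro AE_finite_allI) auto
  then have "ae_eq U ?w (\<lambda>x. 0)"
    unfolding ae_eq_def
  proof eventually_elim
    case (elim x)
    have "?w x = (\<Sum>i\<le>N. \<Sum>j<N. (a i * c i j) *\<^sub>R B j x)"
      using elim by (simp add: scaleR_sum_right)
    also have "\<dots> = (\<Sum>j<N. (\<Sum>i\<le>N. a i * c i j) *\<^sub>R B j x)"
      by (subst sum.swap) (simp add: scaleR_sum_left)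
    also have "\<dots> = 0" using a(2) by simp
    finally show ?case .
  qed
  then have w0: "grad_norm ?w = 0"
    using ae_eq_zero_iff_grad_norm fin_dim_subset[OF S w] by blast
  have "a k = 0" if "k \<le> N" for k
  proof -
    have "e k \<in> H10 U" using e(1) sub that fin_dim_subset[OF S] by auto
    then have "\<bar>grad_inner ?w (e k)\<bar> \<le> 0"
      using grad_inner_Cauchy_Schwarz[OF fin_dim_subset[OF S w]] w0 by fastforce
    then show ?thesis using orthonormal_coefficient[OF S e sub, of k a] that by simp
  qed
  then show False using a(1) by auto
qed

text \<open>An orthonormal family of maximal length, which exists because
  \<open>orthonormal_size_le\<close> bounds the lengths. If an expansion left a residual of nonzero
  energy, the normalised residual could be appended.\<close>

proposition orthonormal_basis:
  assumes S: "fin_dim_subspace U S (H10 U)"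
  obtains m e where "\<And>i. i < m \<Longrightarrow> e i \<in> S" "orthonormal m e"
    "\<And>v. v \<in> S \<Longrightarrow> ae_eq U v (\<lambda>x. \<Sum>i<m. grad_inner v (e i) *\<^sub>R e i x)"
proof -
  define P where "P m \<longleftrightarrow> (\<exists>e. (\<forall>i<m. e i \<in> S) \<and> orthonormal m e)" for m
  obtain N B where B: "\<And>v. v \<in> S \<Longrightarrow> \<exists>c. ae_eq U v (\<lambda>x. \<Sum>j<(N::nat). c j *\<^sub>R B j x)"
    using S unfolding fin_dim_subspace_def by blast
  have bound: "\<forall>m. P m \<longrightarrow> m \<le> N"
    using orthonormal_size_le[OF S _ _ B] unfolding P_def by blast
  have "P 0" by (simp add: P_def orthonormal_def)
  define m where "m = (GREATEST m. P m)"
  have "P m" using GreatestI_nat[of P 0 N] \<open>P 0\<close> bound unfolding m_def by blast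
  then obtain e where e: "\<And>i. i < m \<Longrightarrow> e i \<in> S" "orthonormal m e" unfolding P_def by blast
  have not: "\<not> P (Suc m)"
    using Greatest_le_nat[of P "Suc m" N] bound unfolding m_def by auto
  have "ae_eq U v (\<lambda>x. \<Sum>i<m. grad_inner v (e i) *\<^sub>R e i x)" if v: "v \<in> S" for v
  proof -
    let ?p = "\<lambda>x. \<Sum>i<m. grad_inner v (e i) *\<^sub>R e i x"
    define r where "r = (\<lambda>x. v x - ?p x)"
    have p: "?p \<in> S" by (rule fin_dim_sum[OF S]) (use e(1) in auto)
    have r: "r \<in> S" unfolding r_def by (rule fin_dim_diff[OF S v p])
    note H10 = fin_dim_subset[OF S]
    have orth: "grad_inner r (e k) = 0" if "k < m" for k
      using orthonormal_coefficient[OF S e subset_refl, of k "\<lambda>i. grad_inner v (e i)"] that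
      unfolding r_def by (simp add: grad_inner_diff_left H10 v p e(1))
    have "grad_norm r = 0"
    proof (rule ccontr)
      assume nz: "grad_norm r \<noteq> 0"
      define e' where "e' = e(m := (\<lambda>x. (1 / grad_norm r) *\<^sub>R r x))"
      have sub: "S \<subseteq> H10 U" using H10 by blast
      have normal: "grad_inner (\<lambda>x. (1 / grad_norm r) *\<^sub>R r x) w = (1 / grad_norm r) * grad_inner r w"
        "grad_inner w (\<lambda>x. (1 / grad_norm r) *\<^sub>R r x) = (1 / grad_norm r) * grad_inner w r"
        if "w \<in> H10 U" for w
        using linear_form_scaleR[OF grad_inner_linear_form(1)[OF sub that] r]
          linear_form_scaleR[OF grad_inner_linear_form(2)[OF sub that] r] by auto
      have "(\<lambda>x. (1 / grad_norm r) *\<^sub>R r x) \<in> H10 U"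
        by (intro H10 fin_dim_scaleR[OF S r])
      from normal(1)[OF this]
      have "grad_inner (e' m) (e' m) = (1 / grad_norm r) * ((1 / grad_norm r) * grad_inner r r)"
        unfolding normal(2)[OF H10[OF r]] e'_def by simp
      also have "\<dots> = 1"
        using nz by (simp only: L2_norm_square[symmetric]) (simp add: power2_eq_square)
      finally have "grad_inner (e' m) (e' m) = 1" .
      moreover have "grad_inner (e' m) (e' i) = 0" "grad_inner (e' i) (e' m) = 0" if "i < m" for i
        using that normal[OF H10[OF e(1)[OF that]]] orth[OF that]
          L2_inner_commute[of U "grad U (e i)" "grad U r"]
        unfolding e'_def by auto
      moreover have "grad_inner (e' i) (e' j) = (if i = j then 1 else 0)" if "i < m" "j < m" for i j
        using that e(2) by (simp add: e'_def orthonormal_def)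
      ultimately have "orthonormal (Suc m) e'"
        unfolding orthonormal_def less_Suc_eq by auto
      moreover have "\<forall>i<Suc m. e' i \<in> S"
        using e(1) fin_dim_scaleR[OF S r] by (auto simp: e'_def less_Suc_eq)
      ultimately show False using not unfolding P_def by blast
    qed
    then have "ae_eq U r (\<lambda>x. 0)" using ae_eq_zero_iff_grad_norm H10[OF r] by blast
    then show ?thesis by (simp add: ae_eq_def r_def)
  qed
  with e that show thesis by blast
qed

lemma linear_form_expand:
  assumes S: "fin_dim_subspace U S (H10 U)" and F: "linear_form_on U S F"
    and e: "\<And>i. i < m \<Longrightarrow> e i \<in> S"
    and v: "v \<in> S" "ae_eq U v (\<lambda>x. \<Sum>i<(m::nat). c i *\<^sub>R e i x)"
  shows "F v = (\<Sum>i<m. c i * F (e i))"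
proof -
  have "(\<lambda>x. \<Sum>i<m. c i *\<^sub>R e i x) \<in> S"
    by (rule fin_dim_sum[OF S]) (use e in auto)
  then have "F v = F (\<lambda>x. \<Sum>i<m. c i *\<^sub>R e i x)" by (intro linear_form_cong[OF F] v)
  also have "\<dots> = (\<Sum>i<m. c i * F (e i))" by (rule linear_form_sum[OF S F]) (use e in auto)
  finally show ?thesis .
qed

text \<open>Expansion in a finite basis leaves finitely many values of \<open>F\<close> to control.
  The bound is what makes the sets of quotients behind \<open>dual_norm\<close> bounded
  above.\<close>

lemma linear_form_bounded:
  assumes S: "fin_dim_subspace U S (H10 U)" and F: "linear_form_on U S F"
  obtains K where "\<And>v. v \<in> S \<Longrightarrow> \<bar>F v\<bar> \<le> K * grad_norm v"
proof -
  obtain m e where e: "\<And>i. i < m \<Longrightarrow> e i \<in> S" "orthonormal m e"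
    "\<And>v. v \<in> S \<Longrightarrow> ae_eq U v (\<lambda>x. \<Sum>i<m. grad_inner v (e i) *\<^sub>R e i x)"
    using orthonormal_basis[OF S] by blast
  have "\<bar>F v\<bar> \<le> (\<Sum>i<m. grad_norm (e i) * \<bar>F (e i)\<bar>) * grad_norm v" if v: "v \<in> S" for v
  proof -
    have "\<bar>F v\<bar> = \<bar>\<Sum>i<m. grad_inner v (e i) * F (e i)\<bar>"
      using linear_form_expand[OF S F e(1) v e(3)[OF v]] by simp
    also have "\<dots> \<le> (\<Sum>i<m. \<bar>grad_inner v (e i) * F (e i)\<bar>)" by (rule sum_abs)
    also have "\<dots> \<le> (\<Sum>i<m. (grad_norm v * grad_norm (e i)) * \<bar>F (e i)\<bar>)"
      using v e(1) fin_dim_subset[OF S]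
      by (auto simp: abs_mult intro!: sum_mono mult_right_mono grad_inner_Cauchy_Schwarz)
    also have "\<dots> = (\<Sum>i<m. grad_norm (e i) * \<bar>F (e i)\<bar>) * grad_norm v"
      by (simp add: sum_distrib_left mult_ac)
    finally show ?thesis .
  qed
  then show thesis by (rule that)
qed

text \<open>The Fourier coefficients of \<open>w\<close> with respect to an energy-orthonormal basis
  of \<open>S\<close> define the projection, also for \<open>w\<close> outside
  \<open>S\<close>.\<close>

lemma energy_projection:
  assumes S: "fin_dim_subspace U S (H10 U)" and w: "w \<in> H10 U"
  obtains v where "v \<in> S" "\<And>\<phi>. \<phi> \<in> S \<Longrightarrow> grad_inner (\<lambda>x. w x - v x) \<phi> = 0"
proof -
  obtain m e where e: "\<And>i. i < m \<Longrightarrow> e i \<in> S" "orthonormal m e"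
    "\<And>v. v \<in> S \<Longrightarrow> ae_eq U v (\<lambda>x. \<Sum>i<m. grad_inner v (e i) *\<^sub>R e i x)"
    using orthonormal_basis[OF S] by blast
  note H10 = fin_dim_subset[OF S]
  define v where "v = (\<lambda>x. \<Sum>i<m. grad_inner w (e i) *\<^sub>R e i x)"
  have v: "v \<in> S" unfolding v_def by (rule fin_dim_sum[OF S]) (use e(1) in auto)
  have d: "(\<lambda>x. w x - v x) \<in> H10 U" by (intro H10_diff w H10 v)
  have orth: "grad_inner (\<lambda>x. w x - v x) (e i) = 0" if "i < m" for i
    using orthonormal_coefficient[OF S e(1,2) subset_refl, of i "\<lambda>i. grad_inner w (e i)"] that
    by (simp add: grad_inner_diff_left w H10 v e(1) flip: v_def)
  have "S \<subseteq> H10 U" using H10 by blast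
  then have "grad_inner (\<lambda>x. w x - v x) \<phi> = 0" if "\<phi> \<in> S" for \<phi>
    using linear_form_expand[OF S grad_inner_linear_form(1)[OF _ d] e(1) that e(3)[OF that]]
    by (simp add: orth)
  with v that show thesis by blast
qed

subsection \<open>The discretely divergence-free space\<close>

lemma discr_div_free_fin_dim:
  assumes V: "fin_dim_subspace U V (H10 U)" and Q: "Q \<subseteq> L2 U"
  shows "fin_dim_subspace U (discr_div_free U V Q) (H10 U)"
proof -
  let ?Z = "discr_div_free U V Q"
  note H10 = fin_dim_subset[OF V]
  have lincomb: "(\<lambda>x. a *\<^sub>R v x + b *\<^sub>R w x) \<in> ?Z" if "v \<in> ?Z" "w \<in> ?Z" for v w a b
  proof -
    have vw: "v \<in> V" "w \<in> V" using that by (auto simp: discr_div_free_def)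
    then have "ip (weak_div U (\<lambda>x. a *\<^sub>R v x + b *\<^sub>R w x)) q = 0" if "q \<in> Q" for q
      using L2_inner_weak_div_lincomb[OF H10_Sobolev[OF H10] H10_Sobolev[OF H10], of v w q a b]
        \<open>v \<in> ?Z\<close> \<open>w \<in> ?Z\<close> that Q by (auto simp: discr_div_free_def)
    then show ?thesis
      using fin_dim_lincomb[OF V vw, of a b] by (simp add: discr_div_free_def)
  qed
  have "(\<lambda>x. 0) \<in> ?Z"
    using fin_dim_zero[OF V] Q
      L2_inner_weak_div_lincomb[OF H10_Sobolev[OF H10_zero] H10_Sobolev[OF H10_zero], of _ 0 0]
    by (auto simp: discr_div_free_def)
  moreover obtain N B where "\<forall>v\<in>V. \<exists>c. ae_eq U v (\<lambda>x. \<Sum>i<(N::nat). c i *\<^sub>R B i x)"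
    using V unfolding fin_dim_subspace_def by blast
  then have "\<exists>N B. \<forall>v\<in>?Z. \<exists>c. ae_eq U v (\<lambda>x. \<Sum>i<(N::nat). c i *\<^sub>R B i x)"
    by (intro exI[of _ N] exI[of _ B]) (simp add: discr_div_free_def)
  moreover have "?Z \<subseteq> H10 U" using H10 by (auto simp: discr_div_free_def)
  ultimately show ?thesis
    using lincomb unfolding fin_dim_subspace_def by simp
qed

text \<open>The energy projection provides the witness without which nothing could be said about the
  function selected by \<open>SOME\<close>.\<close>

lemma stokes_projector:
  assumes V: "fin_dim_subspace U V (H10 U)" and Q: "Q \<subseteq> L2 U" and w: "w \<in> H10 U"
  shows "stokes_projector U V Q w \<in> discr_div_free U V Q"
    and "\<phi> \<in> discr_div_free U V Q \<Longrightarrow> grad_inner (\<lambda>x. w x - stokes_projector U V Q w x) \<phi> = 0"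
proof -
  obtain v where v: "v \<in> discr_div_free U V Q"
    "\<And>\<phi>. \<phi> \<in> discr_div_free U V Q \<Longrightarrow> grad_inner (\<lambda>x. w x - v x) \<phi> = 0"
    using energy_projection[OF discr_div_free_fin_dim[OF V Q] w] by blast
  have "stokes_projector U V Q w \<in> discr_div_free U V Q \<and>
      (\<forall>\<phi>\<in>discr_div_free U V Q. grad_inner (\<lambda>x. w x - stokes_projector U V Q w x) \<phi> = 0)"
    unfolding stokes_projector_def by (rule someI[of _ v]) (use v in blast)
  then show "stokes_projector U V Q w \<in> discr_div_free U V Q"
    "\<phi> \<in> discr_div_free U V Q \<Longrightarrow> grad_inner (\<lambda>x. w x - stokes_projector U V Q w x) \<phi> = 0"
    by auto
qed

text \<open>A real supremum bounds its set only if the set is bounded above, which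
  \<open>linear_form_bounded\<close> guarantees. The absolute value on the left is gained by
  applying the estimate to the negative of \<open>\<phi>\<close> too.\<close>

lemma dual_norm_bound:
  assumes V: "fin_dim_subspace U V (H10 U)" and Q: "Q \<subseteq> L2 U"
    and F: "linear_form_on U (discr_div_free U V Q) (\<lambda>\<phi>. ip g (T \<phi>))"
    and \<phi>: "\<phi> \<in> discr_div_free U V Q"
  shows "\<bar>ip g (T \<phi>)\<bar> \<le> dual_norm U V Q T g * grad_norm \<phi>"
proof -
  let ?Z = "discr_div_free U V Q"
  have Z: "fin_dim_subspace U ?Z (H10 U)" by (rule discr_div_free_fin_dim[OF V Q])
  note H10 = fin_dim_subset[OF Z]
  obtain K where K: "\<And>v. v \<in> ?Z \<Longrightarrow> \<bar>ip g (T v)\<bar> \<le> K * grad_norm v"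
    using linear_form_bounded[OF Z F] by blast
  have bdd: "bdd_above (insert 0 {ip g (T \<phi>) / grad_norm \<phi> | \<phi>. \<phi> \<in> ?Z \<and> \<not> ae_eq U \<phi> (\<lambda>x. 0)})"
  proof (rule bdd_aboveI[of _ "max 0 K"])
    fix t assume "t \<in> insert 0 {ip g (T \<phi>) / grad_norm \<phi> | \<phi>. \<phi> \<in> ?Z \<and> \<not> ae_eq U \<phi> (\<lambda>x. 0)}"
    then consider "t = 0" | v where "v \<in> ?Z" "\<not> ae_eq U v (\<lambda>x. 0)" "t = ip g (T v) / grad_norm v"
      by blast
    then show "t \<le> max 0 K"
    proof cases
      case 2
      then have "grad_norm v > 0"
        using ae_eq_zero_iff_grad_norm[OF H10[OF 2(1)]] L2_norm_nonneg[of U "grad U v"] by simp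
      then have "t \<le> K" using K[OF 2(1)] by (simp add: 2(3) pos_divide_le_eq)
      then show ?thesis by simp
    qed simp
  qed
  have le: "ip g (T v) \<le> dual_norm U V Q T g * grad_norm v" if v: "v \<in> ?Z" for v
  proof (cases "grad_norm v = 0")
    case True
    \<comment> \<open>Functions of zero energy do not enter the supremum; the form vanishes on them
      by the bound with \<open>K\<close>.\<close>
    then show ?thesis using K[OF v] by simp
  next
    case False
    then have pos: "grad_norm v > 0" using L2_norm_nonneg[of U "grad U v"] by simp
    have "ip g (T v) / grad_norm v \<le> dual_norm U V Q T g"
      unfolding dual_norm_def
      by (rule cSup_upper[OF _ bdd]) (use v False ae_eq_zero_iff_grad_norm[OF H10[OF v]] in blast)
    then show ?thesis using pos by (simp add: pos_divide_le_eq)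
  qed
  have m: "(\<lambda>x. (- 1) *\<^sub>R \<phi> x) \<in> ?Z" by (rule fin_dim_scaleR[OF Z \<phi>])
  have "grad_norm (\<lambda>x. (- 1) *\<^sub>R \<phi> x) = grad_norm \<phi>"
  proof (rule power2_eq_imp_eq)
    have sub: "?Z \<subseteq> H10 U" using H10 by blast
    show "(grad_norm (\<lambda>x. (- 1) *\<^sub>R \<phi> x))\<^sup>2 = (grad_norm \<phi>)\<^sup>2"
      using linear_form_scaleR[OF grad_inner_linear_form(1)[OF sub H10[OF \<phi>]] \<phi>, of "-1"]
        linear_form_scaleR[OF grad_inner_linear_form(2)[OF sub H10[OF m]] \<phi>, of "-1"]
      by (simp add: L2_norm_square)
  qed (simp_all add: L2_norm_nonneg)
  then show ?thesis
    using le[OF \<phi>] le[OF m] linear_form_scaleR[OF F \<phi>, of "-1"] by simp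
qed

text \<open>Nonnegativity of \<open>C\<close> accounts for the adjoined 0 and for quotients with
  denominator 0, whose value is 0 by convention.\<close>

lemma dual_norm_le:
  assumes "0 \<le> C"
    and "\<And>\<phi>. \<phi> \<in> discr_div_free U V Q \<Longrightarrow> ip g (T \<phi>) \<le> C * grad_norm \<phi>"
  shows "dual_norm U V Q T g \<le> C"
  unfolding dual_norm_def
proof (rule cSup_least)
  fix t assume "t \<in> insert 0 {ip g (T \<phi>) / grad_norm \<phi> | \<phi>.
    \<phi> \<in> discr_div_free U V Q \<and> \<not> ae_eq U \<phi> (\<lambda>x. 0)}"
  then consider "t = 0" | v where "v \<in> discr_div_free U V Q" "t = ip g (T v) / grad_norm v"
    by blast
  then show "t \<le> C"
  proof cases
    case 2
    show ?thesis
    proof (cases "grad_norm v = 0")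
      case False
      then have "grad_norm v > 0" using L2_norm_nonneg[of U "grad U v"] by simp
      then show ?thesis using assms(2)[OF 2(1)] by (simp add: 2(2) pos_divide_le_eq)
    qed (simp add: 2 assms(1))
  qed (use assms(1) in simp)
qed simp

end

text \<open>Approximation properties are stated as infima, while error estimates arise for one
  competitor at a time; this connects the two without a minimiser.\<close>

lemma mult_INF_bound:
  fixes f :: "'a \<Rightarrow> real"
  assumes "S \<noteq> {}" "0 \<le> A" "\<And>s. s \<in> S \<Longrightarrow> X \<le> A * f s"
  shows "X \<le> A * (INF s\<in>S. f s)"
proof (cases "A = 0")
  case True
  then show ?thesis using assms by force
next
  case False
  then have "A > 0" using assms(2) by simp
  have "X / A \<le> (INF s\<in>S. f s)"
    by (rule cINF_greatest[OF assms(1)]) (use assms(3) \<open>A > 0\<close> in \<open>simp add: pos_divide_le_eq mult.commute\<close>)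
  then show ?thesis using \<open>A > 0\<close> by (simp add: pos_divide_le_eq mult.commute)
qed

section \<open>Quasi-optimality of the Stokes projector from inf-sup stability\<close>

context bounded_domain
begin

lemma grad_norm_triangle:
  assumes "u \<in> H10 U" "v \<in> H10 U"
  shows "grad_norm (\<lambda>x. u x + v x) \<le> grad_norm u + grad_norm v"
  using grad_norm_lincomb_le[OF H10_Sobolev[OF assms(1)] H10_Sobolev[OF assms(2)], of 1 1] by simp

lemma L2_inner_weak_div_bound:
  fixes v :: "'n vfield"
  assumes "v \<in> H10 U" "q \<in> L2 U"
  shows "\<bar>ip (weak_div U v) q\<bar> \<le> real CARD('n) * grad_norm v * nrm q"
proof -
  note v = H10_Sobolev[OF assms(1)]
  have "\<bar>ip (weak_div U v) q\<bar> \<le> nrm (weak_div U v) * nrm q"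
    by (intro L2_Cauchy_Schwarz weak_div_eq_trace(1) v assms)
  also have "\<dots> \<le> real CARD('n) * grad_norm v * nrm q"
    by (intro mult_right_mono weak_div_norm_le_grad v L2_norm_nonneg)
  finally show ?thesis .
qed

lemma weak_div_linear_form:
  fixes S :: "('n vfield) set"
  assumes "S \<subseteq> H10 U" "q \<in> L2 U"
  shows "linear_form_on U S (\<lambda>v. ip (weak_div U v) q)"
proof (rule linear_form_onI)
  fix v w :: "'n vfield" and a b
  assume vw: "v \<in> S" "w \<in> S"
  then have H: "v \<in> H10 U" "w \<in> H10 U" using assms(1) by auto
  show "ip (weak_div U (\<lambda>x. a *\<^sub>R v x + b *\<^sub>R w x)) q =
      a * ip (weak_div U v) q + b * ip (weak_div U w) q"
    by (intro L2_inner_weak_div_lincomb H10_Sobolev H assms(2))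
  assume "ae_eq U v w"
  then show "ip (weak_div U v) q = ip (weak_div U w) q"
    using weak_div_cong[OF H10_L2[OF H(1)] H10_L2[OF H(2)]] by simp
qed

lemma L2_inner_weak_div_diff:
  fixes v w :: "'n vfield"
  assumes "v \<in> H10 U" "w \<in> H10 U" "q \<in> L2 U"
  shows "ip (weak_div U (\<lambda>x. v x - w x)) q =
    ip (weak_div U v) q - ip (weak_div U w) q"
  using linear_form_lincomb[OF weak_div_linear_form[OF subset_refl assms(3)] assms(1,2), of 1 "-1"] by simp

text \<open>
  The residual of the projection of \<open>r\<close> onto the Riesz representatives of the forms \<open>(div \<cdot>, q)\<close>
  is discretely divergence-free, hence orthogonal to itself.
\<close>

lemma discr_div_free_representation:
  fixes V :: "('n vfield) set"
  assumes V: "fin_dim_subspace U V (H10 U)" and Q: "fin_dim_subspace U Q (L2_mean_zero U)"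
    and r: "r \<in> V" "\<And>\<phi>. \<phi> \<in> discr_div_free U V Q \<Longrightarrow> grad_inner r \<phi> = 0"
  obtains q where "q \<in> Q" "\<And>\<phi>. \<phi> \<in> V \<Longrightarrow> grad_inner r \<phi> = ip (weak_div U \<phi>) q"
proof -
  note H10 = fin_dim_subset[OF V]
  have QL2: "q \<in> L2 U" if "q \<in> Q" for q
    using fin_dim_subset[OF Q that] by (simp add: L2_mean_zero_def)
  have sub: "V \<subseteq> H10 U" using H10 by blast
  obtain m e where e: "\<And>i. i < m \<Longrightarrow> e i \<in> V" "orthonormal m e"
    "\<And>v. v \<in> V \<Longrightarrow> ae_eq U v (\<lambda>x. \<Sum>i<m. grad_inner v (e i) *\<^sub>R e i x)"
    using orthonormal_basis[OF V] by blast
  \<comment> \<open>Writing the representative through its basis coefficients makes its linearity in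
    \<open>q\<close> visible.\<close>
  define R where "R q = (\<lambda>x. \<Sum>i<m. ip (weak_div U (e i)) q *\<^sub>R e i x)" for q
  have RV: "R q \<in> V" for q
    unfolding R_def by (rule fin_dim_sum[OF V]) (use e(1) in auto)
  have Riesz: "grad_inner (R q) \<phi> = ip (weak_div U \<phi>) q" if "q \<in> Q" "\<phi> \<in> V" for q \<phi>
  proof -
    have "grad_inner (R q) \<phi> = (\<Sum>i<m. ip (weak_div U (e i)) q * grad_inner (e i) \<phi>)"
      unfolding R_def
      by (rule linear_form_sum[OF V grad_inner_linear_form(2)[OF sub H10[OF that(2)]]]) (use e(1) in auto)
    also have "\<dots> = (\<Sum>i<m. grad_inner \<phi> (e i) * ip (weak_div U (e i)) q)"
      by (simp add: mult.commute L2_inner_commute[of U "grad U \<phi>"])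
    also have "\<dots> = ip (weak_div U \<phi>) q"
      using linear_form_expand[OF V weak_div_linear_form[OF sub QL2[OF that(1)]] e(1) that(2) e(3)[OF that(2)]]
      by simp
    finally show ?thesis .
  qed
  have R_lincomb: "(\<lambda>x. a *\<^sub>R R q x + b *\<^sub>R R q' x) = R (\<lambda>x. a *\<^sub>R q x + b *\<^sub>R q' x)"
    if "q \<in> Q" "q' \<in> Q" for q q' a b
  proof -
    have "ip (weak_div U (e i)) (\<lambda>x. a *\<^sub>R q x + b *\<^sub>R q' x) =
        a * ip (weak_div U (e i)) q + b * ip (weak_div U (e i)) q'" if "i < m" for i
      by (intro L2_inner_lincomb_right QL2 \<open>q \<in> Q\<close> \<open>q' \<in> Q\<close> weak_div_eq_trace(1) H10_Sobolev H10 e(1) that)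
    then show ?thesis
      unfolding R_def by (simp add: scaleR_sum_right scaleR_add_left sum.distrib)
  qed
  \<comment> \<open>The basis \<open>e\<close> of \<open>V\<close> spans the range, so finite
    dimension follows without a basis of \<open>Q\<close>.\<close>
  have Y: "fin_dim_subspace U (R ` Q) (H10 U)"
  proof -
    have "\<forall>v\<in>R ` Q. \<forall>w\<in>R ` Q. \<forall>a b. (\<lambda>x. a *\<^sub>R v x + b *\<^sub>R w x) \<in> R ` Q"
      using R_lincomb fin_dim_lincomb[OF Q] by auto
    moreover have "(\<lambda>x. 0) \<in> R ` Q"
      using fin_dim_zero[OF Q] by (force simp: R_def)
    moreover have "R ` Q \<subseteq> H10 U" using RV H10 by blast
    moreover have "\<exists>N B. \<forall>v\<in>R ` Q. \<exists>c. ae_eq U v (\<lambda>x. \<Sum>i<(N::nat). c i *\<^sub>R B i x)"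
      by (intro exI[of _ m] exI[of _ e]) (auto simp: R_def intro: ae_eq_refl)
    ultimately show ?thesis unfolding fin_dim_subspace_def by blast
  qed
  obtain y where y: "y \<in> R ` Q" "\<And>\<phi>. \<phi> \<in> R ` Q \<Longrightarrow> grad_inner (\<lambda>x. r x - y x) \<phi> = 0"
    using energy_projection[OF Y H10[OF r(1)]] by blast
  then obtain q where q: "q \<in> Q" "y = R q" by blast
  have yV: "y \<in> V" using RV q by simp
  define t where "t = (\<lambda>x. r x - y x)"
  have tV: "t \<in> V" unfolding t_def by (rule fin_dim_diff[OF V r(1) yV])
  have "ip (weak_div U t) q' = 0" if "q' \<in> Q" for q'
    using Riesz[OF that tV] y(2)[of "R q'"] that
    by (simp add: L2_inner_commute[of U "grad U (R q')"] flip: t_def)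
  then have tZ: "t \<in> discr_div_free U V Q" using tV by (simp add: discr_div_free_def)
  have "grad_inner y t = 0"
    using Riesz[OF q(1) tV] tZ q by (simp add: discr_div_free_def)
  then have "grad_inner t t = 0"
    using r(2)[OF tZ] grad_inner_diff_left[OF H10[OF r(1)] H10[OF yV] H10[OF tV]]
    by (simp flip: t_def)
  then have t0: "grad_norm t = 0" by (simp add: L2_norm_def)
  have "grad_inner r \<phi> = ip (weak_div U \<phi>) q" if "\<phi> \<in> V" for \<phi>
  proof -
    have "grad_inner t \<phi> = 0"
      using grad_inner_Cauchy_Schwarz[OF H10[OF tV] H10[OF that]] t0 by simp
    then show ?thesis
      using grad_inner_diff_left[OF H10[OF r(1)] H10[OF yV] H10[OF that]] Riesz[OF q(1) that]
      by (simp add: t_def q(2))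
  qed
  with q(1) that show thesis by blast
qed

text \<open>Cea's argument: the error is energy-orthogonal to the projection and to every
  competitor, so one may replace the other in the second slot of the inner product.\<close>

lemma stokes_projector_best:
  fixes V :: "('n vfield) set"
  assumes V: "fin_dim_subspace U V (H10 U)" and Q: "Q \<subseteq> L2 U" and w: "w \<in> H10 U"
    and s: "s \<in> discr_div_free U V Q"
  shows "grad_norm (\<lambda>x. w x - stokes_projector U V Q w x) \<le> grad_norm (\<lambda>x. w x - s x)"
proof -
  let ?S = "stokes_projector U V Q w"
  have Z: "fin_dim_subspace U (discr_div_free U V Q) (H10 U)" by (rule discr_div_free_fin_dim[OF V Q])
  note H10 = fin_dim_subset[OF Z]
  note S = stokes_projector[OF V Q w]
  let ?d = "\<lambda>x. w x - ?S x"
  have d: "?d \<in> H10 U" by (intro H10_diff w H10 S(1))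
  have ws: "(\<lambda>x. w x - s x) \<in> H10 U" by (intro H10_diff w H10 s)
  have "grad_inner ?d ?S = 0" "grad_inner ?d s = 0" using S s by auto
  then have "grad_inner ?d ?d = grad_inner ?d (\<lambda>x. w x - s x)"
    using grad_inner_diff_right[OF w H10[OF S(1)] d] grad_inner_diff_right[OF w H10[OF s] d] by simp
  then have "grad_norm ?d * grad_norm ?d \<le> grad_norm (\<lambda>x. w x - s x) * grad_norm ?d"
    using grad_inner_Cauchy_Schwarz[OF d ws]
    by (simp add: mult.commute flip: L2_norm_square power2_eq_square)
  then show ?thesis by (rule le_if_mult_self_le) (rule L2_norm_nonneg)
qed

text \<open>A competitor \<open>v\<close> from the full space is replaced by its own projection
  \<open>s\<close>. The correction \<open>r = v - s\<close> is energy-orthogonal to the discretely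
  divergence-free functions, hence represented by a discrete pressure \<open>q\<close>, which
  inf-sup stability bounds by \<open>r\<close>. As \<open>w\<close> is divergence-free,
  \<open>r\<close> is controlled by the divergence of \<open>w - v\<close>; this contributes
  \<open>CARD('n) / \<beta>\<close> to the constant.\<close>

proposition stokes_projector_quasi_optimal:
  fixes V :: "('n vfield) set"
  assumes V: "fin_dim_subspace U V (H10 U)" and Q: "fin_dim_subspace U Q (L2_mean_zero U)"
    and \<beta>: "0 < \<beta>" "\<And>q. q \<in> Q \<Longrightarrow> \<not> ae_eq U q (\<lambda>x. 0) \<Longrightarrow>
      \<beta> \<le> Sup (insert 0 {ip (weak_div U v) q / (grad_norm v * nrm q) | v.
                          v \<in> V \<and> \<not> ae_eq U v (\<lambda>x. 0)})"
    and w: "w \<in> H10 U" "\<And>q. q \<in> L2_mean_zero U \<Longrightarrow> ip (weak_div U w) q = 0"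
    and v: "v \<in> V"
  shows "grad_norm (\<lambda>x. w x - stokes_projector U V Q w x) \<le>
    (1 + real CARD('n) / \<beta>) * grad_norm (\<lambda>x. w x - v x)"
proof -
  note H10 = fin_dim_subset[OF V]
  have QL2: "Q \<subseteq> L2 U" using fin_dim_subset[OF Q] by (auto simp: L2_mean_zero_def)
  define s where "s = stokes_projector U V Q v"
  define r where "r = (\<lambda>x. v x - s x)"
  note S = stokes_projector[OF V QL2 H10[OF v], folded s_def, folded r_def]
  have sV: "s \<in> V" using S(1) by (simp add: discr_div_free_def)
  have rV: "r \<in> V" unfolding r_def by (rule fin_dim_diff[OF V v sV])
  have wv: "(\<lambda>x. w x - v x) \<in> H10 U" by (intro H10_diff w H10 v)
  obtain q where q: "q \<in> Q" "\<And>\<phi>. \<phi> \<in> V \<Longrightarrow> grad_inner r \<phi> = ip (weak_div U \<phi>) q"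
    using discr_div_free_representation[OF V Q rV S(2)] by blast
  have q2: "q \<in> L2 U" "q \<in> L2_mean_zero U"
    using q(1) QL2 fin_dim_subset[OF Q] by auto
  \<comment> \<open>By the representation of \<open>r\<close>, no quotient in the inf-sup supremum
    for \<open>q\<close> exceeds \<open>grad_norm r / nrm q\<close>.\<close>
  have \<beta>q: "\<beta> * nrm q \<le> grad_norm r"
  proof (cases "ae_eq U q (\<lambda>x. 0)")
    case True
    then have "nrm q = 0" using L2_norm_eq_0_iff[OF q2(1)] by simp
    then show ?thesis by (simp add: L2_norm_nonneg)
  next
    case False
    then have pos: "nrm q > 0"
      using L2_norm_eq_0_iff[OF q2(1)] L2_norm_nonneg[of U q] by simp
    have "\<beta> \<le> grad_norm r / nrm q"
    proof (rule order_trans[OF \<beta>(2)[OF q(1) False]], rule cSup_least)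
      fix t
      assume "t \<in> insert 0 {ip (weak_div U v) q / (grad_norm v * nrm q) | v.
                          v \<in> V \<and> \<not> ae_eq U v (\<lambda>x. 0)}"
      then consider "t = 0" | v where "v \<in> V" "\<not> ae_eq U v (\<lambda>x. 0)"
        "t = ip (weak_div U v) q / (grad_norm v * nrm q)" by blast
      then show "t \<le> grad_norm r / nrm q"
      proof cases
        case 1
        then show ?thesis using pos by (simp add: L2_norm_nonneg)
      next
        case (2 v)
        then have "grad_norm v > 0"
          using ae_eq_zero_iff_grad_norm[OF H10[OF 2(1)]] L2_norm_nonneg[of U "grad U v"] by simp
        moreover have "ip (weak_div U v) q \<le> grad_norm r * grad_norm v"
          using q(2)[OF 2(1)] grad_inner_Cauchy_Schwarz[OF H10[OF rV] H10[OF 2(1)]] by simp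
        ultimately have "ip (weak_div U v) q / grad_norm v \<le> grad_norm r"
          by (simp add: pos_divide_le_eq)
        then have "ip (weak_div U v) q / grad_norm v / nrm q \<le> grad_norm r / nrm q"
          using pos by (intro divide_right_mono) auto
        then show ?thesis by (simp add: 2(3))
      qed
    qed simp
    then show ?thesis using pos by (simp add: pos_le_divide_eq)
  qed
  \<comment> \<open>The representation is tested with \<open>r\<close> itself: \<open>s\<close>
    drops out as discretely divergence-free, and \<open>w\<close> may be inserted because its
    divergence vanishes against \<open>q\<close>.\<close>
  have "ip (weak_div U r) q = ip (weak_div U v) q"
    using S(1) q(1) L2_inner_weak_div_diff[OF H10[OF v] H10[OF sV] q2(1)]
    by (simp add: r_def discr_div_free_def)
  also have "\<dots> = - ip (weak_div U (\<lambda>x. w x - v x)) q"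
    using w(2)[OF q2(2)] L2_inner_weak_div_diff[OF w(1) H10[OF v] q2(1)] by simp
  finally have "grad_inner r r = - ip (weak_div U (\<lambda>x. w x - v x)) q"
    using q(2)[OF rV] by simp
  then have "(grad_norm r)\<^sup>2 \<le> real CARD('n) * grad_norm (\<lambda>x. w x - v x) * nrm q"
    using L2_inner_weak_div_bound[OF wv q2(1)] unfolding L2_norm_square by linarith
  then have "\<beta> * (grad_norm r)\<^sup>2 \<le> \<beta> * (real CARD('n) * grad_norm (\<lambda>x. w x - v x) * nrm q)"
    using \<beta>(1) by (intro mult_left_mono) auto
  also have "\<dots> = (real CARD('n) * grad_norm (\<lambda>x. w x - v x)) * (\<beta> * nrm q)" by simp
  also have "\<dots> \<le> (real CARD('n) * grad_norm (\<lambda>x. w x - v x)) * grad_norm r"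
    by (intro mult_left_mono \<beta>q mult_nonneg_nonneg) (auto simp: L2_norm_nonneg)
  finally have "grad_norm r * grad_norm r \<le> (real CARD('n) / \<beta> * grad_norm (\<lambda>x. w x - v x)) * grad_norm r"
    using \<beta>(1) by (simp add: power2_eq_square pos_le_divide_eq mult_ac)
  then have r: "grad_norm r \<le> real CARD('n) / \<beta> * grad_norm (\<lambda>x. w x - v x)"
    by (rule le_if_mult_self_le) (use \<beta>(1) in \<open>simp add: L2_norm_nonneg\<close>)
  have "grad_norm (\<lambda>x. w x - stokes_projector U V Q w x) \<le> grad_norm (\<lambda>x. w x - s x)"
    by (rule stokes_projector_best[OF V QL2 w(1) S(1)])
  also have "\<dots> \<le> grad_norm (\<lambda>x. w x - v x) + grad_norm r"
    using grad_norm_triangle[OF wv H10[OF rV]] by (simp add: r_def)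
  also have "\<dots> \<le> (1 + real CARD('n) / \<beta>) * grad_norm (\<lambda>x. w x - v x)"
    using r by (simp add: distrib_right)
  finally show ?thesis .
qed

end

subsection \<open>Error of the Stokes projector\<close>

locale discretization = bounded_domain U for U :: "(real ^ 'n::finite) set" +
  fixes I :: "real set"
    and Vh :: "real \<Rightarrow> ('n vfield) set"
    and Qh :: "real \<Rightarrow> (real ^ 'n \<Rightarrow> real) set"
  assumes mesh_pos: "h \<in> I \<Longrightarrow> 0 < h"
    and bounded_mesh: "bounded I"
    and Vh: "h \<in> I \<Longrightarrow> fin_dim_subspace U (Vh h) (H10 U)"
    and Qh: "h \<in> I \<Longrightarrow> fin_dim_subspace U (Qh h) (L2_mean_zero U)"
    and inf_sup: "inf_sup_stable U I Vh Qh"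
begin

abbreviation S :: "real \<Rightarrow> ('n vfield) \<Rightarrow> 'n vfield" where
  "S h \<equiv> stokes_projector U (Vh h) (Qh h)"

abbreviation Z :: "real \<Rightarrow> ('n vfield) set" where
  "Z h \<equiv> discr_div_free U (Vh h) (Qh h)"

abbreviation dual where "dual h \<equiv> dual_norm U (Vh h) (Qh h)"

definition div_free :: "('n vfield) \<Rightarrow> bool" where
  "div_free w \<longleftrightarrow> (\<forall>\<psi>\<in>L2_mean_zero U. ip (weak_div U w) \<psi> = 0)"

lemma Vh_H10: "h \<in> I \<Longrightarrow> v \<in> Vh h \<Longrightarrow> v \<in> H10 U"
  using fin_dim_subset[OF Vh] .

lemma Qh_L2: "h \<in> I \<Longrightarrow> Qh h \<subseteq> L2 U"
  using fin_dim_subset[OF Qh] by (auto simp: L2_mean_zero_def)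

lemma Z_fin_dim: "h \<in> I \<Longrightarrow> fin_dim_subspace U (Z h) (H10 U)"
  by (intro discr_div_free_fin_dim Vh Qh_L2)

lemma Z_Vh: "\<phi> \<in> Z h \<Longrightarrow> \<phi> \<in> Vh h"
  by (simp add: discr_div_free_def)

lemma Z_H10: "h \<in> I \<Longrightarrow> v \<in> Z h \<Longrightarrow> v \<in> H10 U"
  using fin_dim_subset[OF Z_fin_dim] .

lemma S_Z: "h \<in> I \<Longrightarrow> w \<in> H10 U \<Longrightarrow> S h w \<in> Z h"
  by (intro stokes_projector(1) Vh Qh_L2)

lemma S_orthogonal:
  "h \<in> I \<Longrightarrow> w \<in> H10 U \<Longrightarrow> \<phi> \<in> Z h \<Longrightarrow> grad_inner (\<lambda>x. w x - S h w x) \<phi> = 0"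
  by (intro stokes_projector(2) Vh Qh_L2)

lemma S_error_H10:
  assumes "h \<in> I" "w \<in> H10 U"
  shows "(\<lambda>x. w x - S h w x) \<in> H10 U"
  by (rule H10_diff[OF assms(2) Z_H10[OF assms(1) S_Z[OF assms]]])

lemma energy_error:
  assumes "approximation_order U I Vh Qh k"
  obtains C where "0 \<le> C"
    "\<And>h s w. h \<in> I \<Longrightarrow> s \<in> {1..k} \<Longrightarrow> w \<in> H10 U \<Longrightarrow> w \<in> Sobolev (s + 1) U \<Longrightarrow> div_free w \<Longrightarrow>
      grad_norm (\<lambda>x. w x - S h w x) \<le> C * h ^ s * Sobolev_norm (s + 1) U w"
proof -
  obtain C where C: "\<And>h s w. h \<in> I \<Longrightarrow> s \<in> {1..k} \<Longrightarrow> w \<in> H10 U \<inter> Sobolev (s + 1) U \<Longrightarrow>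
      (INF \<phi>\<in>Vh h. grad_norm (\<lambda>x. w x - \<phi> x)) \<le> C * h ^ s * Sobolev_norm (s + 1) U w"
    using assms unfolding approximation_order_def by blast
  obtain \<beta> where \<beta>: "0 < \<beta>" "\<And>h q. h \<in> I \<Longrightarrow> q \<in> Qh h \<Longrightarrow> \<not> ae_eq U q (\<lambda>x. 0) \<Longrightarrow>
      \<beta> \<le> Sup (insert 0 {ip (weak_div U v) q / (grad_norm v * nrm q) | v.
                          v \<in> Vh h \<and> \<not> ae_eq U v (\<lambda>x. 0)})"
    using inf_sup unfolding inf_sup_stable_def by blast
  let ?K = "1 + real CARD('n) / \<beta>"
  have K: "0 \<le> ?K" using \<beta>(1) by simp
  have "grad_norm (\<lambda>x. w x - S h w x) \<le> (?K * max 0 C) * h ^ s * Sobolev_norm (s + 1) U w"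
    if h: "h \<in> I" and s: "s \<in> {1..k}" and w: "w \<in> H10 U" "w \<in> Sobolev (s + 1) U" "div_free w" for h s w
  proof -
    have "grad_norm (\<lambda>x. w x - S h w x) \<le> ?K * (INF \<phi>\<in>Vh h. grad_norm (\<lambda>x. w x - \<phi> x))"
    proof (rule mult_INF_bound[OF _ K])
      show "Vh h \<noteq> {}" using fin_dim_zero[OF Vh[OF h]] by blast
      show "grad_norm (\<lambda>x. w x - S h w x) \<le> ?K * grad_norm (\<lambda>x. w x - \<phi> x)" if "\<phi> \<in> Vh h" for \<phi>
        by (rule stokes_projector_quasi_optimal[OF Vh[OF h] Qh[OF h] \<beta>(1) \<beta>(2)[OF h] w(1) _ that])
          (use w(3) in \<open>auto simp: div_free_def\<close>)
    qed
    also have "\<dots> \<le> ?K * (C * h ^ s * Sobolev_norm (s + 1) U w)"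
      by (intro mult_left_mono K C h s) (use w in auto)
    \<comment> \<open>The sign of the constant in \<open>approximation_order\<close> is unknown; a
      nonnegative one is needed for the monotonicity steps built on this bound.\<close>
    also have "\<dots> \<le> ?K * (max 0 C * h ^ s * Sobolev_norm (s + 1) U w)"
      using mesh_pos[OF h] by (intro mult_left_mono mult_right_mono K Sobolev_norm_nonneg) auto
    finally show ?thesis by (simp add: mult.assoc)
  qed
  then show thesis using that[of "?K * max 0 C"] K by simp
qed

text \<open>The bound is relative to the energy error, so duality contributes just the factor
  \<open>h\<close>, whatever the smoothness of \<open>w\<close>. The pressure of the dual problem
  survives because the error is only discretely divergence-free; it is diminished by elements of
  \<open>Qh h\<close>.\<close>

lemma L2_error:
  assumes approx: "approximation_order U I Vh Qh k" and k: "1 \<le> k" and reg: "stokes_H2_regular U"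
  obtains C where "0 \<le> C"
    "\<And>h w. h \<in> I \<Longrightarrow> w \<in> H10 U \<Longrightarrow> div_free w \<Longrightarrow>
      nrm (\<lambda>x. w x - S h w x) \<le> C * h * grad_norm (\<lambda>x. w x - S h w x)"
proof -
  obtain C1 where C1: "0 \<le> C1" "\<And>h s w. h \<in> I \<Longrightarrow> s \<in> {1..k} \<Longrightarrow> w \<in> H10 U \<Longrightarrow> w \<in> Sobolev (s + 1) U \<Longrightarrow>
      div_free w \<Longrightarrow> grad_norm (\<lambda>x. w x - S h w x) \<le> C1 * h ^ s * Sobolev_norm (s + 1) U w"
    using energy_error[OF approx] by blast
  obtain C2 where C2: "\<And>h \<psi>. h \<in> I \<Longrightarrow> \<psi> \<in> L2_mean_zero U \<inter> Sobolev 1 U \<Longrightarrow>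
      (INF \<psi>h\<in>Qh h. nrm (\<lambda>x. \<psi> x - \<psi>h x)) \<le> C2 * h * Sobolev_norm 1 U \<psi>"
    using approx unfolding approximation_order_def by blast
  obtain C3 where solvable: "\<And>g. g \<in> L2 U \<Longrightarrow> \<exists>v r. stokes_solution U g v r"
    and C3: "\<And>g v r. g \<in> L2 U \<Longrightarrow> stokes_solution U g v r \<Longrightarrow> v \<in> Sobolev 2 U \<and> r \<in> Sobolev 1 U \<and>
        Sobolev_norm 2 U v + Sobolev_norm 1 U r \<le> C3 * nrm g"
    using reg unfolding stokes_H2_regular_def by blast
  \<comment> \<open>One factor for the velocity and the pressure part, so that their norms can be
    added up to the regularity bound.\<close>
  define M where "M = max C1 (real CARD('n) * max 0 C2)"
  have M: "0 \<le> M" "C1 \<le> M" "real CARD('n) * max 0 C2 \<le> M" using C1(1) by (auto simp: M_def)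
  have "nrm (\<lambda>x. w x - S h w x) \<le> (M * max 0 C3) * h * grad_norm (\<lambda>x. w x - S h w x)"
    if h: "h \<in> I" and w: "w \<in> H10 U" "div_free w" for h w
  proof -
    define g where "g = (\<lambda>x. w x - S h w x)"
    have g: "g \<in> H10 U" unfolding g_def by (rule S_error_H10[OF h w(1)])
    note gL2 = H10_L2[OF g]
    note SZ = S_Z[OF h w(1)] and h0 = mesh_pos[OF h]
    note SH = Z_H10[OF h SZ]
    obtain v r where vr: "stokes_solution U g v r" using solvable[OF gL2] by blast
    note reg_vr = C3[OF gL2 vr]
    have v: "v \<in> H10 U" "div_free v" and r: "r \<in> L2_mean_zero U" "r \<in> L2 U"
      and eq: "grad_inner v g + ip r (weak_div U g) = ip g g"
      using vr g by (auto simp: stokes_solution_def div_free_def L2_mean_zero_def)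
    \<comment> \<open>Orthogonality permits subtracting the projection of the dual velocity
      \<open>v\<close>, which is in \<open>H2\<close>; its error is estimated with
      \<open>s = 1\<close>, admissible as \<open>1 \<le> k\<close>.\<close>
    have "grad_inner g v = grad_inner g (\<lambda>x. v x - S h v x)"
      using S_orthogonal[OF h w(1) S_Z[OF h v(1)]]
        grad_inner_diff_right[OF v(1) Z_H10[OF h S_Z[OF h v(1)]] g] by (simp add: g_def)
    also have "\<dots> \<le> grad_norm g * grad_norm (\<lambda>x. v x - S h v x)"
      using grad_inner_Cauchy_Schwarz[OF g S_error_H10[OF h v(1)]] by simp
    also have "\<dots> \<le> grad_norm g * (C1 * h * Sobolev_norm 2 U v)"
      using C1(2)[OF h, of 1 v] v reg_vr k by (intro mult_left_mono L2_norm_nonneg) simp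
    also have "\<dots> \<le> grad_norm g * (M * h * Sobolev_norm 2 U v)"
      using h0 M by (intro mult_left_mono mult_right_mono L2_norm_nonneg Sobolev_norm_nonneg) auto
    finally have first: "grad_inner v g \<le> grad_norm g * (M * h * Sobolev_norm 2 U v)"
      by (simp add: L2_inner_commute)
    have "ip r (weak_div U g) \<le> (real CARD('n) * grad_norm g) * nrm (\<lambda>x. r x - q x)"
      if q: "q \<in> Qh h" for q
    proof -
      have q2: "q \<in> L2 U" "q \<in> L2_mean_zero U"
        using Qh_L2[OF h] fin_dim_subset[OF Qh[OF h]] q by auto
      \<comment> \<open>Both parts of \<open>g\<close> contribute zero: \<open>w\<close> since
        \<open>q\<close> has mean zero, \<open>S h w\<close> by membership in
        \<open>Z h\<close>.\<close>
      have "ip (weak_div U g) q = 0"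
        using L2_inner_weak_div_diff[OF w(1) SH q2(1)] w(2) SZ q q2(2)
        by (simp add: g_def div_free_def discr_div_free_def)
      then have "ip r (weak_div U g) = ip (weak_div U g) (\<lambda>x. r x - q x)"
        using L2_inner_diff_right[OF r(2) q2(1) weak_div_eq_trace(1)[OF H10_Sobolev[OF g]]]
        by (simp add: L2_inner_commute)
      then show ?thesis
        using L2_inner_weak_div_bound[OF g L2_diff[OF r(2) q2(1)]] by simp
    qed
    then have "ip r (weak_div U g) \<le>
        (real CARD('n) * grad_norm g) * (INF q\<in>Qh h. nrm (\<lambda>x. r x - q x))"
      using fin_dim_zero[OF Qh[OF h]]
      by (intro mult_INF_bound mult_nonneg_nonneg) (auto simp: L2_norm_nonneg)
    also have "\<dots> \<le> (real CARD('n) * grad_norm g) * (max 0 C2 * h * Sobolev_norm 1 U r)"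
    proof (rule mult_left_mono)
      have "(INF q\<in>Qh h. nrm (\<lambda>x. r x - q x)) \<le> C2 * h * Sobolev_norm 1 U r"
        using C2[OF h] r reg_vr by blast
      also have "\<dots> \<le> max 0 C2 * h * Sobolev_norm 1 U r"
        using h0 by (intro mult_right_mono Sobolev_norm_nonneg) auto
      finally show "(INF q\<in>Qh h. nrm (\<lambda>x. r x - q x)) \<le> max 0 C2 * h * Sobolev_norm 1 U r" .
    qed (simp add: L2_norm_nonneg)
    also have "\<dots> = grad_norm g * ((real CARD('n) * max 0 C2) * h * Sobolev_norm 1 U r)"
      by (simp add: mult_ac)
    also have "\<dots> \<le> grad_norm g * (M * h * Sobolev_norm 1 U r)"
      using h0 M by (intro mult_left_mono mult_right_mono L2_norm_nonneg Sobolev_norm_nonneg) auto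
    finally have "(nrm g)\<^sup>2 \<le>
        grad_norm g * (M * h * Sobolev_norm 2 U v) + grad_norm g * (M * h * Sobolev_norm 1 U r)"
      using first eq by (simp add: L2_norm_square)
    also have "\<dots> = (grad_norm g * (M * h)) * (Sobolev_norm 2 U v + Sobolev_norm 1 U r)"
      by (simp add: algebra_simps)
    also have "\<dots> \<le> (grad_norm g * (M * h)) * (max 0 C3 * nrm g)"
    proof (rule mult_left_mono)
      have "Sobolev_norm 2 U v + Sobolev_norm 1 U r \<le> C3 * nrm g" using reg_vr by blast
      also have "\<dots> \<le> max 0 C3 * nrm g" by (intro mult_right_mono L2_norm_nonneg) simp
      finally show "Sobolev_norm 2 U v + Sobolev_norm 1 U r \<le> max 0 C3 * nrm g" .
    qed (use h0 M in \<open>auto simp: L2_norm_nonneg\<close>)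
    \<comment> \<open>One factor \<open>nrm g\<close> is the right-hand side of the dual problem,
      and it cancels.\<close>
    finally have "nrm g * nrm g \<le> ((M * max 0 C3) * h * grad_norm g) * nrm g"
      by (simp add: power2_eq_square mult_ac)
    then have "nrm g \<le> (M * max 0 C3) * h * grad_norm g"
      by (rule le_if_mult_self_le) (use h0 M in \<open>simp add: L2_norm_nonneg\<close>)
    then show ?thesis by (simp add: g_def)
  qed
  then show thesis using that[of "M * max 0 C3"] M by simp
qed

end

subsection \<open>Reconstruction operators\<close>

locale reconstructed_discretization = discretization U I Vh Qh
  for U :: "(real ^ 'n::finite) set" and I Vh Qh +
  fixes Wh :: "real \<Rightarrow> ('n vfield) set"
    and Rec :: "real \<Rightarrow> ('n vfield) \<Rightarrow> 'n vfield"
  assumes Rec: "h \<in> I \<Longrightarrow> reconstruction_operator U (Vh h) (Qh h) (Wh h) (Rec h)"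
begin

text \<open>The discrete spaces are contained in \<open>H10\<close>, so the discrete summand of a
  member of the domain can be taken to be zero.\<close>

lemma Rec_domain: "h \<in> I \<Longrightarrow> u \<in> H10 U \<Longrightarrow> u \<in> {\<lambda>x. v x + w x | v w. v \<in> Vh h \<and> w \<in> H10 U}"
  using fin_dim_zero[OF Vh]
  by - (rule CollectI, rule exI[of _ "\<lambda>x. 0"], rule exI[of _ u], simp)

lemma Rec_L2:
  assumes "h \<in> I" "u \<in> H10 U"
  shows "Rec h u \<in> L2 U"
proof -
  have "fin_dim_subspace U (Wh h) (L2 U)" "Rec h u \<in> Wh h"
    using Rec[OF assms(1)] Rec_domain[OF assms] unfolding reconstruction_operator_def Let_def by blast+
  then show ?thesis by (rule fin_dim_subset)
qed

lemma Rec_cong: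
  assumes "h \<in> I" "u \<in> H10 U" "v \<in> H10 U" "ae_eq U u v"
  shows "ae_eq U (Rec h u) (Rec h v)"
  using Rec[OF assms(1)] Rec_domain[OF assms(1,2)] Rec_domain[OF assms(1,3)] assms(4)
  unfolding reconstruction_operator_def Let_def by blast

lemma Rec_lincomb:
  assumes "h \<in> I" "u \<in> H10 U" "v \<in> H10 U"
  shows "ae_eq U (Rec h (\<lambda>x. a *\<^sub>R u x + b *\<^sub>R v x)) (\<lambda>x. a *\<^sub>R Rec h u x + b *\<^sub>R Rec h v x)"
proof -
  let ?D = "{\<lambda>x. v x + w x | v w. v \<in> Vh h \<and> w \<in> H10 U}"
  have "\<forall>v\<in>?D. \<forall>w\<in>?D. \<forall>a b.
      ae_eq U (Rec h (\<lambda>x. a *\<^sub>R v x + b *\<^sub>R w x)) (\<lambda>x. a *\<^sub>R Rec h v x + b *\<^sub>R Rec h w x)"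
    using Rec[OF assms(1)] unfolding reconstruction_operator_def Let_def by (elim conjE)
  from this[rule_format, OF Rec_domain[OF assms(1,2)] Rec_domain[OF assms(1,3)]] show ?thesis .
qed

lemma Rec_diff:
  assumes "h \<in> I" "u \<in> H10 U" "v \<in> H10 U"
  shows "ae_eq U (Rec h (\<lambda>x. u x - v x)) (\<lambda>x. Rec h u x - Rec h v x)"
  using Rec_lincomb[OF assms, of 1 "-1"] by simp

text \<open>The normal trace is defined by Green's formula; once it and the divergence vanish, only
  the gradient term is left. The divergence is zero almost everywhere, which suffices under the
  integral.\<close>

lemma Rec_orthogonal_grad:
  assumes "h \<in> I" "\<phi> \<in> Z h" "\<psi> \<in> Sobolev 1 U"
  shows "ip (grad U \<psi>) (Rec h \<phi>) = 0"
proof -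
  have R: "Rec h \<phi> \<in> Hdiv U" "ae_eq U (weak_div U (Rec h \<phi>)) (\<lambda>x. 0)"
    "normal_trace U (Rec h \<phi>) \<psi> = 0"
    using Rec[OF assms(1)] assms(2,3) unfolding reconstruction_operator_def by blast+
  then have "weak_div U (Rec h \<phi>) \<in> L2 U" using weak_div_eqI(1) by (auto simp: Hdiv_def)
  then have "ip \<psi> (weak_div U (Rec h \<phi>)) = ip \<psi> (\<lambda>x. 0)"
    using R(2) Sobolev_L2[OF assms(3)] by (intro L2_inner_cong ae_eq_refl L2_zero)
  then show ?thesis using R(3) by (simp add: normal_trace_def)
qed

lemma Rec_linear_form:
  assumes h: "h \<in> I" and g: "g \<in> L2 U"
  shows "linear_form_on U (Z h) (\<lambda>\<phi>. ip g (Rec h \<phi>))"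
proof (rule linear_form_onI)
  fix v w a b assume "v \<in> Z h" "w \<in> Z h"
  then have vw: "v \<in> H10 U" "w \<in> H10 U" using Z_H10[OF h] by auto
  note L2 = Rec_L2[OF h vw(1)] Rec_L2[OF h vw(2)]
  have "ip g (Rec h (\<lambda>x. a *\<^sub>R v x + b *\<^sub>R w x)) =
      ip g (\<lambda>x. a *\<^sub>R Rec h v x + b *\<^sub>R Rec h w x)"
    by (intro L2_inner_cong ae_eq_refl Rec_lincomb h vw g Rec_L2 H10_lincomb L2_lincomb)
  then show "ip g (Rec h (\<lambda>x. a *\<^sub>R v x + b *\<^sub>R w x)) =
      a * ip g (Rec h v) + b * ip g (Rec h w)"
    using L2_inner_lincomb_right[OF L2 g] by simp
  assume "ae_eq U v w"
  then show "ip g (Rec h v) = ip g (Rec h w)"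
    by (intro L2_inner_cong ae_eq_refl Rec_cong h vw g L2)
qed

lemma L2_inner_compl_Rec:
  assumes "h \<in> I" "g \<in> L2 U" "\<phi> \<in> H10 U"
  shows "ip g (compl_op (Rec h) \<phi>) = ip g \<phi> - ip g (Rec h \<phi>)"
  unfolding compl_op_def by (intro L2_inner_diff_right H10_L2 Rec_L2 assms)

lemma compl_Rec_linear_form:
  assumes h: "h \<in> I" and g: "g \<in> L2 U"
  shows "linear_form_on U (Z h) (\<lambda>\<phi>. ip g (compl_op (Rec h) \<phi>))"
proof (rule linear_form_onI)
  fix v w a b assume Z: "v \<in> Z h" "w \<in> Z h"
  then have vw: "v \<in> H10 U" "w \<in> H10 U" using Z_H10[OF h] by auto
  show "ip g (compl_op (Rec h) (\<lambda>x. a *\<^sub>R v x + b *\<^sub>R w x)) =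
      a * ip g (compl_op (Rec h) v) + b * ip g (compl_op (Rec h) w)"
    using linear_form_lincomb[OF Rec_linear_form[OF h g] Z, of a b]
      L2_inner_lincomb_right[OF H10_L2[OF vw(1)] H10_L2[OF vw(2)] g, of a b]
    by (simp add: L2_inner_compl_Rec h g vw H10_lincomb algebra_simps)
  assume ae: "ae_eq U v w"
  then have "ip g v = ip g w"
    by (intro L2_inner_cong ae_eq_refl g H10_L2 vw)
  then show "ip g (compl_op (Rec h) v) = ip g (compl_op (Rec h) w)"
    using linear_form_cong[OF Rec_linear_form[OF h g] Z ae] by (simp add: L2_inner_compl_Rec h g vw)
qed

lemma Rec_norm_le:
  assumes "h \<in> I" "u \<in> H10 U"
  shows "nrm (Rec h u) \<le> nrm u + nrm (compl_op (Rec h) u)"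
  using L2_norm_triangle_diff[OF Rec_L2[OF assms] H10_L2[OF assms(2)]]
  by (simp add: compl_op_def L2_norm_minus_commute)

text \<open>Property (A) of order 1 and the Poincare inequality give a bound by \<open>h\<close>
  times the gradient norm. As mesh sizes are bounded, this also yields stability from the gradient
  norm to \<open>L2\<close>. One constant is kept for all three estimates.\<close>

lemma reconstruction_bounds:
  assumes A: "reconstruction_approximation U I Rec k"
  obtains C where "0 \<le> C"
    "\<And>h m \<phi>. h \<in> I \<Longrightarrow> m \<in> {1..k + 1} \<Longrightarrow> \<phi> \<in> H10 U \<Longrightarrow> \<phi> \<in> Sobolev m U \<Longrightarrow>
      nrm (compl_op (Rec h) \<phi>) \<le> C * h ^ m * Sobolev_norm m U \<phi>"
    "\<And>h \<phi>. h \<in> I \<Longrightarrow> \<phi> \<in> H10 U \<Longrightarrow> nrm (compl_op (Rec h) \<phi>) \<le> C * h * grad_norm \<phi>"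
    "\<And>h \<phi>. h \<in> I \<Longrightarrow> \<phi> \<in> H10 U \<Longrightarrow> nrm (Rec h \<phi>) \<le> C * grad_norm \<phi>"
proof -
  obtain C where C: "\<And>h m \<phi>. h \<in> I \<Longrightarrow> m \<in> {1..k + 1} \<Longrightarrow> \<phi> \<in> H10 U \<inter> Sobolev m U \<Longrightarrow>
      nrm (compl_op (Rec h) \<phi>) \<le> C * h ^ m * Sobolev_norm m U \<phi>"
    using A unfolding reconstruction_approximation_def by blast
  obtain P where P: "0 < P" "\<And>u :: 'n vfield. u \<in> H10 U \<Longrightarrow> nrm u \<le> P * grad_norm u"
    using Poincare[OF bounded_domain] by blast
  obtain H where H: "0 < H" "\<And>h. h \<in> I \<Longrightarrow> norm h \<le> H"
    using bounded_mesh by (auto simp: bounded_pos)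
  \<comment> \<open>Here \<open>C'\<close> is a nonnegative constant for (A), \<open>D\<close>
    absorbs the Poincare constant and \<open>E\<close> the bound \<open>H\<close> for the mesh
    sizes; their sum dominates each of them.\<close>
  define C' where "C' = max 0 C"
  define D where "D = C' * (P + 1)"
  define E where "E = P + D * H"
  have pos: "0 \<le> C'" "0 \<le> D" "0 \<le> E" using P H by (auto simp: C'_def D_def E_def)
  have approx: "nrm (compl_op (Rec h) \<phi>) \<le> C' * h ^ m * Sobolev_norm m U \<phi>"
    if "h \<in> I" "m \<in> {1..k + 1}" "\<phi> \<in> H10 U" "\<phi> \<in> Sobolev m U" for h m \<phi>
  proof -
    have "C * h ^ m * Sobolev_norm m U \<phi> \<le> C' * h ^ m * Sobolev_norm m U \<phi>"
      using mesh_pos[OF that(1)] by (intro mult_right_mono Sobolev_norm_nonneg) (auto simp: C'_def)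
    with C[OF that(1,2)] that(3,4) show ?thesis by fastforce
  qed
  have first: "nrm (compl_op (Rec h) \<phi>) \<le> D * h * grad_norm \<phi>" if h: "h \<in> I" and \<phi>: "\<phi> \<in> H10 U" for h \<phi>
  proof -
    have "nrm (compl_op (Rec h) \<phi>) \<le> C' * h * Sobolev_norm 1 U \<phi>"
      using approx[OF h, of 1 \<phi>] H10_Sobolev[OF \<phi>] \<phi> by simp
    also have "\<dots> \<le> C' * h * ((P + 1) * grad_norm \<phi>)"
    proof (rule mult_left_mono)
      show "Sobolev_norm 1 U \<phi> \<le> (P + 1) * grad_norm \<phi>"
        using Sobolev_norm_1_bounds(3)[OF H10_Sobolev[OF \<phi>]] P(2)[OF \<phi>] by (simp add: distrib_right)
    qed (use mesh_pos[OF h] pos in auto)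
    finally show ?thesis by (simp add: D_def mult_ac)
  qed
  have stable: "nrm (Rec h \<phi>) \<le> E * grad_norm \<phi>" if h: "h \<in> I" and \<phi>: "\<phi> \<in> H10 U" for h \<phi>
  proof -
    have "nrm (Rec h \<phi>) \<le> P * grad_norm \<phi> + D * h * grad_norm \<phi>"
      using Rec_norm_le[OF h \<phi>] P(2)[OF \<phi>] first[OF h \<phi>] by simp
    also have "\<dots> \<le> P * grad_norm \<phi> + D * H * grad_norm \<phi>"
      using H(2)[OF h] pos by (intro add_left_mono mult_right_mono mult_left_mono L2_norm_nonneg) auto
    finally show ?thesis by (simp add: E_def distrib_right)
  qed
  let ?C = "C' + D + E"
  have mono: "x \<le> ?C * y" if "x \<le> c * y" "0 \<le> y" "c \<in> {C', D, E}" for x y c :: real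
  proof -
    have "c * y \<le> ?C * y" using that(2,3) pos by (intro mult_right_mono) auto
    with that(1) show ?thesis by simp
  qed
  show thesis
  proof (rule that[of ?C])
    show "0 \<le> ?C" using pos by simp
    fix h m and \<phi> :: "'n vfield" assume h: "h \<in> I" and \<phi>: "\<phi> \<in> H10 U"
    show "nrm (compl_op (Rec h) \<phi>) \<le> ?C * h * grad_norm \<phi>"
      using mono[of _ D "h * grad_norm \<phi>"] first[OF h \<phi>] mesh_pos[OF h] by (simp add: L2_norm_nonneg mult.assoc)
    show "nrm (Rec h \<phi>) \<le> ?C * grad_norm \<phi>"
      using mono[of _ E "grad_norm \<phi>"] stable[OF h \<phi>] by (simp add: L2_norm_nonneg)
    assume "m \<in> {1..k + 1}" "\<phi> \<in> Sobolev m U"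
    then show "nrm (compl_op (Rec h) \<phi>) \<le> ?C * h ^ m * Sobolev_norm m U \<phi>"
      using mono[of _ C' "h ^ m * Sobolev_norm m U \<phi>"] approx[OF h _ \<phi>] mesh_pos[OF h]
      by (simp add: Sobolev_norm_nonneg mult.assoc)
  qed
qed

text \<open>The reconstructed projector error is not estimated by stability, which would lose a
  power of \<open>h\<close>, but by the projector error in \<open>L2\<close> plus its first-order
  reconstruction error; each is \<open>h\<close> times an energy error of order
  \<open>h ^ k\<close>. Stability is used for the tested function \<open>Rec h \<phi>\<close>
  alone.\<close>

proposition reconstruction_dual_norm_bound:
  assumes approx: "approximation_order U I Vh Qh k" and k: "1 \<le> k" and reg: "stokes_H2_regular U"
    and A: "reconstruction_approximation U I Rec k"
  obtains C where "0 \<le> C"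
    "\<And>h w. h \<in> I \<Longrightarrow> w \<in> H10 U \<Longrightarrow> w \<in> Sobolev (k + 1) U \<Longrightarrow> div_free w \<Longrightarrow>
      dual h (Rec h) (\<lambda>x. w x - Rec h (S h w) x) \<le>
        C * h ^ (k + 1) * Sobolev_norm (k + 1) U w"
proof -
  obtain CE where CE: "0 \<le> CE" "\<And>h s w. h \<in> I \<Longrightarrow> s \<in> {1..k} \<Longrightarrow> w \<in> H10 U \<Longrightarrow> w \<in> Sobolev (s + 1) U \<Longrightarrow>
      div_free w \<Longrightarrow> grad_norm (\<lambda>x. w x - S h w x) \<le> CE * h ^ s * Sobolev_norm (s + 1) U w"
    using energy_error[OF approx] by blast
  obtain CL where CL: "0 \<le> CL" "\<And>h w. h \<in> I \<Longrightarrow> w \<in> H10 U \<Longrightarrow> div_free w \<Longrightarrow>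
      nrm (\<lambda>x. w x - S h w x) \<le> CL * h * grad_norm (\<lambda>x. w x - S h w x)"
    using L2_error[OF approx k reg] by blast
  obtain C where C: "0 \<le> C"
    "\<And>h m \<phi>. h \<in> I \<Longrightarrow> m \<in> {1..k + 1} \<Longrightarrow> \<phi> \<in> H10 U \<Longrightarrow> \<phi> \<in> Sobolev m U \<Longrightarrow>
      nrm (compl_op (Rec h) \<phi>) \<le> C * h ^ m * Sobolev_norm m U \<phi>"
    "\<And>h \<phi>. h \<in> I \<Longrightarrow> \<phi> \<in> H10 U \<Longrightarrow> nrm (compl_op (Rec h) \<phi>) \<le> C * h * grad_norm \<phi>"
    "\<And>h \<phi>. h \<in> I \<Longrightarrow> \<phi> \<in> H10 U \<Longrightarrow> nrm (Rec h \<phi>) \<le> C * grad_norm \<phi>"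
    using reconstruction_bounds[OF A] by blast
  \<comment> \<open>The summand \<open>C\<close> comes from (A) of order \<open>k + 1\<close>
    applied to \<open>w\<close>, the product from the reconstructed projector error.\<close>
  define D where "D = C + (CL + C) * CE"
  have D: "0 \<le> D" using C(1) CE(1) CL(1) by (simp add: D_def)
  have "dual h (Rec h) (\<lambda>x. w x - Rec h (S h w) x) \<le>
      (D * C) * h ^ (k + 1) * Sobolev_norm (k + 1) U w"
    if h: "h \<in> I" and w: "w \<in> H10 U" "w \<in> Sobolev (k + 1) U" "div_free w" for h w
  proof -
    note h0 = mesh_pos[OF h]
    have SH: "S h w \<in> H10 U" by (rule Z_H10[OF h S_Z[OF h w(1)]])
    let ?e = "\<lambda>x. w x - S h w x" and ?r = "\<lambda>x. w x - Rec h (S h w) x"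
    let ?N = "h ^ (k + 1) * Sobolev_norm (k + 1) U w"
    have N: "0 \<le> ?N" using h0 by (simp add: Sobolev_norm_nonneg)
    have e: "?e \<in> H10 U" by (rule S_error_H10[OF h w(1)])
    have r: "?r \<in> L2 U" by (intro L2_diff H10_L2 w(1) Rec_L2 h SH)
    have "grad_norm ?e \<le> CE * h ^ k * Sobolev_norm (k + 1) U w"
      using CE(2)[OF h _ w(1,2,3)] k by simp
    then have "(CL + C) * h * grad_norm ?e \<le> (CL + C) * h * (CE * h ^ k * Sobolev_norm (k + 1) U w)"
      using CL(1) C(1) h0 by (intro mult_left_mono) auto
    then have e_bound: "(CL + C) * h * grad_norm ?e \<le> ((CL + C) * CE) * ?N"
      by (simp add: mult_ac power_add)
    have c: "compl_op (Rec h) w \<in> L2 U" "Rec h ?e \<in> L2 U"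
      unfolding compl_op_def by (intro L2_diff H10_L2 Rec_L2 h w(1) e)+
    have "ae_eq U ?r (\<lambda>x. compl_op (Rec h) w x + Rec h ?e x)"
      using Rec_diff[OF h w(1) SH] unfolding ae_eq_def by eventually_elim (simp add: compl_op_def)
    then have "nrm ?r = nrm (\<lambda>x. compl_op (Rec h) w x + Rec h ?e x)"
      by (intro L2_norm_cong r L2_add c)
    also have "\<dots> \<le> nrm (compl_op (Rec h) w) + nrm (Rec h ?e)"
      by (intro L2_norm_triangle c)
    also have "nrm (Rec h ?e) \<le> nrm ?e + nrm (compl_op (Rec h) ?e)"
      by (rule Rec_norm_le[OF h e])
    also have "\<dots> \<le> CL * h * grad_norm ?e + C * h * grad_norm ?e"
      by (intro add_mono CL(2) C(3) h w e)
    also have "\<dots> = (CL + C) * h * grad_norm ?e" by (simp add: algebra_simps)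
    also note e_bound
    also have "nrm (compl_op (Rec h) w) \<le> C * ?N"
      using C(2)[OF h _ w(1,2)] by (simp add: mult.assoc)
    finally have r_bound: "nrm ?r \<le> D * ?N" by (simp add: D_def distrib_right)
    \<comment> \<open>The further factor \<open>C\<close> bounds \<open>Rec h \<phi>\<close> by the
      gradient norm in the denominator.\<close>
    have "dual h (Rec h) ?r \<le> (D * ?N) * C"
    proof (rule dual_norm_le)
      show "0 \<le> (D * ?N) * C" using D N C(1) by simp
      fix \<phi> assume "\<phi> \<in> Z h"
      then have \<phi>: "\<phi> \<in> H10 U" by (rule Z_H10[OF h])
      have "ip ?r (Rec h \<phi>) \<le> nrm ?r * nrm (Rec h \<phi>)"
        using L2_Cauchy_Schwarz[OF r Rec_L2[OF h \<phi>]] by simp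
      also have "\<dots> \<le> (D * ?N) * (C * grad_norm \<phi>)"
        by (intro mult_mono r_bound C(4) h \<phi> L2_norm_nonneg mult_nonneg_nonneg D N)
      finally show "ip ?r (Rec h \<phi>) \<le> (D * ?N) * C * grad_norm \<phi>" by (simp add: mult.assoc)
    qed
    then show ?thesis by (simp add: mult_ac)
  qed
  then show thesis using that[of "D * C"] D C(1) by simp
qed

subsection \<open>Discrete error equations\<close>

text \<open>Fields with one nonzero component isolate one component of the momentum equation, and
  their divergence reduces to one partial derivative.\<close>

lemma weak_div_test_scalar:
  fixes \<phi> :: "real ^ 'n \<Rightarrow> real"
  assumes \<phi>: "\<phi> \<in> test_functions U"
  shows "ae_eq U (weak_div U (\<lambda>x. \<phi> x *\<^sub>R axis j 1)) (partial_deriv j \<phi>)"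
proof (rule weak_div_eqI(2)[OF test_fun_L2'(2)[OF \<phi>]], unfold has_weak_div_def, intro allI impI)
  fix \<psi> :: "real ^ 'n \<Rightarrow> real" assume \<psi>: "\<psi> \<in> test_functions U"
  have "ip (\<lambda>x. \<phi> x *\<^sub>R axis j 1) (\<lambda>x. \<chi> i. partial_deriv i \<psi> x) = ip \<phi> (partial_deriv j \<psi>)"
    by (simp add: L2_inner_def inner_commute[of "axis j 1"] inner_axis)
  also have "\<dots> = - ip (partial_deriv j \<phi>) \<psi>"
    using integration_by_parts[OF lmeasurable_domain \<phi> \<psi>, of j] by (simp add: L2_inner_def)
  finally show "ip (\<lambda>x. \<phi> x *\<^sub>R axis j 1) (\<lambda>x. \<chi> i. partial_deriv i \<psi> x) =
      - ip (partial_deriv j \<phi>) \<psi>" .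
qed

text \<open>Testing with a scalar test function times a unit vector shows that each component of the
  residual is annihilated. The pressure gradient carries a minus sign because the weak form contains
  the pressure with a plus sign.\<close>

lemma momentum_equation_strong:
  fixes v s :: "'n vfield"
  assumes v: "v \<in> Sobolev 2 U" and p: "p \<in> Sobolev 1 U" and s: "s \<in> L2 U"
    and eq: "\<And>\<phi>. \<phi> \<in> H10 U \<Longrightarrow> \<nu> * grad_inner v \<phi> + ip (weak_div U \<phi>) p = ip s \<phi>"
  shows "ae_eq U s (\<lambda>x. (- \<nu>) *\<^sub>R laplacian U v x + (- 1) *\<^sub>R grad U p x)"
proof -
  define m where "m = (\<lambda>x. (- \<nu>) *\<^sub>R laplacian U v x + (- 1) *\<^sub>R grad U p x)"
  have L2: "laplacian U v \<in> L2 U" "grad U p \<in> L2 U" by (intro laplacian_L2 grad_L2 v p)+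
  have m: "m \<in> L2 U" unfolding m_def by (rule L2_lincomb[OF L2])
  have "ae_eq U (\<lambda>x. s x - m x) (\<lambda>x. 0)"
  proof (rule fundamental_lemma[OF open_domain L2_diff[OF s m]])
    fix \<phi> :: "real ^ 'n \<Rightarrow> real" assume \<phi>: "\<phi> \<in> test_functions U"
    let ?X = "integral\<^sup>L (lebesgue_on U) (\<lambda>x. \<phi> x *\<^sub>R (s x - m x))"
    have "?X $ j = 0" for j
    proof -
      let ?t = "\<lambda>x. \<phi> x *\<^sub>R axis j (1::real)"
      have t: "?t \<in> test_functions U"
        by (rule test_fun_linear_image[OF bounded_linear_scaleR_left \<phi>])
      note tH = test_fun_H10[OF t] and tL2 = test_fun_L2'(1)[OF t]
      have "ip (weak_div U ?t) p = ip (partial_deriv j \<phi>) p"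
        by (intro L2_inner_cong weak_div_test_scalar \<phi> ae_eq_refl weak_div_eq_trace(1) H10_Sobolev tH
            test_fun_L2'(2) Sobolev_L2[OF p])
      also have "\<dots> = - ip (weak_deriv U [j] p) \<phi>"
        using has_weak_deriv_inner[OF Sobolev_weak_deriv_1(2)[OF p] Sobolev_L2[OF p]
            Sobolev_weak_deriv_1(1)[OF p] \<phi>] by (simp add: L2_inner_commute)
      also have "ip (weak_deriv U [j] p) \<phi> = ip (grad U p) ?t"
        by (simp add: L2_inner_def inner_axis grad_def mult.commute)
      finally have "ip s ?t = (- \<nu>) * ip (laplacian U v) ?t + (- 1) * ip (grad U p) ?t"
        using eq[OF tH] Green[OF v tH] by simp
      also have "\<dots> = ip m ?t"
        unfolding m_def by (rule L2_inner_lincomb_left[OF L2 tL2, symmetric])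
      finally have "ip (\<lambda>x. s x - m x) ?t = 0"
        using L2_inner_diff_left[OF s m tL2] by simp
      moreover have "ip (\<lambda>x. s x - m x) ?t = ?X \<bullet> axis j 1"
        unfolding L2_inner_def
        by (subst integral_inner_left[symmetric])
          (auto intro!: L2_scaleR_integrable test_fun_L2'(1)[OF \<phi>] L2_diff[OF s m])
      ultimately show ?thesis by (simp add: inner_axis)
    qed
    then show "?X = 0" by (simp add: vec_eq_iff)
  qed
  then show ?thesis by (simp add: ae_eq_def m_def)
qed

text \<open>State and adjoint differ only in the data \<open>s\<close>. Green's formula turns the
  gradient term into the Laplacian tested with \<open>\<phi>\<close>; the strong form turns
  \<open>s\<close> into the Laplacian tested with \<open>Rec h \<phi>\<close>, where the pressure
  gradient is invisible. The difference is the operator \<open>1 - \<Pi>\<close>.\<close>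

lemma consistency_error:
  fixes v s :: "'n vfield"
  assumes v: "v \<in> Sobolev 2 U" and p: "p \<in> Sobolev 1 U" and s: "s \<in> L2 U"
    and eq: "\<And>\<phi>. \<phi> \<in> H10 U \<Longrightarrow> \<nu> * grad_inner v \<phi> + ip (weak_div U \<phi>) p = ip s \<phi>"
    and h: "h \<in> I" and \<phi>: "\<phi> \<in> Z h"
  shows "\<nu> * grad_inner v \<phi> - ip s (Rec h \<phi>) =
    - \<nu> * ip (laplacian U v) (compl_op (Rec h) \<phi>)"
proof -
  note \<phi>H = Z_H10[OF h \<phi>]
  note R = Rec_L2[OF h \<phi>H]
  have L2: "laplacian U v \<in> L2 U" "grad U p \<in> L2 U" by (intro laplacian_L2 grad_L2 v p)+
  have "ip s (Rec h \<phi>) =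
      ip (\<lambda>x. (- \<nu>) *\<^sub>R laplacian U v x + (- 1) *\<^sub>R grad U p x) (Rec h \<phi>)"
    by (intro L2_inner_cong[OF momentum_equation_strong[OF v p s eq] ae_eq_refl] s L2_lincomb L2 R)
  also have "\<dots> = - \<nu> * ip (laplacian U v) (Rec h \<phi>)"
    using L2_inner_lincomb_left[OF L2 R, of "- \<nu>" "- 1"] Rec_orthogonal_grad[OF h \<phi> p] by simp
  finally show ?thesis
    using Green[OF v \<phi>H] L2_inner_compl_Rec[OF h L2(1) \<phi>H] by (simp add: right_diff_distrib)
qed

text \<open>The intermediate function is the reconstruction of \<open>S h w\<close>. The last term
  then pairs two reconstructed functions, the symmetric shape that the cancellation of the coupling
  relies on.\<close>

lemma L2_inner_reconstruction_split:
  assumes h: "h \<in> I" and w: "w \<in> H10 U" and wh: "wh \<in> Vh h" and \<phi>: "\<phi> \<in> H10 U"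
  shows "ip w (Rec h \<phi>) - ip (Rec h wh) (Rec h \<phi>) =
    ip (\<lambda>x. w x - Rec h (S h w) x) (Rec h \<phi>)
      + ip (Rec h (\<lambda>x. S h w x - wh x)) (Rec h \<phi>)"
proof -
  have H: "S h w \<in> H10 U" "wh \<in> H10 U" by (intro Z_H10[OF h S_Z[OF h w]] Vh_H10[OF h wh])+
  note R = Rec_L2[OF h H(1)] Rec_L2[OF h H(2)] Rec_L2[OF h \<phi>]
  have "ip (Rec h (\<lambda>x. S h w x - wh x)) (Rec h \<phi>) =
      ip (\<lambda>x. Rec h (S h w) x - Rec h wh x) (Rec h \<phi>)"
    by (intro L2_inner_cong Rec_diff ae_eq_refl h H Rec_L2 H10_diff \<phi> L2_diff)
  then show ?thesis
    using L2_inner_diff_left[OF R] L2_inner_diff_left[OF H10_L2[OF w] R(1) R(3)] by simp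
qed

theorem energy_error_bound:
  assumes h: "h \<in> I" and \<nu>: "\<nu> > 0" and \<alpha>: "\<alpha> > 0" and f: "f \<in> L2 U" and ud: "ud \<in> L2 U"
    and sys: "optimality_system U \<nu> \<alpha> f ud u z p l"
    and smooth: "u \<in> Sobolev 2 U" "z \<in> Sobolev 2 U" "p \<in> Sobolev 1 U" "l \<in> Sobolev 1 U"
    and dsys: "discrete_optimality_system U (Vh h) (Qh h) (Rec h) \<nu> \<alpha> f ud uh zh ph lh"
  shows "energy_norm U (\<lambda>x. S h u x - uh x) (\<lambda>x. S h z x - zh x) \<le>
    sqrt ((dual h (compl_op (Rec h)) (laplacian U u))\<^sup>2
          + (dual h (compl_op (Rec h)) (laplacian U z))\<^sup>2)
    + 1 / (\<nu> * \<alpha> powr (1/2))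
      * sqrt ((dual h (Rec h) (\<lambda>x. u x - Rec h (S h u) x))\<^sup>2
              + (dual h (Rec h) (\<lambda>x. z x - Rec h (S h z) x))\<^sup>2)"
proof -
  define a where "a = \<alpha> powr (-1/2)"
  have a: "0 < a" using \<alpha> by (simp add: a_def)
  have H: "u \<in> H10 U" "z \<in> H10 U" using sys by (auto simp: optimality_system_def)
  have state: "\<nu> * grad_inner u \<phi> + ip (weak_div U \<phi>) p + a * ip z \<phi> = ip f \<phi>"
    if "\<phi> \<in> H10 U" for \<phi>
    using sys that unfolding optimality_system_def a_def by (elim conjE bspec)
  have adjoint: "\<nu> * grad_inner \<phi> z + ip (weak_div U \<phi>) l - a * ip u \<phi> =
      - a * ip ud \<phi>" if "\<phi> \<in> H10 U" for \<phi>
    using sys that unfolding optimality_system_def a_def by (elim conjE bspec)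
  have discrete_state: "\<nu> * grad_inner uh \<phi> + ip (weak_div U \<phi>) ph =
      ip (\<lambda>x. f x - a *\<^sub>R Rec h zh x) (Rec h \<phi>)" if "\<phi> \<in> Vh h" for \<phi>
    using dsys that unfolding discrete_optimality_system_def a_def by (elim conjE bspec)
  have discrete_adjoint: "\<nu> * grad_inner \<phi> zh + ip (weak_div U \<phi>) lh =
      a * ip (\<lambda>x. Rec h uh x - ud x) (Rec h \<phi>)" if "\<phi> \<in> Vh h" for \<phi>
    using dsys that unfolding discrete_optimality_system_def a_def by (elim conjE bspec)
  have V: "uh \<in> Vh h" "zh \<in> Vh h" and ph: "ph \<in> Qh h" "lh \<in> Qh h"
    using dsys by (auto simp: discrete_optimality_system_def)
  have hZ: "uh \<in> Z h" "zh \<in> Z h"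
    using dsys by (auto simp: discrete_optimality_system_def discr_div_free_def)
  note hH = Vh_H10[OF h V(1)] Vh_H10[OF h V(2)]
  define eu ez where "eu = (\<lambda>x. S h u x - uh x)" and "ez = (\<lambda>x. S h z x - zh x)"
  have eZ: "eu \<in> Z h" "ez \<in> Z h"
    unfolding eu_def ez_def
    by (intro fin_dim_diff[OF Z_fin_dim[OF h]] S_Z[OF h] H hZ)+
  note eH = Z_H10[OF h eZ(1)] Z_H10[OF h eZ(2)]
  have project: "grad_inner (\<lambda>x. S h w x - wh x) \<phi> = grad_inner w \<phi> - grad_inner wh \<phi>"
    if "w \<in> H10 U" "wh \<in> H10 U" "\<phi> \<in> Z h" for w wh \<phi>
  proof -
    note SH = Z_H10[OF h S_Z[OF h that(1)]] and \<phi>H = Z_H10[OF h that(3)]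
    show ?thesis
      using S_orthogonal[OF h that(1,3)] grad_inner_diff_left[OF that(1) SH \<phi>H]
        grad_inner_diff_left[OF SH that(2) \<phi>H] by simp
  qed
  have error_u: "\<nu> * grad_inner eu \<phi> = - \<nu> * ip (laplacian U u) (compl_op (Rec h) \<phi>)
      - a * (ip (\<lambda>x. z x - Rec h (S h z) x) (Rec h \<phi>) + ip (Rec h ez) (Rec h \<phi>))"
    if \<phi>: "\<phi> \<in> Z h" for \<phi>
  proof -
    note \<phi>H = Z_H10[OF h \<phi>]
    note R = Rec_L2[OF h \<phi>H]
    \<comment> \<open>With the coupling moved to the right-hand side, the state equation has the
      form that \<open>consistency_error\<close> treats, with data \<open>f - a z\<close>.\<close>
    let ?s = "\<lambda>x. 1 *\<^sub>R f x + (- a) *\<^sub>R z x"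
    have s: "?s \<in> L2 U" by (intro L2_lincomb f H10_L2 H)
    have "\<nu> * grad_inner u \<phi> + ip (weak_div U \<phi>) p = ip ?s \<phi>" if "\<phi> \<in> H10 U" for \<phi>
      using state[OF that] L2_inner_lincomb_left[OF f H10_L2[OF H(2)] H10_L2[OF that], of 1 "- a"]
      by simp
    from consistency_error[OF smooth(1,3) s this h \<phi>]
    have "\<nu> * grad_inner u \<phi> - (ip f (Rec h \<phi>) - a * ip z (Rec h \<phi>)) =
        - \<nu> * ip (laplacian U u) (compl_op (Rec h) \<phi>)"
      using L2_inner_lincomb_left[OF f H10_L2[OF H(2)] R, of 1 "- a"] by simp
    moreover have "\<nu> * grad_inner uh \<phi> = ip (\<lambda>x. f x - a *\<^sub>R Rec h zh x) (Rec h \<phi>)"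
      using discrete_state[OF Z_Vh[OF \<phi>]] \<phi> ph(1) by (simp add: discr_div_free_def)
    then have "\<nu> * grad_inner uh \<phi> = ip f (Rec h \<phi>) - a * ip (Rec h zh) (Rec h \<phi>)"
      using L2_inner_lincomb_left[OF f Rec_L2[OF h hH(2)] R, of 1 "- a"] by simp
    moreover have "\<nu> * grad_inner eu \<phi> = \<nu> * grad_inner u \<phi> - \<nu> * grad_inner uh \<phi>"
      using project[OF H(1) hH(1) \<phi>] by (simp add: eu_def right_diff_distrib)
    moreover have "a * ip z (Rec h \<phi>) - a * ip (Rec h zh) (Rec h \<phi>) =
        a * (ip (\<lambda>x. z x - Rec h (S h z) x) (Rec h \<phi>) + ip (Rec h ez) (Rec h \<phi>))"
      using L2_inner_reconstruction_split[OF h H(2) V(2) \<phi>H] by (simp add: ez_def flip: right_diff_distrib)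
    ultimately show ?thesis by linarith
  qed
  have error_z: "\<nu> * grad_inner ez \<phi> = - \<nu> * ip (laplacian U z) (compl_op (Rec h) \<phi>)
      + a * (ip (\<lambda>x. u x - Rec h (S h u) x) (Rec h \<phi>) + ip (Rec h eu) (Rec h \<phi>))"
    if \<phi>: "\<phi> \<in> Z h" for \<phi>
  proof -
    note \<phi>H = Z_H10[OF h \<phi>]
    note R = Rec_L2[OF h \<phi>H]
    \<comment> \<open>The adjoint data are \<open>a (u - ud)\<close>; the opposite sign of the
      coupling leads to the plus sign in \<open>error_z\<close>.\<close>
    let ?s = "\<lambda>x. a *\<^sub>R u x + (- a) *\<^sub>R ud x"
    have s: "?s \<in> L2 U" by (intro L2_lincomb ud H10_L2 H)
    have "\<nu> * grad_inner z \<phi> + ip (weak_div U \<phi>) l = ip ?s \<phi>" if "\<phi> \<in> H10 U" for \<phi>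
      using adjoint[OF that] L2_inner_lincomb_left[OF H10_L2[OF H(1)] ud H10_L2[OF that], of a "- a"]
      by (simp add: L2_inner_commute[of U "grad U \<phi>" "grad U z"])
    from consistency_error[OF smooth(2,4) s this h \<phi>]
    have "\<nu> * grad_inner z \<phi> - (a * ip u (Rec h \<phi>) - a * ip ud (Rec h \<phi>)) =
        - \<nu> * ip (laplacian U z) (compl_op (Rec h) \<phi>)"
      using L2_inner_lincomb_left[OF H10_L2[OF H(1)] ud R, of a "- a"] by simp
    moreover have "\<nu> * grad_inner zh \<phi> = a * ip (\<lambda>x. Rec h uh x - ud x) (Rec h \<phi>)"
      using discrete_adjoint[OF Z_Vh[OF \<phi>]] \<phi> ph(2)
      by (simp add: discr_div_free_def L2_inner_commute[of U "grad U \<phi>" "grad U zh"])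
    then have "\<nu> * grad_inner zh \<phi> = a * ip (Rec h uh) (Rec h \<phi>) - a * ip ud (Rec h \<phi>)"
      using L2_inner_diff_left[OF Rec_L2[OF h hH(1)] ud R] by (simp add: right_diff_distrib)
    moreover have "\<nu> * grad_inner ez \<phi> = \<nu> * grad_inner z \<phi> - \<nu> * grad_inner zh \<phi>"
      using project[OF H(2) hH(2) \<phi>] by (simp add: ez_def right_diff_distrib)
    moreover have "a * ip u (Rec h \<phi>) - a * ip (Rec h uh) (Rec h \<phi>) =
        a * (ip (\<lambda>x. u x - Rec h (S h u) x) (Rec h \<phi>) + ip (Rec h eu) (Rec h \<phi>))"
      using L2_inner_reconstruction_split[OF h H(1) V(1) \<phi>H] by (simp add: eu_def flip: right_diff_distrib)
    ultimately show ?thesis by linarith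
  qed
  define Du Dz Pu Pz where "Du = dual h (compl_op (Rec h)) (laplacian U u)"
    and "Dz = dual h (compl_op (Rec h)) (laplacian U z)"
    and "Pu = dual h (Rec h) (\<lambda>x. u x - Rec h (S h u) x)"
    and "Pz = dual h (Rec h) (\<lambda>x. z x - Rec h (S h z) x)"
  define A B where "A = grad_norm eu" and "B = grad_norm ez"
  have compl_bound: "\<bar>ip g (compl_op (Rec h) \<phi>)\<bar> \<le> dual h (compl_op (Rec h)) g * grad_norm \<phi>"
    if "g \<in> L2 U" "\<phi> \<in> Z h" for g \<phi>
    by (rule dual_norm_bound[OF Vh[OF h] Qh_L2[OF h] compl_Rec_linear_form[OF h that(1)] that(2)])
  have rec_bound: "\<bar>ip g (Rec h \<phi>)\<bar> \<le> dual h (Rec h) g * grad_norm \<phi>"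
    if "g \<in> L2 U" "\<phi> \<in> Z h" for g \<phi>
    by (rule dual_norm_bound[OF Vh[OF h] Qh_L2[OF h] Rec_linear_form[OF h that(1)] that(2)])
  have rL2: "(\<lambda>x. w x - Rec h (S h w) x) \<in> L2 U" if "w \<in> H10 U" for w
    by (intro L2_diff H10_L2 that Rec_L2 h Z_H10[OF h] S_Z)
  let ?lu = "ip (laplacian U u) (compl_op (Rec h) eu)"
    and ?lz = "ip (laplacian U z) (compl_op (Rec h) ez)"
    and ?ru = "ip (\<lambda>x. u x - Rec h (S h u) x) (Rec h ez)"
    and ?rz = "ip (\<lambda>x. z x - Rec h (S h z) x) (Rec h eu)"
  have bounds: "\<bar>?lu\<bar> \<le> Du * A" "\<bar>?lz\<bar> \<le> Dz * B" "\<bar>?ru\<bar> \<le> Pu * B" "\<bar>?rz\<bar> \<le> Pz * A"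
    unfolding Du_def Dz_def Pu_def Pz_def A_def B_def
    by (intro compl_bound rec_bound laplacian_L2 smooth rL2 H eZ)+
  have "\<nu> * A\<^sup>2 = - \<nu> * ?lu - a * (?rz + ip (Rec h ez) (Rec h eu))"
    using error_u[OF eZ(1)] by (simp add: A_def L2_norm_square)
  moreover have "\<nu> * B\<^sup>2 = - \<nu> * ?lz + a * (?ru + ip (Rec h eu) (Rec h ez))"
    using error_z[OF eZ(2)] by (simp add: B_def L2_norm_square)
  ultimately have "\<nu> * (A\<^sup>2 + B\<^sup>2) = \<nu> * (- ?lu - ?lz) + a * (?ru - ?rz)"
    by (simp add: L2_inner_commute[of U "Rec h ez"] algebra_simps)
  also have "\<dots> \<le> \<nu> * (Du * A + Dz * B) + a * (Pz * A + Pu * B)"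
    using bounds \<nu> a by (intro add_mono mult_left_mono) auto
  \<comment> \<open>Cauchy-Schwarz in the plane. In the second sum the indices cross, because the
    state error is tested against the adjoint variable and conversely; the sum of squares does not
    notice.\<close>
  also have "\<dots> \<le> \<nu> * (sqrt (Du\<^sup>2 + Dz\<^sup>2) * sqrt (A\<^sup>2 + B\<^sup>2)) + a * (sqrt (Pz\<^sup>2 + Pu\<^sup>2) * sqrt (A\<^sup>2 + B\<^sup>2))"
  proof -
    have CS: "x * r + y * t \<le> sqrt (x\<^sup>2 + y\<^sup>2) * sqrt (r\<^sup>2 + t\<^sup>2)" for x y r t :: real
    proof -
      have "(x * r + y * t)\<^sup>2 \<le> (x\<^sup>2 + y\<^sup>2) * (r\<^sup>2 + t\<^sup>2)"
        using zero_le_power2[of "x * t - y * r"] by (simp add: power2_eq_square algebra_simps)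
      then have "\<bar>x * r + y * t\<bar> \<le> sqrt ((x\<^sup>2 + y\<^sup>2) * (r\<^sup>2 + t\<^sup>2))"
        using real_le_rsqrt real_sqrt_abs real_sqrt_le_mono by metis
      then show ?thesis by (simp add: real_sqrt_mult)
    qed
    show ?thesis using \<nu> a by (intro add_mono mult_left_mono CS) auto
  qed
  finally have main: "\<nu> * (A\<^sup>2 + B\<^sup>2) \<le>
      (\<nu> * sqrt (Du\<^sup>2 + Dz\<^sup>2) + a * sqrt (Pu\<^sup>2 + Pz\<^sup>2)) * sqrt (A\<^sup>2 + B\<^sup>2)"
    by (simp add: algebra_simps)
  define X where "X = sqrt (A\<^sup>2 + B\<^sup>2)"
  let ?R = "sqrt (Du\<^sup>2 + Dz\<^sup>2) + 1 / (\<nu> * \<alpha> powr (1/2)) * sqrt (Pu\<^sup>2 + Pz\<^sup>2)"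
  have "a = 1 / \<alpha> powr (1/2)" by (simp add: a_def powr_minus_divide)
  then have R: "\<nu> * sqrt (Du\<^sup>2 + Dz\<^sup>2) + a * sqrt (Pu\<^sup>2 + Pz\<^sup>2) = \<nu> * ?R"
    using \<nu> by (simp add: distrib_left)
  have R0: "0 \<le> ?R" using \<nu> by simp
  have "\<nu> * (X * X) \<le> \<nu> * ?R * X"
    using main unfolding R by (simp add: X_def)
  then have "X * X \<le> ?R * X" using \<nu> by (simp add: mult.assoc)
  then have "X \<le> ?R" using R0 by (rule le_if_mult_self_le)
  then show ?thesis
    by (simp add: energy_norm_def X_def A_def B_def eu_def ez_def Du_def Dz_def Pu_def Pz_def)
qed

end

text \<open>The constant of the rates is chosen ahead of the parameters, the data and the solutions,
  so it depends on nothing but the domain, the family of discretisations and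
  \<open>k\<close>.\<close>

theorem lemma4p1:
  fixes \<Omega> :: "(real ^ 'n) set"
    and I :: "real set"
    and Vh :: "real \<Rightarrow> (real ^ 'n \<Rightarrow> real ^ 'n) set"
    and Qh :: "real \<Rightarrow> (real ^ 'n \<Rightarrow> real) set"
    and Wh :: "real \<Rightarrow> (real ^ 'n \<Rightarrow> real ^ 'n) set"
    and Rec :: "real \<Rightarrow> (real ^ 'n \<Rightarrow> real ^ 'n) \<Rightarrow> real ^ 'n \<Rightarrow> real ^ 'n"
  assumes "CARD('n) \<le> 3" and "bounded \<Omega>" and "lipschitz_domain \<Omega>"
    and "bounded I" and "\<forall>h \<in> I. 0 < h"
    and "\<forall>h \<in> I. fin_dim_subspace \<Omega> (Vh h) (H10 \<Omega>)"
    and "\<forall>h \<in> I. fin_dim_subspace \<Omega> (Qh h) (L2_mean_zero \<Omega>)"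
    and "inf_sup_stable \<Omega> I Vh Qh"
    and "\<forall>h \<in> I. reconstruction_operator \<Omega> (Vh h) (Qh h) (Wh h) (Rec h)"
  shows
    "(\<forall>\<nu> > 0. \<forall>\<alpha> > 0. \<forall>f \<in> L2 \<Omega>. \<forall>ud \<in> L2 \<Omega>. \<forall>u z p l.
        optimality_system \<Omega> \<nu> \<alpha> f ud u z p l \<longrightarrow>
        u \<in> Sobolev 2 \<Omega> \<longrightarrow> z \<in> Sobolev 2 \<Omega> \<longrightarrow> p \<in> Sobolev 1 \<Omega> \<longrightarrow> l \<in> Sobolev 1 \<Omega> \<longrightarrow>
        (\<forall>h \<in> I. \<forall>uh zh ph lh.
           discrete_optimality_system \<Omega> (Vh h) (Qh h) (Rec h) \<nu> \<alpha> f ud uh zh ph lh \<longrightarrow>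
           energy_norm \<Omega> (\<lambda>x. stokes_projector \<Omega> (Vh h) (Qh h) u x - uh x) (\<lambda>x. stokes_projector \<Omega> (Vh h) (Qh h) z x - zh x)
             \<le> sqrt ((dual_norm \<Omega> (Vh h) (Qh h) (compl_op (Rec h)) (laplacian \<Omega> u))\<^sup>2
                     + (dual_norm \<Omega> (Vh h) (Qh h) (compl_op (Rec h)) (laplacian \<Omega> z))\<^sup>2)
               + 1 / (\<nu> * \<alpha> powr (1/2))
                 * sqrt ((dual_norm \<Omega> (Vh h) (Qh h) (Rec h) (\<lambda>x. u x - Rec h (stokes_projector \<Omega> (Vh h) (Qh h) u) x))\<^sup>2
                         + (dual_norm \<Omega> (Vh h) (Qh h) (Rec h) (\<lambda>x. z x - Rec h (stokes_projector \<Omega> (Vh h) (Qh h) z) x))\<^sup>2)))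
   \<and> (\<forall>k \<ge> 1.
        approximation_order \<Omega> I Vh Qh k \<longrightarrow>
        stokes_H2_regular \<Omega> \<longrightarrow>
        reconstruction_approximation \<Omega> I Rec k \<longrightarrow>
        reconstruction_consistency \<Omega> I Vh Qh Rec k \<longrightarrow>
        (\<exists>C. \<forall>\<nu> > 0. \<forall>\<alpha> > 0. \<forall>f \<in> L2 \<Omega>. \<forall>ud \<in> L2 \<Omega>. \<forall>u z p l.
           optimality_system \<Omega> \<nu> \<alpha> f ud u z p l \<longrightarrow>
           u \<in> Sobolev 2 \<Omega> \<longrightarrow> z \<in> Sobolev 2 \<Omega> \<longrightarrow> p \<in> Sobolev 1 \<Omega> \<longrightarrow> l \<in> Sobolev 1 \<Omega> \<longrightarrow>
           (\<forall>w \<in> {u, z} \<inter> Sobolev (k + 1) \<Omega>. \<forall>h \<in> I.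
              dual_norm \<Omega> (Vh h) (Qh h) (compl_op (Rec h)) (laplacian \<Omega> w)
                \<le> C * h ^ k * Sobolev_norm (k - 1) \<Omega> (laplacian \<Omega> w) \<and>
              dual_norm \<Omega> (Vh h) (Qh h) (Rec h) (\<lambda>x. w x - Rec h (stokes_projector \<Omega> (Vh h) (Qh h) w) x)
                \<le> C * h ^ (k + 1) * Sobolev_norm (k + 1) \<Omega> w)))"
proof -
  interpret reconstructed_discretization \<Omega> I Vh Qh Wh Rec
    using assms by unfold_locales (auto simp: lipschitz_domain_def)
  have rates: "\<exists>C. \<forall>\<nu> > 0. \<forall>\<alpha> > 0. \<forall>f \<in> L2 \<Omega>. \<forall>ud \<in> L2 \<Omega>. \<forall>u z p l.
      optimality_system \<Omega> \<nu> \<alpha> f ud u z p l \<longrightarrow>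
      u \<in> Sobolev 2 \<Omega> \<longrightarrow> z \<in> Sobolev 2 \<Omega> \<longrightarrow> p \<in> Sobolev 1 \<Omega> \<longrightarrow> l \<in> Sobolev 1 \<Omega> \<longrightarrow>
      (\<forall>w \<in> {u, z} \<inter> Sobolev (k + 1) \<Omega>. \<forall>h \<in> I.
        dual_norm \<Omega> (Vh h) (Qh h) (compl_op (Rec h)) (laplacian \<Omega> w)
          \<le> C * h ^ k * Sobolev_norm (k - 1) \<Omega> (laplacian \<Omega> w) \<and>
        dual_norm \<Omega> (Vh h) (Qh h) (Rec h) (\<lambda>x. w x - Rec h (S h w) x)
          \<le> C * h ^ (k + 1) * Sobolev_norm (k + 1) \<Omega> w)"
    if k: "k \<ge> 1" and approx: "approximation_order \<Omega> I Vh Qh k" and reg: "stokes_H2_regular \<Omega>"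
      and A: "reconstruction_approximation \<Omega> I Rec k"
      and B: "reconstruction_consistency \<Omega> I Vh Qh Rec k" for k
  proof -
    obtain CB where CB: "\<And>h g. h \<in> I \<Longrightarrow> g \<in> Sobolev (k - 1) \<Omega> \<Longrightarrow>
        dual_norm \<Omega> (Vh h) (Qh h) (compl_op (Rec h)) g \<le> CB * h ^ k * Sobolev_norm (k - 1) \<Omega> g"
      using B unfolding reconstruction_consistency_def by blast
    obtain CA where "0 \<le> CA" and CA: "\<And>h w. h \<in> I \<Longrightarrow> w \<in> H10 \<Omega> \<Longrightarrow> w \<in> Sobolev (k + 1) \<Omega> \<Longrightarrow> div_free w \<Longrightarrow>
        dual_norm \<Omega> (Vh h) (Qh h) (Rec h) (\<lambda>x. w x - Rec h (S h w) x) \<le>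
          CA * h ^ (k + 1) * Sobolev_norm (k + 1) \<Omega> w"
      using reconstruction_dual_norm_bound[OF approx k reg A] by blast
    let ?C = "max CA CB"
    have "dual_norm \<Omega> (Vh h) (Qh h) (compl_op (Rec h)) (laplacian \<Omega> w)
          \<le> ?C * h ^ k * Sobolev_norm (k - 1) \<Omega> (laplacian \<Omega> w) \<and>
        dual_norm \<Omega> (Vh h) (Qh h) (Rec h) (\<lambda>x. w x - Rec h (S h w) x)
          \<le> ?C * h ^ (k + 1) * Sobolev_norm (k + 1) \<Omega> w"
      if sys: "optimality_system \<Omega> \<nu> \<alpha> f ud u z p l" and w: "w \<in> {u, z} \<inter> Sobolev (k + 1) \<Omega>"
        and h: "h \<in> I" for \<nu> \<alpha> f ud u z p l w h
    proof
      have h0: "0 < h" by (rule mesh_pos[OF h])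
      have "w \<in> H10 \<Omega>" "div_free w"
        using sys w by (auto simp: optimality_system_def div_free_def)
      with w have "dual_norm \<Omega> (Vh h) (Qh h) (Rec h) (\<lambda>x. w x - Rec h (S h w) x) \<le>
          CA * h ^ (k + 1) * Sobolev_norm (k + 1) \<Omega> w"
        by (intro CA h) auto
      also have "\<dots> \<le> ?C * h ^ (k + 1) * Sobolev_norm (k + 1) \<Omega> w"
        using h0 by (intro mult_right_mono Sobolev_norm_nonneg) auto
      finally show "dual_norm \<Omega> (Vh h) (Qh h) (Rec h) (\<lambda>x. w x - Rec h (S h w) x)
          \<le> ?C * h ^ (k + 1) * Sobolev_norm (k + 1) \<Omega> w" .
      \<comment> \<open>Subtraction on naturals is truncated; \<open>k \<ge> 1\<close> ensures that
        the Laplacian of \<open>w\<close> has the order \<open>k - 1\<close> at which (B)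
        applies.\<close>
      have "k - 1 + 2 = k + 1" using k by simp
      then have "laplacian \<Omega> w \<in> Sobolev (k - 1) \<Omega>"
        using laplacian_Sobolev[of w "k - 1"] w by (simp only: Int_iff)
      from CB[OF h this]
      show "dual_norm \<Omega> (Vh h) (Qh h) (compl_op (Rec h)) (laplacian \<Omega> w)
          \<le> ?C * h ^ k * Sobolev_norm (k - 1) \<Omega> (laplacian \<Omega> w)"
        by (rule order_trans) (use h0 in \<open>intro mult_right_mono Sobolev_norm_nonneg; simp\<close>)
    qed
    then show ?thesis by blast
  qed
  show ?thesis
  proof (rule conjI, goal_cases)
    case 1
    show ?case by (intro allI ballI impI) (rule energy_error_bound; assumption)
  next
    case 2
    show ?case by (intro allI impI) (rule rates)
  qed
qed

end
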